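(* Assume that $\mathcal T_h$ admits a partition $\mathcal M_h$ into vertex-star macroelements belonging to the fixed finite set of equivalence classes $\mathcal E_{\hat M_1},\dots,\mathcal E_{\hat M_n}$. Then the following discrete problem (the MSMFE-1 method) has a unique solution: find $\sigma_h\in\mathbb X_h$, $u_h\in V_h$, $\gamma_h\in\mathbb W_h^1$ such that $$(A\sigma_h,\tau)_Q+(u_h,\operatorname{div}\tau)+(\gamma_h,\tau)_Q=\langle g,\tau n\rangle_{\Gamma_D}\quad\forall\tau\in\mathbb X_h,$$ $$(\operatorname{div}\sigma_h,v)=(f,v)\quad\forall v\in V_h,$$ $$(\sigma_h,\xi)_Q=0\quad\forall\xi\in\mathbb W_h^1.$$
   Context: $d\in\{2,3\}$; $\Omega\subset\mathbb R^d$ is a simply connected bounded polygonal (polyhedral) domain with outward unit normal $n$; $\partial\Omega=\Gamma_D\cup\Gamma_N$ with $\Gamma_D\neq\emptyset$. $\mathbb M,\mathbb S,\mathbb N$ are the real $d\times d$ matrices, symmetric matrices and skew-symmetric matrices. $A=A(x)$, $x\in\Omega$, is at each point a symmetric linear operator $\mathbb M\to\mathbb M$ (mapping $\mathbb S$ to $\mathbb S$), bounded and uniformly positive definite in $x$. $f$ is a given $L^2$ vector field and $g$ given boundary data on $\Gamma_D$. The divergence of a matrix field is taken row-wise. $(\cdot,\cdot)$ is the $L^2(\Omega)$ inner product (Frobenius product for matrices), $\langle\cdot,\cdot\rangle_S$ the $L^2(S)$ inner product or duality pairing. $\mathbb X=\{\tau\in L^2(\Omega,\mathbb M):\operatorname{div}\tau\in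 L^2(\Omega,\mathbb R^d),\ \tau n=0\text{ on }\Gamma_N\}$, $V=L^2(\Omega,\mathbb R^d)$, $\mathbb W=L^2(\Omega,\mathbb N)$. $\mathcal T_h$ is a shape-regular, quasi-uniform conforming partition of $\Omega$ into triangles ($d=2$) or tetrahedra ($d=3$) of maximum diameter $h$; each boundary facet is contained in $\overline{\Gamma_D}$ or in $\overline{\Gamma_N}$. Finite element spaces: $\mathbb X_h=\{\tau\in\mathbb X:\tau|_E\in\mathcal P_1(E)^{d\times d}\ \forall E\in\mathcal T_h\}$ (each row in the lowest order Brezzi-Douglas-Marini space), $V_h=\{v\in V: v|_E\in\mathcal P_0(E)^d\ \forall E\}$, $\mathbb W_h^1=\{\xi\in\mathcal C(\Omega,\mathbb N):\xi|_E\text{ has entries in }\mathcal P_1(E)\ \forall E\}$ (continuous piecewise linear skew-symmetric fields). Vertex quadrature: for an element $E$ with vertices $\mathbf r_1,\dots,\mathbf r_s$, $s=d+1$, $(\varphi,\psi)_{Q,E}=\frac{|E|}{s}\sum_{i=1}^s\varphi(\mathbf r_i):\psi(\mathbf r_i)$, with the values at $\mathbf r_i$ taken from within $E$, and $(\varphi,\psi)_Q=\sum_{E\in\mathcal T_h}(\varphi,\psi)_{Q,E}$. Macroelements: a macroelement is a connected, shape-regular union of neighboring simplices. A vertex-star macroelement is the union of all simplices of $\mathcal T_h$ that share a given interior vertex $c$ of $\mathcal T_h$; $c$ is its only interior vertex. A macroelement $M$ is equivalent to a reference macroelement $\hat M=\cup_{j=1}^m\hat T_j$ if there is a continuous one-to-one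 map $F_M:\hat M\to M$ with $F_M(\hat M)=M$, $M=\cup_{j=1}^m T_j$ with $T_j=F_M(\hat T_j)$, and $F_M|_{\hat T_j}=F_{T_j}\circ F_{\hat T_j}^{-1}$, where $F_{\hat T_j},F_{T_j}$ are the affine maps from the reference simplex onto $\hat T_j,T_j$. $\mathcal E_{\hat M}$ denotes the family of macroelements equivalent to $\hat M$. The classes $\mathcal E_{\hat M_1},\dots,\mathcal E_{\hat M_n}$ are fixed (independent of $h$). *)

theory Defs
  imports "HOL-Analysis.Analysis" "HOL-Library.Disjoint_Sets"
begin

text \<open>The domain is the interior of a finite union of polytopes, so slits are excluded;
  neither convexity nor a Lipschitz boundary is required.\<close>

definition polyhedral_domain :: "'a::euclidean_space set \<Rightarrow> bool" where
  "polyhedral_domain \<Omega> \<longleftrightarrow> \<Omega> \<noteq> {} \<and> open \<Omega> \<and> connected \<Omega> \<and> bounded \<Omega> \<and>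
     (\<exists>P. finite P \<and> (\<forall>p\<in>P. polytope p) \<and> \<Omega> = interior (\<Union>P))"

text \<open>The boundary splits into disjoint parts. The Dirichlet part is nonempty in the sense that
  it contains a nonempty relatively open piece of the boundary: if it were only, say, a
  single point, no boundary facet would carry a Dirichlet condition.\<close>

definition boundary_partition :: "'a::euclidean_space set \<Rightarrow> 'a set \<Rightarrow> 'a set \<Rightarrow> bool" where
  "boundary_partition \<Omega> \<Gamma>D \<Gamma>N \<longleftrightarrow>
     \<Gamma>D \<union> \<Gamma>N = frontier \<Omega> \<and> \<Gamma>D \<inter> \<Gamma>N = {} \<and> \<Gamma>D \<in> sets borel \<and>
     (\<exists>U. openin (top_of_set (frontier \<Omega>)) U \<and> U \<noteq> {} \<and> U \<subseteq> \<Gamma>D)"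

text \<open>Elements are closed simplices; \<^const>\<open>triangulation\<close> says that there are finitely many
  and that any two of them meet in a common (possibly empty) face.\<close>

definition simplicial_mesh :: "'a::euclidean_space set set \<Rightarrow> bool" where
  "simplicial_mesh T \<longleftrightarrow> T \<noteq> {} \<and> triangulation T \<and> (\<forall>E\<in>T. int DIM('a) simplex E)"

definition mesh_of :: "'a::euclidean_space set \<Rightarrow> 'a set set \<Rightarrow> bool" where
  "mesh_of \<Omega> T \<longleftrightarrow> simplicial_mesh T \<and> \<Union>T = closure \<Omega>"

definition vertices :: "'a::euclidean_space set \<Rightarrow> 'a set" where
  "vertices E = {r. r extreme_point_of E}"

definition boundary_facets :: "'a::euclidean_space set \<Rightarrow> 'a set \<Rightarrow> 'a set set" where
  "boundary_facets \<Omega> E = {F. F facet_of E \<and> F \<subseteq> frontier \<Omega>}"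

definition facets_resolve :: "'a::euclidean_space set \<Rightarrow> 'a set \<Rightarrow> 'a set \<Rightarrow> 'a set set \<Rightarrow> bool" where
  "facets_resolve \<Omega> \<Gamma>D \<Gamma>N T \<longleftrightarrow>
     (\<forall>E\<in>T. \<forall>F\<in>boundary_facets \<Omega> E. F \<subseteq> closure \<Gamma>D \<or> F \<subseteq> closure \<Gamma>N)"

definition mesh_size :: "'a::euclidean_space set set \<Rightarrow> real" where
  "mesh_size T = Max (diameter ` T)"

definition shape_regular :: "real \<Rightarrow> 'a::euclidean_space set set \<Rightarrow> bool" where
  "shape_regular \<kappa> T \<longleftrightarrow> \<kappa> > 0 \<and> (\<forall>E\<in>T. \<exists>x. cball x (diameter E / \<kappa>) \<subseteq> E)"

definition quasi_uniform :: "real \<Rightarrow> 'a::euclidean_space set set \<Rightarrow> bool" where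
  "quasi_uniform C T \<longleftrightarrow> C > 0 \<and> (\<forall>E\<in>T. mesh_size T \<le> C * diameter E)"

text \<open>A macroelement is represented by the set of its simplices; the point set it occupies is
  the union of that set.\<close>

definition macroelement :: "real \<Rightarrow> 'a::euclidean_space set set \<Rightarrow> bool" where
  "macroelement \<kappa> M \<longleftrightarrow> simplicial_mesh M \<and> connected (\<Union>M) \<and> shape_regular \<kappa> M"

definition vertex_star :: "'a::euclidean_space set set \<Rightarrow> 'a \<Rightarrow> 'a set set" where
  "vertex_star T c = {E\<in>T. c \<in> vertices E}"

definition reference_simplex :: "'a::euclidean_space set" where
  "reference_simplex = convex hull (insert 0 Basis)"

definition affine_onto :: "('a::euclidean_space \<Rightarrow> 'a) \<Rightarrow> 'a set \<Rightarrow> bool" where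
  "affine_onto f S \<longleftrightarrow> (\<exists>L b. linear L \<and> f = (\<lambda>x. L x + b)) \<and> f ` reference_simplex = S"

text \<open>The affine map from the reference simplex onto a simplex is determined only up to the
  numbering of the vertices, hence the existential quantifiers over these maps.\<close>

definition macro_equivalent :: "'a::euclidean_space set set \<Rightarrow> 'a set set \<Rightarrow> bool" where
  "macro_equivalent M' M \<longleftrightarrow>
     (\<exists>F. continuous_on (\<Union>M') F \<and> inj_on F (\<Union>M') \<and> F ` (\<Union>M') = \<Union>M \<and>
          bij_betw (\<lambda>S. F ` S) M' M \<and>
          (\<forall>S\<in>M'. \<exists>a b. affine_onto a S \<and> affine_onto b (F ` S) \<and>
                   (\<forall>x\<in>S. F x = b (inv_into reference_simplex a x))))"

definition macro_class :: "real \<Rightarrow> 'a::euclidean_space set set \<Rightarrow> 'a set set set" where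
  "macro_class \<kappa> M' = {M. macroelement \<kappa> M \<and> macro_equivalent M' M}"

definition vertex_star_partition ::
  "real \<Rightarrow> 'a::euclidean_space set set set \<Rightarrow> 'a set \<Rightarrow> 'a set set \<Rightarrow> 'a set set set \<Rightarrow> bool" where
  "vertex_star_partition \<kappa> \<R> \<Omega> T \<M> \<longleftrightarrow> partition_on T \<M> \<and>
     (\<forall>M\<in>\<M>. (\<exists>c\<in>\<Omega>. c \<in> \<Union>(vertices ` T) \<and> M = vertex_star T c) \<and>
              (\<exists>M'\<in>\<R>. M \<in> macro_class \<kappa> M'))"

text \<open>Elements of Lebesgue spaces are represented by functions; only their values almost
  everywhere in the domain matter. On matrices, the inner product is the Frobenius product.\<close>

definition L2 :: "'a::euclidean_space set \<Rightarrow> ('a \<Rightarrow> 'b::euclidean_space) set" where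
  "L2 \<Omega> = {w. w \<in> borel_measurable (lebesgue_on \<Omega>) \<and>
               integrable (lebesgue_on \<Omega>) (\<lambda>x. (norm (w x))\<^sup>2)}"

definition L2_inner :: "'a::euclidean_space set \<Rightarrow> ('a \<Rightarrow> 'b::euclidean_space) \<Rightarrow> ('a \<Rightarrow> 'b) \<Rightarrow> real" where
  "L2_inner \<Omega> v w = integral\<^sup>L (lebesgue_on \<Omega>) (\<lambda>x. v x \<bullet> w x)"

definition C1_field :: "(real^'n \<Rightarrow> real^'n) \<Rightarrow> bool" where
  "C1_field \<phi> \<longleftrightarrow> (\<forall>x. \<phi> differentiable (at x)) \<and> continuous_on UNIV (\<lambda>x. jacobian \<phi> (at x))"

text \<open>Row-wise distributional divergence: row \<open>i\<close> of the matrix is paired with the gradient of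
  component \<open>i\<close> of the test field, which is row \<open>i\<close> of the Jacobian. Continuously
  differentiable test fields give the same notion as smooth ones, by mollification.\<close>

definition has_weak_div ::
  "(real^'n) set \<Rightarrow> (real^'n \<Rightarrow> real^'n^'n) \<Rightarrow> (real^'n \<Rightarrow> real^'n) \<Rightarrow> bool" where
  "has_weak_div \<Omega> \<tau> w \<longleftrightarrow>
     (\<forall>\<phi>. C1_field \<phi> \<and> compact (closure {x. \<phi> x \<noteq> 0}) \<and> closure {x. \<phi> x \<noteq> 0} \<subseteq> \<Omega> \<longrightarrow>
          L2_inner \<Omega> w \<phi> = - L2_inner \<Omega> \<tau> (\<lambda>x. jacobian \<phi> (at x)))"

definition weak_div ::
  "(real^'n) set \<Rightarrow> (real^'n \<Rightarrow> real^'n^'n) \<Rightarrow> (real^'n \<Rightarrow> real^'n)" where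
  "weak_div \<Omega> \<tau> = (SOME w. w \<in> L2 \<Omega> \<and> has_weak_div \<Omega> \<tau> w)"

text \<open>The normal trace of a field with square integrable divergence is defined by Green's
  formula; it vanishes on a part \<open>\<Gamma>\<close> of the boundary iff its pairing with every test field that
  vanishes on the rest of the boundary is zero.\<close>

definition normal_trace_zero ::
  "(real^'n) set \<Rightarrow> (real^'n) set \<Rightarrow> (real^'n \<Rightarrow> real^'n^'n) \<Rightarrow> bool" where
  "normal_trace_zero \<Omega> \<Gamma> \<tau> \<longleftrightarrow>
     (\<forall>\<phi>. C1_field \<phi> \<and> (\<forall>x\<in>frontier \<Omega> - \<Gamma>. \<phi> x = 0) \<longrightarrow>
          L2_inner \<Omega> \<tau> (\<lambda>x. jacobian \<phi> (at x)) + L2_inner \<Omega> (weak_div \<Omega> \<tau>) \<phi> = 0)"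

definition stress_space ::
  "(real^'n) set \<Rightarrow> (real^'n) set \<Rightarrow> (real^'n \<Rightarrow> real^'n^'n) set" where
  "stress_space \<Omega> \<Gamma>N =
     {\<tau> \<in> L2 \<Omega>. (\<exists>w \<in> L2 \<Omega>. has_weak_div \<Omega> \<tau> w) \<and> normal_trace_zero \<Omega> \<Gamma>N \<tau>}"

text \<open>Piecewise polynomials are prescribed on the open simplices only, because their one-sided
  values on a common facet may differ.\<close>

definition P1_on :: "'a::euclidean_space set \<Rightarrow> ('a \<Rightarrow> 'b::euclidean_space) \<Rightarrow> bool" where
  "P1_on E w \<longleftrightarrow> (\<exists>L b. linear L \<and> (\<forall>x\<in>interior E. w x = L x + b))"

definition P0_on :: "'a::euclidean_space set \<Rightarrow> ('a \<Rightarrow> 'b::euclidean_space) \<Rightarrow> bool" where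
  "P0_on E w \<longleftrightarrow> (\<exists>b. \<forall>x\<in>interior E. w x = b)"

definition Xh ::
  "(real^'n) set \<Rightarrow> (real^'n) set \<Rightarrow> (real^'n) set set \<Rightarrow> (real^'n \<Rightarrow> real^'n^'n) set" where
  "Xh \<Omega> \<Gamma>N T = {\<tau> \<in> stress_space \<Omega> \<Gamma>N. \<forall>E\<in>T. P1_on E \<tau>}"

definition Vh :: "(real^'n) set \<Rightarrow> (real^'n) set set \<Rightarrow> (real^'n \<Rightarrow> real^'n) set" where
  "Vh \<Omega> T = {v \<in> L2 \<Omega>. \<forall>E\<in>T. P0_on E v}"

definition symmetric_mat :: "real^'n^'n \<Rightarrow> bool" where
  "symmetric_mat S \<longleftrightarrow> transpose S = S"

definition skew_mat :: "real^'n^'n \<Rightarrow> bool" where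
  "skew_mat S \<longleftrightarrow> transpose S = - S"

definition Wh1 :: "(real^'n) set \<Rightarrow> (real^'n) set set \<Rightarrow> (real^'n \<Rightarrow> real^'n^'n) set" where
  "Wh1 \<Omega> T = {\<xi>. continuous_on \<Omega> \<xi> \<and> (\<forall>x\<in>\<Omega>. skew_mat (\<xi> x)) \<and> (\<forall>E\<in>T. P1_on E \<xi>)}"

definition value_from :: "'a::euclidean_space set \<Rightarrow> ('a \<Rightarrow> 'b::euclidean_space) \<Rightarrow> 'a \<Rightarrow> 'b" where
  "value_from E \<phi> r = Lim (at r within interior E) \<phi>"

definition quad_elem ::
  "'a::euclidean_space set \<Rightarrow> ('a \<Rightarrow> 'b::euclidean_space) \<Rightarrow> ('a \<Rightarrow> 'b) \<Rightarrow> real" where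
  "quad_elem E \<phi> \<psi> = measure lebesgue E / real (DIM('a) + 1) *
     (\<Sum>r\<in>vertices E. value_from E \<phi> r \<bullet> value_from E \<psi> r)"

definition quad ::
  "'a::euclidean_space set set \<Rightarrow> ('a \<Rightarrow> 'b::euclidean_space) \<Rightarrow> ('a \<Rightarrow> 'b) \<Rightarrow> real" where
  "quad T \<phi> \<psi> = (\<Sum>E\<in>T. quad_elem E \<phi> \<psi>)"

definition outward_normal :: "'a::euclidean_space set \<Rightarrow> 'a set \<Rightarrow> 'a" where
  "outward_normal E F =
     (THE n. norm n = 1 \<and> (\<exists>b. E \<subseteq> {x. n \<bullet> x \<le> b} \<and> F = E \<inter> {x. n \<bullet> x = b}))"

text \<open>Surface measure on a polytope \<open>F\<close> of codimension one: the orthogonal projection to its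
  hyperplane of the Lebesgue measure on the prism of height one over \<open>F\<close>.\<close>

definition surface_measure :: "'a::euclidean_space set \<Rightarrow> 'a measure" where
  "surface_measure F =
     (let n = (SOME n. norm n = 1 \<and> (\<forall>x\<in>F. \<forall>y\<in>F. n \<bullet> (x - y) = 0));
          prism = {x + t *\<^sub>R n |x t. x \<in> F \<and> 0 \<le> t \<and> t \<le> 1}
      in completion (distr (restrict_space lborel prism) borel (closest_point (affine hull F))))"

text \<open>Square integrability on a part of a polyhedral boundary, stated on every flat piece of the
  boundary so as not to depend on a mesh.\<close>

definition L2_boundary :: "'a::euclidean_space set \<Rightarrow> 'a set \<Rightarrow> ('a \<Rightarrow> 'b::euclidean_space) set" where
  "L2_boundary \<Omega> \<Gamma> = {g. \<forall>F. polytope F \<and> aff_dim F = int DIM('a) - 1 \<and> F \<subseteq> frontier \<Omega> \<longrightarrow>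
     set_borel_measurable (surface_measure F) \<Gamma> g \<and>
     set_integrable (surface_measure F) \<Gamma> (\<lambda>x. (norm (g x))\<^sup>2)}"

text \<open>The normal trace of a discrete stress is affine on each boundary facet, so its pairing with
  boundary data is an integral; data of class \<open>H\<^sup>1\<^sup>/\<^sup>2\<close>, for which the pairing
  is usually written as a duality, are in particular square integrable.\<close>

definition boundary_pairing ::
  "(real^'n) set \<Rightarrow> (real^'n) set \<Rightarrow> (real^'n) set set \<Rightarrow> (real^'n \<Rightarrow> real^'n) \<Rightarrow>
   (real^'n \<Rightarrow> real^'n^'n) \<Rightarrow> real" where
  "boundary_pairing \<Omega> \<Gamma> T g \<tau> = (\<Sum>E\<in>T. \<Sum>F\<in>boundary_facets \<Omega> E.
     (LINT x:\<Gamma>|surface_measure F. g x \<bullet> (value_from E \<tau> x *v outward_normal E F)))"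

definition compliance_tensor :: "(real^'n) set \<Rightarrow> (real^'n \<Rightarrow> real^'n^'n \<Rightarrow> real^'n^'n) \<Rightarrow> bool" where
  "compliance_tensor \<Omega> A \<longleftrightarrow>
     (\<forall>x\<in>\<Omega>. linear (A x) \<and> (\<forall>S R. A x S \<bullet> R = S \<bullet> A x R) \<and>
            (\<forall>S. symmetric_mat S \<longrightarrow> symmetric_mat (A x S))) \<and>
     (\<exists>C. \<forall>x\<in>\<Omega>. \<forall>S. norm (A x S) \<le> C * norm S) \<and>
     (\<exists>\<alpha>>0. \<forall>x\<in>\<Omega>. \<forall>S. A x S \<bullet> S \<ge> \<alpha> * (norm S)\<^sup>2)"

text \<open>The quadrature rule presupposes that the coefficient has a value at each vertex of each
  element, taken from within that element.\<close>

definition has_vertex_values ::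
  "(real^'n) set set \<Rightarrow> (real^'n \<Rightarrow> real^'n^'n \<Rightarrow> real^'n^'n) \<Rightarrow> bool" where
  "has_vertex_values T A \<longleftrightarrow>
     (\<forall>E\<in>T. \<forall>r\<in>vertices E. \<forall>S. \<exists>R. ((\<lambda>x. A x S) \<longlongrightarrow> R) (at r within interior E))"

definition msmfe1_solution ::
  "(real^'n) set \<Rightarrow> (real^'n) set \<Rightarrow> (real^'n) set \<Rightarrow> (real^'n) set set \<Rightarrow>
   (real^'n \<Rightarrow> real^'n^'n \<Rightarrow> real^'n^'n) \<Rightarrow> (real^'n \<Rightarrow> real^'n) \<Rightarrow> (real^'n \<Rightarrow> real^'n) \<Rightarrow>
   (real^'n \<Rightarrow> real^'n^'n) \<Rightarrow> (real^'n \<Rightarrow> real^'n) \<Rightarrow> (real^'n \<Rightarrow> real^'n^'n) \<Rightarrow> bool" where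
  "msmfe1_solution \<Omega> \<Gamma>D \<Gamma>N T A f g \<sigma> u \<gamma> \<longleftrightarrow>
     \<sigma> \<in> Xh \<Omega> \<Gamma>N T \<and> u \<in> Vh \<Omega> T \<and> \<gamma> \<in> Wh1 \<Omega> T \<and>
     (\<forall>\<tau>\<in>Xh \<Omega> \<Gamma>N T.
        quad T (\<lambda>x. A x (\<sigma> x)) \<tau> + L2_inner \<Omega> u (weak_div \<Omega> \<tau>) + quad T \<gamma> \<tau>
          = boundary_pairing \<Omega> \<Gamma>D T g \<tau>) \<and>
     (\<forall>v\<in>Vh \<Omega> T. L2_inner \<Omega> (weak_div \<Omega> \<sigma>) v = L2_inner \<Omega> f v) \<and>
     (\<forall>\<xi>\<in>Wh1 \<Omega> T. quad T \<sigma> \<xi> = 0)"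

end

theory Submission
  imports Defs
begin

text \<open>The discrete problem is a finite-dimensional linear system whose bilinear form is symmetric, so
existence for all data follows as soon as a triple \<open>(\<sigma>, u, \<gamma>)\<close> that is annihilated by the form vanishes
(\<open>bilinear_problem_solvable\<close>, \<open>mixed_form_nondegenerate\<close>). Testing such a triple with
\<open>(\<sigma>, -u, -\<gamma>)\<close> leaves \<open>(A \<sigma>, \<sigma>)\<^sub>Q = 0\<close>, and since the limits of \<open>A\<close> at the vertices are still positive
definite, \<open>\<sigma> = 0\<close>. What remains is the inf-sup part: \<open>(u, div \<tau>) + (\<gamma>, \<tau>)\<^sub>Q = 0\<close> for all \<open>\<tau>\<close> must
force \<open>u = 0\<close> and \<open>\<gamma> = 0\<close>.

The vertex quadrature turns this into algebra. Let \<open>p\<close> be a vertex of an element \<open>E\<close>, let \<open>r\<close> be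
a vertex of the opposite facet and \<open>e\<close> a vector. The field \<open>\<lambda>\<^sub>r / |E|\<close> times the outer product
of \<open>e\<close> and \<open>r - p\<close>, with \<open>\<lambda>\<^sub>r\<close> the barycentric coordinate of \<open>r\<close>, vanishes at all vertices
but \<open>r\<close>, and its direction is tangential to every facet through \<open>r\<close> except the one opposite to
\<open>p\<close>. The difference of two such fields from both sides of an interior facet lies in
the stress space, and so does a single one on a Dirichlet facet; these are the
Brezzi-Douglas-Marini basis functions (\<open>interior_facet_field\<close>, \<open>dirichlet_facet_field\<close>). With
\<open>d\<close> the dimension, with \<open>E'\<close> the element across the facet and \<open>p'\<close> its opposite vertex, testing
with them gives
\<open>(d + 1) (u\<^sub>E - u\<^sub>E') + \<gamma>(r) (p' - p) = 0\<close> on interior facets and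
\<open>(d + 1) u\<^sub>E + \<gamma>(r) (r - p) = 0\<close> on a Dirichlet facet.

Subtracting the first equation at two vertices \<open>c\<close> and \<open>s\<close> of a facet shows that
\<open>D = \<gamma>(s) - \<gamma>(c)\<close> annihilates \<open>p' - p\<close>. In the plane a nonzero skew matrix is
injective. In space its kernel is a line. Follow every second vertex of the link on a walk around
the edge \<open>cs\<close>: each displacement lies on that line and always points the same way, which is impossible
with finitely many vertices (\<open>kernel_rotation_local\<close>). The walk never meets the boundary when
\<open>c\<close> is an interior vertex, and the partition into vertex stars provides such a
vertex for every element. Hence \<open>\<gamma>\<close> is constant on each element, and then on the mesh; the
equations on a Dirichlet facet put the directions of that facet into its kernel, which is more
than a nonzero skew matrix allows. Finally \<open>u\<close> is equal across interior facets
and zero next to the Dirichlet facet (\<open>kernel_trivial\<close>).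

Two ingredients carry the passage from analysis to algebra. Green's formula for the basis fields
needs no surface integrals: the boundary term is written as an integral over the element, which
depends only on the facet because the affine map that fixes the facet and moves \<open>p\<close> to \<open>p'\<close> carries
one integral to the other, up to an integral of a directional derivative that vanishes by
translation invariance (\<open>edge_flux_shared_facet\<close>). On the side of the mesh, a generic segment
misses all faces of codimension two, which yields both the connectedness of the mesh through
interior facets and a boundary facet of Dirichlet type (\<open>convex_open_covered\<close>).\<close>

section \<open>Solvability of finite-dimensional bilinear problems\<close>

text \<open>Here \<open>cb z c w\<close> stands for \<open>z + c w\<close>. The discrete spaces are sets of triples of functions, which
carry no vector space structure as types and in which functions with equal values inside all
elements have to be identified; passing the operation as a parameter avoids forming the quotient.\<close>

definition comb_closed :: "('z \<Rightarrow> real \<Rightarrow> 'z \<Rightarrow> 'z) \<Rightarrow> 'z set \<Rightarrow> bool" where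
  "comb_closed cb Z \<longleftrightarrow> (\<forall>z\<in>Z. \<forall>w\<in>Z. \<forall>c. cb z c w \<in> Z)"

definition comb_linear :: "('z \<Rightarrow> real \<Rightarrow> 'z \<Rightarrow> 'z) \<Rightarrow> 'z set \<Rightarrow> ('z \<Rightarrow> real) \<Rightarrow> bool" where
  "comb_linear cb Z f \<longleftrightarrow> (\<forall>z\<in>Z. \<forall>w\<in>Z. \<forall>c. f (cb z c w) = f z + c * f w)"

text \<open>One functional \<open>f k\<close> is removed at a time: either \<open>f k\<close> is implied by the rest, or some \<open>w\<close>
in the kernel of the rest has \<open>f k w \<noteq> 0\<close>, and subtracting from \<open>l\<close> the multiple of \<open>f k\<close> that
agrees with \<open>l\<close> at \<open>w\<close> makes it vanish on the kernel of the rest.\<close>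

lemma functional_in_span:
  assumes "finite I" "comb_closed cb Z"
    and "\<And>i. i \<in> I \<Longrightarrow> comb_linear cb Z (f i)" "comb_linear cb Z l"
    and "\<And>z. z \<in> Z \<Longrightarrow> \<forall>i\<in>I. f i z = 0 \<Longrightarrow> l z = 0"
  shows "\<exists>c. \<forall>z\<in>Z. l z = (\<Sum>i\<in>I. c i * f i z)"
  using assms(1,3-)
proof (induction I arbitrary: l rule: finite_induct)
  case empty
  then show ?case by simp
next
  case (insert k I)
  note lin = insert.prems(1)[unfolded comb_linear_def] and linl = insert.prems(2)[unfolded comb_linear_def]
  note cl = assms(2)[unfolded comb_closed_def]
  show ?case
  proof (cases "\<exists>w\<in>Z. (\<forall>i\<in>I. f i w = 0) \<and> f k w \<noteq> 0")
    case True
    then obtain w where w: "w \<in> Z" "\<And>i. i \<in> I \<Longrightarrow> f i w = 0" "f k w \<noteq> 0" by auto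
    define a where "a = l w / f k w"
    have "\<exists>c. \<forall>z\<in>Z. l z - a * f k z = (\<Sum>i\<in>I. c i * f i z)"
    proof (rule insert.IH)
      show "comb_linear cb Z (\<lambda>z. l z - a * f k z)"
        using lin[of k] linl by (simp add: comb_linear_def algebra_simps)
      fix z assume z: "z \<in> Z" "\<forall>i\<in>I. f i z = 0"
      define y where "y = cb z (- (f k z / f k w)) w"
      have "y \<in> Z" using z w cl by (auto simp: y_def)
      moreover have "\<forall>i\<in>insert k I. f i y = 0" using z w lin by (auto simp: y_def)
      ultimately have "l y = 0" using insert.prems(3) by blast
      then show "l z - a * f k z = 0" using z w linl by (simp add: y_def a_def field_simps)
    qed (use insert.prems in auto)
    then obtain c where c: "\<forall>z\<in>Z. l z - a * f k z = (\<Sum>i\<in>I. c i * f i z)" by blast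
    have "(\<Sum>i\<in>insert k I. (c(k := a)) i * f i z) = a * f k z + (\<Sum>i\<in>I. c i * f i z)" for z
      using insert.hyps by (auto intro: sum.cong)
    then show ?thesis using c by (metis add.commute diff_add_cancel)
  next
    case False
    have "\<exists>c. \<forall>z\<in>Z. l z = (\<Sum>i\<in>I. c i * f i z)"
      by (rule insert.IH) (use insert.prems False in auto)
    then obtain c where c: "\<forall>z\<in>Z. l z = (\<Sum>i\<in>I. c i * f i z)" by blast
    have "(\<Sum>i\<in>insert k I. (c(k := 0)) i * f i z) = (\<Sum>i\<in>I. c i * f i z)" for z
      using insert.hyps by (auto intro: sum.cong)
    then show ?thesis using c by metis
  qed
qed

text \<open>This replaces the choice of a basis. Functionals that factor through the finitely many values
\<open>e k\<close> live on a finite-dimensional quotient, so finitely many elements decide whether they vanish.\<close>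

lemma finite_determining_set:
  assumes "finite K" "comb_closed cb Z" "\<And>k. k \<in> K \<Longrightarrow> comb_linear cb Z (e k)"
  shows "\<exists>S. finite S \<and> S \<subseteq> Z \<and>
    (\<forall>m. comb_linear cb Z m \<longrightarrow> (\<forall>z\<in>Z. (\<forall>k\<in>K. e k z = 0) \<longrightarrow> m z = 0) \<longrightarrow>
         (\<forall>s\<in>S. m s = 0) \<longrightarrow> (\<forall>z\<in>Z. m z = 0))"
  using assms
proof (induction K arbitrary: Z rule: finite_induct)
  case empty
  then show ?case by (intro exI[of _ "{}"]) auto
next
  case (insert k K)
  note cl = insert.prems(1)[unfolded comb_closed_def]
  note lin = insert.prems(2)[unfolded comb_linear_def]
  define Z' where "Z' = {z\<in>Z. e k z = 0}"
  have "comb_closed cb Z'" using cl lin by (auto simp: comb_closed_def Z'_def)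
  moreover have "comb_linear cb Z' (e j)" if "j \<in> K" for j
    using lin that by (auto simp: comb_linear_def Z'_def)
  ultimately obtain S where S: "finite S" "S \<subseteq> Z'" "\<And>m. comb_linear cb Z' m \<Longrightarrow>
      (\<forall>z\<in>Z'. (\<forall>k\<in>K. e k z = 0) \<longrightarrow> m z = 0) \<Longrightarrow> (\<forall>s\<in>S. m s = 0) \<Longrightarrow> (\<forall>z\<in>Z'. m z = 0)"
    using insert.IH[of Z'] by blast
  obtain R where R: "finite R" "R \<subseteq> Z" "R = {} \<Longrightarrow> Z = Z'" "R \<noteq> {} \<Longrightarrow> \<exists>w\<in>R. e k w \<noteq> 0"
  proof (cases "Z = Z'")
    case False
    then obtain w where "w \<in> Z" "e k w \<noteq> 0" by (auto simp: Z'_def)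
    then show ?thesis by (intro that[of "{w}"]) auto
  qed (use that[of "{}"] in auto)
  show ?case
  proof (intro exI[of _ "R \<union> S"] conjI allI impI ballI)
    fix m z assume m: "comb_linear cb Z m" "\<forall>z\<in>Z. (\<forall>k\<in>insert k K. e k z = 0) \<longrightarrow> m z = 0"
      "\<forall>s\<in>R \<union> S. m s = 0" and z: "z \<in> Z"
    have m': "\<forall>z\<in>Z'. m z = 0"
      by (rule S(3)) (use m in \<open>auto simp: comb_linear_def Z'_def\<close>)
    show "m z = 0"
    proof (cases "R = {}")
      case True then show ?thesis using R(3) m' z by blast
    next
      case False
      then obtain w where w: "w \<in> R" "w \<in> Z" "e k w \<noteq> 0" using R by blast
      have "cb z (- (e k z / e k w)) w \<in> Z'" using lin z w cl by (auto simp: Z'_def)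
      then have "m z + (- (e k z / e k w)) * m w = 0" using m' m(1) z w by (metis comb_linear_def)
      then show ?thesis using m(3) w by simp
    qed
  qed (use R S in \<open>auto simp: Z'_def\<close>)
qed

text \<open>The Fredholm alternative: the right-hand side vanishes on the common kernel of the finitely
many functionals \<open>B s\<close> with \<open>s\<close> in a determining set, hence it is a combination of them, and
the same combination of the elements \<open>s\<close> solves the problem.\<close>

lemma bilinear_problem_solvable:
  assumes "finite K" and Z: "comb_closed cb Z" "Z \<noteq> {}"
    and e: "\<And>k. k \<in> K \<Longrightarrow> comb_linear cb Z (e k)"
    and Bl: "\<And>w. w \<in> Z \<Longrightarrow> comb_linear cb Z (\<lambda>z. B z w)"
    and Br: "\<And>z. z \<in> Z \<Longrightarrow> comb_linear cb Z (\<lambda>w. B z w)"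
    and null: "\<And>z w. z \<in> Z \<Longrightarrow> w \<in> Z \<Longrightarrow> \<forall>k\<in>K. e k z = 0 \<Longrightarrow> B z w = 0"
    and l: "comb_linear cb Z l" and compat: "\<And>w. w \<in> Z \<Longrightarrow> \<forall>z\<in>Z. B z w = 0 \<Longrightarrow> l w = 0"
  shows "\<exists>z\<in>Z. \<forall>w\<in>Z. B z w = l w"
proof -
  obtain S where S: "finite S" "S \<subseteq> Z" "\<And>m. comb_linear cb Z m \<Longrightarrow>
      (\<forall>z\<in>Z. (\<forall>k\<in>K. e k z = 0) \<longrightarrow> m z = 0) \<Longrightarrow> (\<forall>s\<in>S. m s = 0) \<Longrightarrow> (\<forall>z\<in>Z. m z = 0)"
    using finite_determining_set[of K cb Z e] assms(1) Z(1) e by blast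
  have "\<exists>c. \<forall>w\<in>Z. l w = (\<Sum>s\<in>S. c s * B s w)"
  proof (rule functional_in_span[OF S(1) Z(1)])
    show "comb_linear cb Z (B s)" if "s \<in> S" for s using Br[of s] S that by auto
    fix w assume w: "w \<in> Z" "\<forall>s\<in>S. B s w = 0"
    have "\<forall>z\<in>Z. B z w = 0"
      by (rule S(3)) (use Bl w null in auto)
    then show "l w = 0" using compat w by blast
  qed (use l in auto)
  then obtain c where c: "\<forall>w\<in>Z. l w = (\<Sum>s\<in>S. c s * B s w)" by blast
  have "\<exists>z\<in>Z. \<forall>w\<in>Z. B z w = (\<Sum>s\<in>S'. c s * B s w)" if "S' \<subseteq> S" for S'
    using finite_subset[OF that S(1)] that
  proof (induction S' rule: finite_induct)
    case empty
    obtain z where z: "z \<in> Z" using Z by auto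
    have "cb z (-1) z \<in> Z" "\<forall>w\<in>Z. B (cb z (-1) z) w = 0"
      using z Z(1) Bl by (auto simp: comb_closed_def comb_linear_def)
    then show ?case by auto
  next
    case (insert s S')
    then obtain z where z: "z \<in> Z" "\<forall>w\<in>Z. B z w = (\<Sum>s\<in>S'. c s * B s w)" by auto
    have s: "s \<in> Z" using insert S by auto
    have "cb z (c s) s \<in> Z" using z s Z(1) by (auto simp: comb_closed_def)
    moreover have "\<forall>w\<in>Z. B (cb z (c s) s) w = (\<Sum>s\<in>insert s S'. c s * B s w)"
      using insert.hyps z s Bl by (auto simp: comb_linear_def)
    ultimately show ?case by blast
  qed
  from this[of S] c show ?thesis by auto
qed

section \<open>Linear images of Lebesgue measure\<close>

lemma nn_integral_lborel_translate:
  fixes f :: "'a::euclidean_space \<Rightarrow> ennreal"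
  assumes [measurable]: "f \<in> borel_measurable borel"
  shows "(\<integral>\<^sup>+x. f (a + x) \<partial>lborel) = (\<integral>\<^sup>+x. f x \<partial>lborel)"
proof -
  have "(\<integral>\<^sup>+x. f x \<partial>lborel) = (\<integral>\<^sup>+x. f x \<partial>distr lborel borel ((+) a))"
    by (simp add: lborel_distr_plus)
  then show ?thesis by (simp add: nn_integral_distr)
qed

lemma nn_integral_lborel_reflect:
  fixes f :: "'a::euclidean_space \<Rightarrow> ennreal"
  assumes [measurable]: "f \<in> borel_measurable borel"
  shows "(\<integral>\<^sup>+x. f (- x) \<partial>lborel) = (\<integral>\<^sup>+x. f x \<partial>lborel)"
proof -
  have "(\<integral>\<^sup>+x. f x \<partial>lborel) = (\<integral>\<^sup>+x. f x \<partial>(density (distr lborel borel (\<lambda>x::'a. 0 + (-1) *\<^sub>R x)) (\<lambda>_. ennreal (\<bar>-1::real\<bar>^DIM('a)))))"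
    by (subst lborel_affine[of "-1" 0, symmetric]) auto
  then show ?thesis by (simp add: nn_integral_distr nn_integral_density)
qed

text \<open>The argument for uniqueness of Haar measure: both sides equal the double integral of
\<open>f (L x + y) g y\<close>, evaluated with Tonelli's theorem in the two orders and with translation and
reflection invariance. Choosing \<open>g\<close> as the indicator of a cube shows that \<open>L\<close> scales the measure by
a constant, for an arbitrary Euclidean space and without determinants.\<close>

lemma nn_integral_linear_exchange:
  fixes f g :: "'a::euclidean_space \<Rightarrow> ennreal" and L :: "'a \<Rightarrow> 'a"
  assumes [measurable]: "f \<in> borel_measurable borel" "g \<in> borel_measurable borel"
    and L: "linear L" "bij L"
  shows "(\<integral>\<^sup>+x. f (L x) \<partial>lborel) * (\<integral>\<^sup>+y. g y \<partial>lborel) = (\<integral>\<^sup>+x. f x \<partial>lborel) * (\<integral>\<^sup>+y. g (L y) \<partial>lborel)"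
proof -
  have [measurable]: "L \<in> borel_measurable borel"
    using L(1) by (simp add: borel_measurable_continuous_onI linear_continuous_on linear_conv_bounded_linear)
  have eq1: "(\<integral>\<^sup>+y. (\<integral>\<^sup>+x. f (L x + y) * g y \<partial>lborel) \<partial>lborel) = (\<integral>\<^sup>+x. f (L x) \<partial>lborel) * (\<integral>\<^sup>+y. g y \<partial>lborel)"
  proof -
    have "(\<integral>\<^sup>+x. f (L x + y) * g y \<partial>lborel) = (\<integral>\<^sup>+x. f (L x) \<partial>lborel) * g y" for y
    proof -
      obtain a where a: "L a = y" using L(2) by (metis bij_pointE)
      have "(\<integral>\<^sup>+x. f (L x + y) * g y \<partial>lborel) = (\<integral>\<^sup>+x. f (L (a + x)) \<partial>lborel) * g y"
        using a by (simp add: nn_integral_multc linear_add[OF L(1)] add.commute)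
      also have "(\<integral>\<^sup>+x. f (L (a + x)) \<partial>lborel) = (\<integral>\<^sup>+x. f (L x) \<partial>lborel)"
        by (rule nn_integral_lborel_translate[of "\<lambda>x. f (L x)"]) simp
      finally show ?thesis .
    qed
    then show ?thesis by (simp add: nn_integral_cmult)
  qed
  have "(\<integral>\<^sup>+y. (\<integral>\<^sup>+x. f (L x + y) * g y \<partial>lborel) \<partial>lborel) = (\<integral>\<^sup>+x. (\<integral>\<^sup>+y. f (L x + y) * g y \<partial>lborel) \<partial>lborel)"
    by (rule lborel_pair.Fubini'[symmetric]) measurable
  also have "\<dots> = (\<integral>\<^sup>+x. (\<integral>\<^sup>+y. f y * g (y - L x) \<partial>lborel) \<partial>lborel)"
  proof (rule nn_integral_cong)
    fix x
    show "(\<integral>\<^sup>+y. f (L x + y) * g y \<partial>lborel) = (\<integral>\<^sup>+y. f y * g (y - L x) \<partial>lborel)"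
      using nn_integral_lborel_translate[of "\<lambda>y. f y * g (y - L x)" "L x"] by simp
  qed
  also have "\<dots> = (\<integral>\<^sup>+y. (\<integral>\<^sup>+x. f y * g (y - L x) \<partial>lborel) \<partial>lborel)"
    by (rule lborel_pair.Fubini') measurable
  also have "\<dots> = (\<integral>\<^sup>+y. f y * (\<integral>\<^sup>+x. g (L x) \<partial>lborel) \<partial>lborel)"
  proof (rule nn_integral_cong)
    fix y
    obtain a where a: "L a = y" using L(2) by (metis bij_pointE)
    have "(\<integral>\<^sup>+x. f y * g (y - L x) \<partial>lborel) = f y * (\<integral>\<^sup>+x. g (y - L x) \<partial>lborel)"
      by (simp add: nn_integral_cmult)
    also have "(\<integral>\<^sup>+x. g (y - L x) \<partial>lborel) = (\<integral>\<^sup>+x. g (L (a - x)) \<partial>lborel)"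
      using a by (simp add: linear_diff[OF L(1)])
    also have "\<dots> = (\<integral>\<^sup>+x. g (L (a + x)) \<partial>lborel)"
      using nn_integral_lborel_reflect[of "\<lambda>x. g (L (a - x))"] by simp
    also have "\<dots> = (\<integral>\<^sup>+x. g (L x) \<partial>lborel)"
      using nn_integral_lborel_translate[of "\<lambda>x. g (L x)"] by simp
    finally show "(\<integral>\<^sup>+x. f y * g (y - L x) \<partial>lborel) = f y * (\<integral>\<^sup>+x. g (L x) \<partial>lborel)" .
  qed
  also have "\<dots> = (\<integral>\<^sup>+x. f x \<partial>lborel) * (\<integral>\<^sup>+y. g (L y) \<partial>lborel)"
    by (simp add: nn_integral_multc)
  finally show ?thesis using eq1 by simp
qed

text \<open>The factor is the measure of the preimage of the unit cube: finite because the preimage is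
bounded, and nonzero because otherwise the whole space would be a null set.\<close>

lemma lborel_distr_linear:
  fixes L :: "'a::euclidean_space \<Rightarrow> 'a"
  assumes L: "linear L" "bij L"
  shows "\<exists>c>0. distr lborel borel L = density lborel (\<lambda>_. ennreal c)"
proof -
  have [measurable]: "L \<in> borel_measurable borel"
    using L(1) by (simp add: borel_measurable_continuous_onI linear_continuous_on linear_conv_bounded_linear)
  let ?C = "cbox 0 One :: 'a set"
  define c where "c = emeasure lborel (L -` ?C)"
  have e: "emeasure lborel (L -` A) = c * emeasure lborel A" if [measurable]: "A \<in> sets borel" for A
  proof -
    have [measurable]: "L -` A \<in> sets borel" "L -` ?C \<in> sets borel"
      using measurable_sets[OF \<open>L \<in> borel_measurable borel\<close>, of A] measurable_sets[OF \<open>L \<in> borel_measurable borel\<close>, of ?C] by auto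
    have i: "indicator A (L x) = (indicator (L -` A) x :: ennreal)" for x and A :: "'a set" by (simp add: indicator_def)
    have one: "emeasure lborel ?C = 1" by (simp add: emeasure_lborel_cbox_eq)
    show ?thesis
      using nn_integral_linear_exchange[OF _ _ L, of "indicator A" "indicator ?C"]
      by (simp add: i one c_def mult.commute)
  qed
  have inj: "inj L" using L bij_is_inj by blast
  have bd: "bounded (L -` ?C)"
  proof -
    obtain M where M: "linear M" "M \<circ> L = id" using linear_injective_left_inverse[OF L(1) inj] by auto
    have "L -` ?C \<subseteq> M ` ?C" using M(2) by (metis comp_apply id_apply image_eqI subsetI vimageE)
    moreover have "bounded (M ` ?C)"
      by (intro bounded_linear_image bounded_cbox) (use M(1) linear_conv_bounded_linear in auto)
    ultimately show ?thesis using bounded_subset by blast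
  qed
  have "c < \<infinity>" unfolding c_def using emeasure_bounded_finite[OF bd] by (simp add: less_top)
  moreover have "c \<noteq> 0"
  proof
    assume "c = 0"
    then have "emeasure lborel (L -` UNIV) = 0 * emeasure lborel (UNIV::'a set)" using e[of UNIV] by simp
    then show False by simp
  qed
  ultimately obtain c' where c': "c = ennreal c'" "c' > 0"
    by (cases c) (auto simp: ennreal_eq_0_iff not_le)
  have "distr lborel borel L = density lborel (\<lambda>_. ennreal c')"
  proof (rule measure_eqI)
    fix A assume "A \<in> sets (distr lborel borel L)"
    then have A[measurable]: "A \<in> sets borel" by simp
    show "emeasure (distr lborel borel L) A = emeasure (density lborel (\<lambda>_. ennreal c')) A"
      by (simp add: emeasure_distr e c' emeasure_density nn_integral_cmult_indicator)
  qed simp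
  then show ?thesis using c' by blast
qed

lemma lebesgue_integral_affine_bijection:
  fixes L :: "'a::euclidean_space \<Rightarrow> 'a"
  assumes L: "linear L" "bij L"
  shows "\<exists>c>0. \<forall>f::'a \<Rightarrow> real. f \<in> borel_measurable borel \<longrightarrow>
    (\<integral>x. f (L x + b) \<partial>lborel) = c * (\<integral>x. f x \<partial>lborel)"
proof -
  have [measurable]: "L \<in> borel_measurable borel"
    using L(1) by (simp add: borel_measurable_continuous_onI linear_continuous_on linear_conv_bounded_linear)
  obtain c where c: "c > 0" "distr lborel borel L = density lborel (\<lambda>_. ennreal c)"
    using lborel_distr_linear[OF L] by blast
  have "(\<integral>x. f (L x + b) \<partial>lborel) = c * (\<integral>x. f x \<partial>lborel)" if [measurable]: "f \<in> borel_measurable borel" for f :: "'a \<Rightarrow> real"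
  proof -
    have "(\<integral>x. f (L x + b) \<partial>lborel) = (\<integral>x. f (x + b) \<partial>distr lborel borel L)"
      by (simp add: integral_distr)
    also have "\<dots> = c * (\<integral>x. f (b + x) \<partial>lborel)"
      using c by (simp add: integral_density add.commute)
    also have "(\<integral>x. f (b + x) \<partial>lborel) = (\<integral>x. f x \<partial>distr lborel borel ((+) b))"
      by (simp add: integral_distr)
    finally show ?thesis by (simp add: lborel_distr_plus)
  qed
  with c show ?thesis by blast
qed

section \<open>Integrals of directional derivatives\<close>

text \<open>Difference quotients of \<open>w\<close> have integral zero by translation invariance. The Lipschitz bound along
\<open>t\<close> dominates them, so the integral of the derivative, their limit, is zero as well.\<close>

lemma integral_directional_derivative_eq_0:
  fixes w w' :: "'a::euclidean_space \<Rightarrow> real"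
  assumes w: "integrable lborel w" and [measurable]: "w' \<in> borel_measurable borel"
    and supp: "bounded K" "\<And>x. x \<notin> K \<Longrightarrow> w x = 0"
    and lip: "\<And>x e. \<bar>w (x + e *\<^sub>R t) - w x\<bar> \<le> C * \<bar>e\<bar>"
    and der: "AE x in lborel. ((\<lambda>e. w (x + e *\<^sub>R t)) has_real_derivative w' x) (at 0)"
  shows "integrable lborel w'" "(\<integral>x. w' x \<partial>lborel) = 0"
proof -
  have [measurable]: "w \<in> borel_measurable borel" using w by auto
  define e where "e n = inverse (real (Suc n))" for n
  have e: "0 < e n" "e n \<le> 1" for n by (auto simp: e_def inverse_le_1_iff)
  define q where "q n x = (w (x + e n *\<^sub>R t) - w x) / e n" for n x
  obtain R where R: "\<And>x. x \<in> K \<Longrightarrow> norm x \<le> R" using supp(1) bounded_iff by blast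
  define S where "S = (cball 0 (R + norm t) :: 'a set)"
  have bnd: "norm (q n x) \<le> indicator S x * C" for n x
  proof (cases "x \<in> S")
    case True
    then show ?thesis using lip[of x "e n"] e[of n] by (simp add: q_def divide_le_eq)
  next
    case False
    then have n: "norm x > R + norm t" by (simp add: S_def)
    have "x \<notin> K" using R[of x] n norm_ge_zero[of t] by linarith
    moreover have "x + e n *\<^sub>R t \<notin> K"
    proof
      assume "x + e n *\<^sub>R t \<in> K"
      then have "norm (x + e n *\<^sub>R t) \<le> R" using R by blast
      moreover have "norm x \<le> norm (x + e n *\<^sub>R t) + norm (e n *\<^sub>R t)"
        using norm_triangle_ineq4[of "x + e n *\<^sub>R t" "e n *\<^sub>R t"] by simp
      moreover have "norm (e n *\<^sub>R t) \<le> norm t" using e[of n] by (simp add: mult_left_le_one_le)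
      ultimately show False using n by linarith
    qed
    ultimately show ?thesis using supp(2) False by (simp add: q_def)
  qed
  have lim: "AE x in lborel. (\<lambda>n. q n x) \<longlonglongrightarrow> w' x"
    using der
  proof eventually_elim
    case (elim x)
    then have "(\<lambda>h. (w (x + h *\<^sub>R t) - w x) / h) \<midarrow>0\<rightarrow> w' x" by (simp add: DERIV_def)
    moreover have "filterlim e (at 0) sequentially"
      unfolding filterlim_at e_def
      using LIMSEQ_inverse_real_of_nat by auto
    ultimately show ?case unfolding q_def by (rule filterlim_compose)
  qed
  have dom: "integrable lborel (\<lambda>x. indicator S x * C)"
    by (intro integrable_mult_left) (auto simp: S_def intro!: integrable_real_indicator emeasure_bounded_finite)
  have qm: "q n \<in> borel_measurable lborel" for n unfolding q_def by measurable
  show "integrable lborel w'"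
    by (rule integrable_dominated_convergence[OF _ qm dom lim]) (use bnd in auto)
  have "(\<lambda>n. \<integral>x. q n x \<partial>lborel) \<longlonglongrightarrow> (\<integral>x. w' x \<partial>lborel)"
    by (rule integral_dominated_convergence[OF _ qm dom lim]) (use bnd in auto)
  moreover have "(\<integral>x. q n x \<partial>lborel) = 0" for n
  proof -
    have d: "distr lborel borel ((+) (e n *\<^sub>R t)) = lborel" by (rule lborel_distr_plus)
    have i: "integrable lborel (\<lambda>x. w (e n *\<^sub>R t + x))"
      using w integrable_distr_eq[of "(+) (e n *\<^sub>R t)" lborel borel w] d by simp
    have "(\<integral>x. w (e n *\<^sub>R t + x) \<partial>lborel) = (\<integral>x. w x \<partial>lborel)"
      using integral_distr[of "(+) (e n *\<^sub>R t)" lborel borel w] d by simp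
    then show ?thesis using i w unfolding q_def by (simp add: add.commute)
  qed
  ultimately show "(\<integral>x. w' x \<partial>lborel) = 0" by (simp add: LIMSEQ_const_iff)
qed

text \<open>The divergence theorem for a field of constant direction \<open>t\<close>, in the case without boundary
contribution. If \<open>h\<close> vanishes wherever a line in direction \<open>t\<close> leaves \<open>E\<close>, then its extension by zero is
still Lipschitz along \<open>t\<close>, although it may jump across the parts of the boundary that are
parallel to \<open>t\<close>.\<close>

lemma integral_directional_derivative_convex:
  fixes h :: "'a::euclidean_space \<Rightarrow> real"
  assumes E: "compact E" "convex E"
    and der: "\<And>x. (h has_derivative h' x) (at x)" and cont: "continuous_on UNIV (\<lambda>x. h' x t)"
    and exits: "\<And>x e. x \<in> E \<Longrightarrow> x + e *\<^sub>R t \<notin> E \<Longrightarrow>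
       \<exists>d. \<bar>d\<bar> \<le> \<bar>e\<bar> \<and> x + d *\<^sub>R t \<in> E \<and> h (x + d *\<^sub>R t) = 0"
  shows "(\<integral>x. indicator E x * h' x t \<partial>lborel) = 0"
proof -
  have hc: "continuous_on UNIV h" by (intro continuous_at_imp_continuous_on ballI has_derivative_continuous[OF der])
  have [measurable]: "E \<in> sets borel" "h \<in> borel_measurable borel" "(\<lambda>x. h' x t) \<in> borel_measurable borel"
    using E hc cont by (auto intro: borel_compact borel_measurable_continuous_onI)
  define w where "w x = indicator E x * h x" for x
  obtain C where C: "\<And>x. x \<in> E \<Longrightarrow> \<bar>h' x t\<bar> \<le> C" "C \<ge> 0"
  proof -
    have "compact ((\<lambda>x. h' x t) ` E)" using compact_continuous_image continuous_on_subset[OF cont] E by blast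
    then obtain B where "\<And>y. y \<in> (\<lambda>x. h' x t) ` E \<Longrightarrow> \<bar>y\<bar> \<le> B"
      using compact_imp_bounded bounded_iff by (metis real_norm_def)
    then show ?thesis by (intro that[of "\<bar>B\<bar>"]) force+
  qed
  have line: "((\<lambda>e. h (x + e *\<^sub>R t)) has_real_derivative h' (x + s *\<^sub>R t) t) (at s within A)" for x s A
  proof -
    interpret D: bounded_linear "h' y" for y using der has_derivative_bounded_linear by blast
    have "((\<lambda>e. h (x + e *\<^sub>R t)) has_derivative (\<lambda>y. h' (x + s *\<^sub>R t) (y *\<^sub>R t))) (at s within A)"
      by (rule has_derivative_compose[OF _ der]) (auto intro!: derivative_eq_intros)
    moreover have "(\<lambda>y. h' (x + s *\<^sub>R t) (y *\<^sub>R t)) = (*) (h' (x + s *\<^sub>R t) t)"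
      by (auto simp: D.scaleR)
    ultimately show ?thesis unfolding has_field_derivative_def by (simp only:)
  qed
  have inside: "\<bar>h (x + e *\<^sub>R t) - h x\<bar> \<le> C * \<bar>e\<bar>" if "x \<in> E" "x + e *\<^sub>R t \<in> E" for x e
  proof -
    have "norm (h (x + e *\<^sub>R t) - h (x + 0 *\<^sub>R t)) \<le> C * norm (e - 0)"
    proof (rule field_differentiable_bound[of "closed_segment 0 e"])
      fix s assume "s \<in> closed_segment 0 e"
      then obtain u where u: "0 \<le> u" "u \<le> 1" "s = u * e" by (auto simp: closed_segment_def)
      have "x + s *\<^sub>R t = (1 - u) *\<^sub>R x + u *\<^sub>R (x + e *\<^sub>R t)" by (simp add: u algebra_simps)
      also have "\<dots> \<in> E" using E(2) that u by (simp add: convexD)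
      finally show "norm (h' (x + s *\<^sub>R t) t) \<le> C" using C by simp
    qed (use line in auto)
    then show ?thesis by simp
  qed
  have out: "\<bar>h x\<bar> \<le> C * \<bar>e\<bar>" if x: "x \<in> E" "x + e *\<^sub>R t \<notin> E" for x e
  proof -
    obtain d where d: "\<bar>d\<bar> \<le> \<bar>e\<bar>" "x + d *\<^sub>R t \<in> E" "h (x + d *\<^sub>R t) = 0" using exits[OF x] by blast
    have "\<bar>h x\<bar> \<le> C * \<bar>d\<bar>" using inside[OF x(1) d(2)] d(3) by simp
    also have "\<dots> \<le> C * \<bar>e\<bar>" using d C by (simp add: mult_left_mono)
    finally show ?thesis .
  qed
  have lip: "\<bar>w (x + e *\<^sub>R t) - w x\<bar> \<le> C * \<bar>e\<bar>" for x e
    using inside[of x e] out[of x e] out[of "x + e *\<^sub>R t" "-e"] C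
    by (cases "x \<in> E"; cases "x + e *\<^sub>R t \<in> E") (auto simp: w_def)
  have wi: "integrable lborel w"
  proof -
    have "set_integrable lborel E h"
      using borel_integrable_compact[OF E(1) continuous_on_subset[OF hc]]
      by (simp add: set_integrable_def indicator_def if_distrib[of "\<lambda>c. c *\<^sub>R _"] cong: if_cong)
    then show ?thesis by (simp add: set_integrable_def w_def[abs_def])
  qed
  have "negligible (frontier E)" using negligible_convex_frontier E(2) by blast
  then have "frontier E \<in> null_sets lborel"
    by (simp add: negligible_iff_null_sets null_sets_completion_iff)
  then have "AE x in lborel. x \<notin> frontier E" by (rule AE_not_in)
  then have "AE x in lborel. ((\<lambda>e. w (x + e *\<^sub>R t)) has_real_derivative indicator E x * h' x t) (at 0)"
  proof eventually_elim
    case (elim x)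
    have cl: "closed E" using E compact_imp_closed by blast
    have near: "eventually (\<lambda>e. x + e *\<^sub>R t \<in> S) (nhds 0)" if "open S" "x \<in> S" for S
    proof -
      have "open ((\<lambda>e::real. x + e *\<^sub>R t) -` S)"
        using that(1) by (intro open_vimage continuous_intros)
      then show ?thesis using that(2) by (force simp: eventually_nhds)
    qed
    show ?case
    proof (cases "x \<in> E")
      case True
      then have "x \<in> interior E" using elim cl by (simp add: frontier_def)
      then have "eventually (\<lambda>e. x + e *\<^sub>R t \<in> interior E) (nhds 0)"
        using near by blast
      then have ev: "eventually (\<lambda>e. w (x + e *\<^sub>R t) = h (x + e *\<^sub>R t)) (nhds 0)"
        by eventually_elim (use interior_subset in \<open>auto simp: w_def indicator_def\<close>)
      show ?thesis using line[of x 0 UNIV] True DERIV_cong_ev[OF refl ev refl] by simp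
    next
      case False
      then have "eventually (\<lambda>e. x + e *\<^sub>R t \<in> - E) (nhds 0)"
        using near[of "- E"] cl by (auto simp: open_Compl)
      then have ev: "eventually (\<lambda>e. w (x + e *\<^sub>R t) = 0) (nhds 0)"
        by eventually_elim (auto simp: w_def)
      show ?thesis using False DERIV_cong_ev[OF refl ev refl] by simp
    qed
  qed
  then show ?thesis
    by (intro integral_directional_derivative_eq_0(2)[OF wi _ compact_imp_bounded[OF E(1)] _ lip])
      (auto simp: w_def)
qed

section \<open>Barycentric coordinates of a simplex\<close>

definition full_simplex :: "'a::euclidean_space set \<Rightarrow> bool" where
  "full_simplex V \<longleftrightarrow> \<not> affine_dependent V \<and> card V = DIM('a) + 1"

text \<open>For the vertices of a full-dimensional simplex the conditions determine the gradient; it is normal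
to the facet opposite to \<open>p\<close>.\<close>

definition bary_grad :: "'a::euclidean_space set \<Rightarrow> 'a \<Rightarrow> 'a" where
  "bary_grad V p = (SOME a. \<forall>q\<in>V - {p}. a \<bullet> (q - p) = -1)"

definition bary :: "'a::euclidean_space set \<Rightarrow> 'a \<Rightarrow> 'a \<Rightarrow> real" where
  "bary V p x = 1 + bary_grad V p \<bullet> (x - p)"

lemma full_simplex_finite: "full_simplex V \<Longrightarrow> finite V"
  unfolding full_simplex_def using aff_independent_finite by blast

lemma bary_vertex:
  assumes V: "full_simplex V" and p: "p \<in> V" and q: "q \<in> V"
  shows "bary V p q = (if q = p then 1 else 0)"
proof -
  let ?D = "(\<lambda>x. x - p) ` (V - {p})"
  have "\<not> dependent ((\<lambda>x. -p + x) ` (V - {p}))"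
    using V p affine_dependent_iff_dependent2[of p V] unfolding full_simplex_def by blast
  moreover have "((\<lambda>x. -p + x) ` (V - {p})) = ?D" by auto
  ultimately have ind: "independent ?D" by simp
  obtain f :: "'a \<Rightarrow> real" where f: "linear f" "\<forall>x\<in>?D. f x = -1"
    using linear_independent_extend[OF ind, of "\<lambda>_. -1"] by blast
  obtain a where a: "\<And>x. f x = a \<bullet> x"
    using adjoint_works[OF f(1), of _ 1] by (metis inner_commute inner_real_def mult.right_neutral)
  have "\<forall>q\<in>V - {p}. a \<bullet> (q - p) = -1" using f a by auto
  then have "\<forall>q\<in>V - {p}. bary_grad V p \<bullet> (q - p) = -1"
    unfolding bary_grad_def by (rule someI)
  then show ?thesis using q by (auto simp: bary_def)
qed

lemma bary_affine: "bary V p (x + c *\<^sub>R (y - z)) = bary V p x + c * (bary V p y - bary V p z)"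
  by (simp add: bary_def algebra_simps)

lemma bary_diff: "bary V p x - bary V p y = bary_grad V p \<bullet> (x - y)"
  by (simp add: bary_def algebra_simps)

lemma bary_combination:
  assumes "(\<Sum>q\<in>S. u q) = 1"
  shows "bary V p (\<Sum>q\<in>S. u q *\<^sub>R f q) = (\<Sum>q\<in>S. u q * bary V p (f q))"
proof -
  have "(\<Sum>q\<in>S. u q * bary V p (f q)) = (\<Sum>q\<in>S. u q * (1 - bary_grad V p \<bullet> p)) + (\<Sum>q\<in>S. u q * (bary_grad V p \<bullet> f q))"
    by (simp add: bary_def algebra_simps sum.distrib sum_subtractf)
  also have "(\<Sum>q\<in>S. u q * (1 - bary_grad V p \<bullet> p)) = 1 - bary_grad V p \<bullet> p"
    using assms by (simp flip: sum_distrib_right)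
  finally show ?thesis by (simp add: bary_def inner_sum_right algebra_simps)
qed

text \<open>The affine hull of \<open>V\<close> is the whole space, and the coefficients of a point are recovered by
applying the affine functions \<open>bary V p\<close> to its representation.\<close>

lemma bary_repr:
  assumes V: "full_simplex V"
  shows "(\<Sum>v\<in>V. bary V v x) = 1" "(\<Sum>v\<in>V. bary V v x *\<^sub>R v) = x"
proof -
  have fin: "finite V" using V full_simplex_finite by blast
  have "affine hull V = UNIV"
    using V affine_independent_span_eq[of V] by (simp add: full_simplex_def)
  then have "x \<in> affine hull V" by simp
  then obtain u where u: "sum u V = 1" "(\<Sum>v\<in>V. u v *\<^sub>R v) = x"
    using fin by (auto simp: affine_hull_finite)
  have "bary V p x = u p" if "p \<in> V" for p
  proof -
    have "bary V p x = (\<Sum>q\<in>V. u q * bary V p q)" using bary_combination[OF u(1), of V p "\<lambda>q. q"] u(2) by simp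
    also have "\<dots> = (\<Sum>q\<in>V. if q = p then u q else 0)"
      using bary_vertex[OF V that] by (intro sum.cong) auto
    finally show ?thesis using fin that by simp
  qed
  then show "(\<Sum>v\<in>V. bary V v x) = 1" "(\<Sum>v\<in>V. bary V v x *\<^sub>R v) = x" using u by auto
qed

lemma simplex_eq_bary_nonneg:
  assumes V: "full_simplex V"
  shows "convex hull V = {x. \<forall>v\<in>V. 0 \<le> bary V v x}"
proof
  have fin: "finite V" using V full_simplex_finite by blast
  show "convex hull V \<subseteq> {x. \<forall>v\<in>V. 0 \<le> bary V v x}"
  proof
    fix x assume "x \<in> convex hull V"
    then obtain u where u: "\<forall>v\<in>V. 0 \<le> u v" "sum u V = 1" "(\<Sum>v\<in>V. u v *\<^sub>R v) = x"
      using fin by (auto simp: convex_hull_finite)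
    have "0 \<le> bary V p x" if "p \<in> V" for p
      using bary_combination[OF u(2), of V p "\<lambda>q. q"] u that bary_vertex[OF V that]
      by (auto intro!: sum_nonneg)
    then show "x \<in> {x. \<forall>v\<in>V. 0 \<le> bary V v x}" by simp
  qed
  show "{x. \<forall>v\<in>V. 0 \<le> bary V v x} \<subseteq> convex hull V"
    using fin bary_repr[OF V] by (fastforce simp: convex_hull_finite)
qed

lemma face_eq_bary:
  assumes V: "full_simplex V" and F: "F \<subseteq> V"
  shows "convex hull F = {x \<in> convex hull V. \<forall>v\<in>V - F. bary V v x = 0}"
proof
  have fin: "finite V" "finite F" using V F full_simplex_finite finite_subset by blast+
  show "convex hull F \<subseteq> {x \<in> convex hull V. \<forall>v\<in>V - F. bary V v x = 0}"
  proof
    fix x assume x: "x \<in> convex hull F"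
    then obtain u where u: "\<forall>v\<in>F. 0 \<le> u v" "sum u F = 1" "(\<Sum>v\<in>F. u v *\<^sub>R v) = x"
      using fin by (auto simp: convex_hull_finite)
    have "bary V p x = 0" if "p \<in> V - F" for p
      using bary_combination[OF u(2), of V p "\<lambda>q. q"] u that bary_vertex[OF V, of p] F
      by (auto intro!: sum.neutral)
    then show "x \<in> {x \<in> convex hull V. \<forall>v\<in>V - F. bary V v x = 0}" using x hull_mono[OF F] by auto
  qed
  show "{x \<in> convex hull V. \<forall>v\<in>V - F. bary V v x = 0} \<subseteq> convex hull F"
  proof
    fix x assume x: "x \<in> {x \<in> convex hull V. \<forall>v\<in>V - F. bary V v x = 0}"
    have "(\<Sum>v\<in>F. bary V v x) = (\<Sum>v\<in>V. bary V v x)" "(\<Sum>v\<in>F. bary V v x *\<^sub>R v) = (\<Sum>v\<in>V. bary V v x *\<^sub>R v)"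
      using x fin F by (auto intro!: sum.mono_neutral_left)
    moreover have "\<forall>v\<in>F. 0 \<le> bary V v x" using x simplex_eq_bary_nonneg[OF V] F by auto
    ultimately show "x \<in> convex hull F"
      using bary_repr[OF V, of x] fin by (auto simp: convex_hull_finite)
  qed
qed

lemma interior_simplex_eq_bary_pos:
  assumes V: "full_simplex V"
  shows "interior (convex hull V) = {x. \<forall>v\<in>V. 0 < bary V v x}"
proof
  have fin: "finite V" using V full_simplex_finite by blast
  have "{x. \<forall>v\<in>V. 0 < bary V v x} = (\<Inter>v\<in>V. {x. 0 < bary V v x})" by auto
  moreover have "open {x. 0 < bary V v x}" for v
    unfolding bary_def by (intro open_Collect_less continuous_intros)
  ultimately have "open {x. \<forall>v\<in>V. 0 < bary V v x}" using open_INT[OF fin, of "\<lambda>v. {x. 0 < bary V v x}"] by presburger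
  then show "{x. \<forall>v\<in>V. 0 < bary V v x} \<subseteq> interior (convex hull V)"
    by (intro interior_maximal) (auto simp: simplex_eq_bary_nonneg[OF V] intro: less_imp_le)
  show "interior (convex hull V) \<subseteq> {x. \<forall>v\<in>V. 0 < bary V v x}"
  proof (clarify)
    fix x v assume x: "x \<in> interior (convex hull V)" and v: "v \<in> V"
    have "V \<noteq> {v}"
    proof
      assume "V = {v}"
      then have "card V = 1" by simp
      then show False using V DIM_positive[where 'a='a] by (simp add: full_simplex_def)
    qed
    then obtain q where q: "q \<in> V" "q \<noteq> v" using v by blast
    have "isCont (\<lambda>e::real. x + e *\<^sub>R (q - v)) 0" by simp
    then have "((\<lambda>e::real. x + e *\<^sub>R (q - v)) \<longlongrightarrow> x) (at_right 0)"
      unfolding isCont_def using tendsto_within_subset by fastforce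
    then have "eventually (\<lambda>e. x + e *\<^sub>R (q - v) \<in> interior (convex hull V)) (at_right 0)"
      using x by (intro topological_tendstoD) auto
    moreover have "eventually (\<lambda>e. e > 0) (at_right (0::real))" by (simp add: eventually_at_right_less)
    ultimately have "eventually (\<lambda>e::real. e > 0 \<and> x + e *\<^sub>R (q - v) \<in> convex hull V) (at_right 0)"
      by eventually_elim (use interior_subset in auto)
    then obtain e where e: "e > 0" "x + e *\<^sub>R (q - v) \<in> convex hull V"
      using eventually_happens'[of "at_right (0::real)"] by auto
    then have "0 \<le> bary V v (x + e *\<^sub>R (q - v))" using simplex_eq_bary_nonneg[OF V] v by auto
    then show "0 < bary V v x" using bary_vertex[OF V v] q v e by (simp add: bary_affine)
  qed
qed

lemma bary_mean:
  assumes V: "full_simplex V" and F: "F \<subseteq> V" "F \<noteq> {}" and q: "q \<in> V"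
  shows "bary V q (\<Sum>v\<in>F. (1 / real (card F)) *\<^sub>R v) = (if q \<in> F then 1 / real (card F) else 0)"
proof -
  have fin: "finite F" using V F full_simplex_finite finite_subset by blast
  then have "(\<Sum>v\<in>F. 1 / real (card F)) = 1" using F by (simp add: card_gt_0_iff)
  then have "bary V q (\<Sum>v\<in>F. (1 / real (card F)) *\<^sub>R v) = (\<Sum>v\<in>F. (1 / real (card F)) * bary V q v)"
    using bary_combination[of "\<lambda>_. 1 / real (card F)" F V q "\<lambda>v. v"] by simp
  also have "\<dots> = (\<Sum>v\<in>F. if v = q then 1 / real (card F) else 0)"
    using bary_vertex[OF V q] F by (intro sum.cong) auto
  finally show ?thesis using fin by simp
qed

section \<open>The flux of an edge field through a facet\<close>

text \<open>Continuity of the derivative is required for each fixed direction, because the derivative is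
only integrated in fixed directions.\<close>

definition C1_scalar :: "('a::euclidean_space \<Rightarrow> real) \<Rightarrow> ('a \<Rightarrow> 'a \<Rightarrow> real) \<Rightarrow> bool" where
  "C1_scalar s s' \<longleftrightarrow> (\<forall>x. (s has_derivative s' x) (at x)) \<and> (\<forall>t. continuous_on UNIV (\<lambda>x. s' x t))"

lemma C1_scalar_continuous: "C1_scalar s s' \<Longrightarrow> continuous_on UNIV s"
  unfolding C1_scalar_def
  by (intro continuous_at_imp_continuous_on ballI) (metis has_derivative_continuous)

lemma continuous_on_bary [continuous_intros]: "continuous_on S (bary V p)"
  unfolding bary_def[abs_def] by (intro continuous_intros)

lemma integrable_indicator_compact:
  fixes f :: "'a::euclidean_space \<Rightarrow> real"
  assumes "compact E" "continuous_on UNIV f"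
  shows "integrable lborel (\<lambda>x. indicator E x * f x)"
  using borel_integrable_compact[OF assms(1) continuous_on_subset[OF assms(2)]] by simp

lemma compact_simplex_hull: "full_simplex V \<Longrightarrow> compact (convex hull V)"
  using full_simplex_finite finite_imp_compact_convex_hull by blast

text \<open>The integrand is the derivative of \<open>bary V r * s\<close> in direction \<open>r - p\<close>. Along a line in that
direction only the coordinates of \<open>r\<close> and \<open>p\<close> change, so the line leaves the simplex where one
of them is zero; there the factor \<open>bary V r\<close>, respectively the factor \<open>s\<close>, vanishes.\<close>

lemma edge_flux_eq_0:
  assumes V: "full_simplex V" and p: "p \<in> V" and r: "r \<in> V" "r \<noteq> p"
    and s: "C1_scalar s s'" and zero: "\<And>x. x \<in> convex hull (V - {p}) \<Longrightarrow> s x = 0"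
  shows "(\<integral>x. indicator (convex hull V) x * (bary V r x * s' x (r - p) + s x) \<partial>lborel) = 0"
proof -
  let ?E = "convex hull V" and ?t = "r - p"
  have gr: "bary_grad V r \<bullet> ?t = 1" "bary_grad V p \<bullet> ?t = -1"
    using bary_vertex[OF V] p r by (simp_all flip: bary_diff)
  have go: "bary_grad V v \<bullet> ?t = 0" if "v \<in> V" "v \<noteq> p" "v \<noteq> r" for v
    using bary_vertex[OF V that(1)] p r that by (simp flip: bary_diff)
  have mv: "bary V v (x + e *\<^sub>R ?t) = bary V v x + e * (bary_grad V v \<bullet> ?t)" for v x e
    by (simp add: bary_affine bary_diff)
  have memE: "x \<in> ?E \<longleftrightarrow> (\<forall>v\<in>V. 0 \<le> bary V v x)" for x using simplex_eq_bary_nonneg[OF V] by auto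
  have "(\<integral>x. indicator ?E x * (bary V r x * s' x ?t + (bary_grad V r \<bullet> ?t) * s x) \<partial>lborel) = 0"
  proof (rule integral_directional_derivative_convex[where h = "\<lambda>x. bary V r x * s x" and
        h' = "\<lambda>x y. bary V r x * s' x y + (bary_grad V r \<bullet> y) * s x"])
    show "compact ?E" "convex ?E" using compact_simplex_hull[OF V] by auto
    show "((\<lambda>x. bary V r x * s x) has_derivative (\<lambda>y. bary V r x * s' x y + (bary_grad V r \<bullet> y) * s x)) (at x)" for x
    proof (rule has_derivative_mult)
      show "(bary V r has_derivative (\<bullet>) (bary_grad V r)) (at x)"
        unfolding bary_def[abs_def] by (auto intro!: derivative_eq_intros)
      show "(s has_derivative s' x) (at x)" using s by (simp add: C1_scalar_def)
    qed
    show "continuous_on UNIV (\<lambda>x. bary V r x * s' x ?t + bary_grad V r \<bullet> ?t * s x)"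
      using s C1_scalar_continuous[OF s] by (auto simp: C1_scalar_def intro!: continuous_intros)
  next
    fix x e assume x: "x \<in> ?E" and out: "x + e *\<^sub>R ?t \<notin> ?E"
    obtain v where v: "v \<in> V" "bary V v (x + e *\<^sub>R ?t) < 0" using out memE by force
    then have "v = p \<or> v = r" using go mv[of v x e] x memE by force
    moreover have nn: "bary V p x \<ge> 0" "bary V r x \<ge> 0" using x memE p r by auto
    ultimately have cases: "bary V p x < e \<or> bary V r x < - e" using v mv[of v x e] gr by auto
    \<comment> \<open>The line through \<open>x\<close> leaves the simplex at this parameter, where the coordinate of \<open>p\<close> or of \<open>r\<close> reaches zero.\<close>
    define d where "d = (if bary V p x < e then bary V p x else - bary V r x)"
    define y where "y = x + d *\<^sub>R ?t"
    have b: "bary V p y = bary V p x - d" "bary V r y = bary V r x + d"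
      "\<And>v. v \<in> V \<Longrightarrow> v \<noteq> p \<Longrightarrow> v \<noteq> r \<Longrightarrow> bary V v y = bary V v x"
      using mv gr go by (auto simp: y_def)
    have "y \<in> ?E"
      unfolding memE
    proof
      fix v assume "v \<in> V"
      then show "0 \<le> bary V v y"
        using b nn cases x memE by (cases "v = p"; cases "v = r") (auto simp: d_def split: if_splits)
    qed
    moreover have "bary V r y * s y = 0"
    proof (cases "bary V p x < e")
      case True
      then have "bary V p y = 0" using b by (simp add: d_def)
      then have "y \<in> convex hull (V - {p})" using face_eq_bary[OF V, of "V - {p}"] \<open>y \<in> ?E\<close> p by auto
      then show ?thesis using zero by simp
    next
      case False
      then show ?thesis using b by (simp add: d_def)
    qed
    moreover have "\<bar>d\<bar> \<le> \<bar>e\<bar>" using cases nn by (auto simp: d_def)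
    ultimately show "\<exists>d. \<bar>d\<bar> \<le> \<bar>e\<bar> \<and> x + d *\<^sub>R ?t \<in> ?E \<and> bary V r (x + d *\<^sub>R ?t) * s (x + d *\<^sub>R ?t) = 0"
      unfolding y_def by blast
  qed
  then show ?thesis using gr by simp
qed

text \<open>The affine map \<open>S\<close> that fixes the common facet and sends \<open>p\<close> to \<open>p'\<close> carries the first simplex onto
the second one, and \<open>r - p\<close> to \<open>r - p'\<close>. After this change of variables the two integrals differ
by the integral for \<open>s - s \<circ> S\<close>, which vanishes on the facet.\<close>

lemma edge_flux_shared_facet:
  fixes V V' :: "'a::euclidean_space set"
  assumes V: "full_simplex V" "p \<in> V" and V': "full_simplex V'" "p' \<in> V'"
    and F: "V - {p} = V' - {p'}" and r: "r \<in> V - {p}" and s: "C1_scalar s s'"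
  shows "(\<integral>x. indicator (convex hull V) x * (bary V r x * s' x (r - p) + s x) \<partial>lborel) / measure lebesgue (convex hull V)
    = (\<integral>x. indicator (convex hull V') x * (bary V' r x * s' x (r - p') + s x) \<partial>lborel) / measure lebesgue (convex hull V')"
proof -
  let ?E = "convex hull V" and ?E' = "convex hull V'"
  have fin: "finite V" using V full_simplex_finite by blast
  have rV: "r \<in> V" "r \<noteq> p" "r \<in> V'" "r \<noteq> p'" using r F by auto
  define g where "g = bary_grad V p"
  define L where "L y = y + (g \<bullet> y) *\<^sub>R (p' - p)" for y
  define b where "b = (1 - g \<bullet> p) *\<^sub>R (p' - p)"
  define S where "S x = L x + b" for x
  have S: "S x = x + bary V p x *\<^sub>R (p' - p)" for x
    by (simp add: S_def L_def b_def bary_def g_def algebra_simps)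
  have lin: "linear L" unfolding L_def by (intro linearI) (auto simp: algebra_simps)
  \<comment> \<open>The vertex map induced by \<open>S\<close>.\<close>
  define \<pi> where "\<pi> v = (if v = p then p' else v)" for v
  have Srep: "S x = (\<Sum>v\<in>V. bary V v x *\<^sub>R \<pi> v)" for x
  proof -
    have "(\<Sum>v\<in>V. bary V v x *\<^sub>R \<pi> v) = (\<Sum>v\<in>V. bary V v x *\<^sub>R v + (if v = p then bary V v x *\<^sub>R (p' - p) else 0))"
      by (intro sum.cong) (auto simp: \<pi>_def algebra_simps)
    also have "\<dots> = x + bary V p x *\<^sub>R (p' - p)"
      using bary_repr[OF V(1), of x] fin V(2) by (simp add: sum.distrib)
    finally show ?thesis using S by simp
  qed
  have bS: "bary V' (\<pi> q) (S x) = bary V q x" if "q \<in> V" for q x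
  proof -
    have eqs: "(\<pi> v = \<pi> q) = (v = q)" if "v \<in> V" for v
      using F that \<open>q \<in> V\<close> V(2) V'(2) by (auto simp: \<pi>_def)
    have inV': "\<pi> v \<in> V'" if "v \<in> V" for v using F that V'(2) by (auto simp: \<pi>_def)
    have "bary V' (\<pi> q) (S x) = (\<Sum>v\<in>V. bary V v x * bary V' (\<pi> q) (\<pi> v))"
      unfolding Srep using bary_combination bary_repr(1)[OF V(1)] by blast
    also have "\<dots> = (\<Sum>v\<in>V. if v = q then bary V v x else 0)"
      using bary_vertex[OF V'(1)] inV' eqs that by (intro sum.cong) auto
    finally show ?thesis using fin that by simp
  qed
  have V'img: "V' = \<pi> ` V" using F V(2) V'(2) by (auto simp: \<pi>_def image_iff)
  have ind: "indicator ?E' (S x) = (indicator ?E x :: real)" for x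
  proof -
    have "S x \<in> ?E' \<longleftrightarrow> (\<forall>q\<in>V. 0 \<le> bary V' (\<pi> q) (S x))"
      unfolding simplex_eq_bary_nonneg[OF V'(1)] using V'img by blast
    also have "\<dots> \<longleftrightarrow> x \<in> ?E" using bS simplex_eq_bary_nonneg[OF V(1)] by simp
    finally show ?thesis by (simp add: indicator_def)
  qed
  have bp: "bary V' p' (S x) = bary V p x" for x using bS[OF V(2)] by (simp add: \<pi>_def)
  have br: "bary V' r (S x) = bary V r x" for x using bS[OF rV(1)] rV by (simp add: \<pi>_def)
  have inj: "inj L"
    unfolding linear_injective_0[OF lin]
  proof (intro allI impI)
    fix y assume "L y = 0"
    then have "S (p + y) = S p" by (simp add: S_def linear_add[OF lin])
    moreover have "S x + bary V' p' (S x) *\<^sub>R (p - p') = x" for x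
      unfolding bp by (simp add: S algebra_simps)
    ultimately have "p + y = p" by metis
    then show "y = 0" by simp
  qed
  then have "bij L" using linear_injective_imp_surjective[OF lin] by (simp add: bij_def)
  then obtain c where c: "c > 0" "\<And>f::'a \<Rightarrow> real. f \<in> borel_measurable borel \<Longrightarrow>
      (\<integral>x. f (S x) \<partial>lborel) = c * (\<integral>x. f x \<partial>lborel)"
    using lebesgue_integral_affine_bijection[OF lin, of b] unfolding S_def by blast
  have cE: "compact ?E" "compact ?E'" using compact_simplex_hull V V' by auto
  then have [measurable]: "?E \<in> sets borel" "?E' \<in> sets borel" using borel_compact by blast+
  have meas: "measure lebesgue X = (\<integral>x. indicator X x \<partial>lborel)" if "compact X" for X :: "'a set"
    using borel_compact[OF that] by (simp add: measure_completion)
  have vol: "measure lebesgue ?E = c * measure lebesgue ?E'"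
    using c(2)[of "indicator ?E'"] meas cE by (simp add: ind)
  have s_cont: "continuous_on UNIV s" using s C1_scalar_continuous by blast
  have s'_cont: "continuous_on UNIV (\<lambda>x. s' x t)" for t using s by (simp add: C1_scalar_def)
  have S_cont: "continuous_on UNIV S" unfolding S[abs_def] by (intro continuous_intros)
  let ?f = "\<lambda>x. bary V' r x * s' x (r - p') + s x"
  have fcont: "continuous_on UNIV ?f" by (intro continuous_intros s_cont s'_cont)
  have Lt: "L (r - p) = r - p'"
  proof -
    have "g \<bullet> (r - p) = -1" unfolding g_def using bary_vertex[OF V(1) V(2)] rV V(2) by (simp flip: bary_diff)
    then show ?thesis by (simp add: L_def)
  qed
  let ?u = "\<lambda>x. s x - s (S x)" and ?u' = "\<lambda>x y. s' x y - s' (S x) (L y)"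
  have "(\<integral>x. indicator ?E x * (bary V r x * ?u' x (r - p) + ?u x) \<partial>lborel) = 0"
  proof (rule edge_flux_eq_0[OF V rV(1,2)])
    have dS: "(S has_derivative L) (at x)" for x
      unfolding S_def using linear_imp_has_derivative[OF lin] by (auto intro!: derivative_eq_intros)
    have "((\<lambda>x. s (S x)) has_derivative (\<lambda>y. s' (S x) (L y))) (at x)" for x
      by (rule has_derivative_compose[OF dS]) (use s in \<open>simp add: C1_scalar_def\<close>)
    then have "(?u has_derivative ?u' x) (at x)" for x
      using s by (auto simp: C1_scalar_def intro!: has_derivative_diff)
    moreover have "continuous_on UNIV (\<lambda>x. ?u' x t)" for t
      by (intro continuous_intros s'_cont continuous_on_compose2[OF s'_cont S_cont]) auto
    ultimately show "C1_scalar ?u ?u'" by (simp add: C1_scalar_def)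
    fix x assume "x \<in> convex hull (V - {p})"
    then have "bary V p x = 0" using face_eq_bary[OF V(1), of "V - {p}"] V(2) by auto
    then show "?u x = 0" by (simp add: S)
  qed
  moreover have "indicator ?E x * (bary V r x * ?u' x (r - p) + ?u x)
     = indicator ?E x * (bary V r x * s' x (r - p) + s x) - indicator ?E' (S x) * ?f (S x)" for x :: 'a
    by (simp add: ind br Lt algebra_simps)
  moreover have i1: "integrable lborel (\<lambda>x. indicator ?E x * (bary V r x * s' x (r - p) + s x))"
    by (intro integrable_indicator_compact cE continuous_intros s_cont s'_cont)
  moreover have i2: "integrable lborel (\<lambda>x. indicator ?E' (S x) * ?f (S x))"
    unfolding ind
    by (intro integrable_indicator_compact cE continuous_on_compose2[OF fcont S_cont]) auto
  moreover have "(\<integral>x. indicator ?E' (S x) * ?f (S x) \<partial>lborel) = c * (\<integral>x. indicator ?E' x * ?f x \<partial>lborel)"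
    by (intro c(2) borel_measurable_times borel_measurable_indicator borel_measurable_continuous_onI fcont) simp
  ultimately have "(\<integral>x. indicator ?E x * (bary V r x * s' x (r - p) + s x) \<partial>lborel) = c * (\<integral>x. indicator ?E' x * ?f x \<partial>lborel)"
    by simp
  then show ?thesis using vol c(1) by simp
qed

section \<open>Geometry of a mesh of a polyhedral domain\<close>

text \<open>The vertices \<open>p\<close> and \<open>p'\<close> are those off the common facet; the negative barycentric
coordinate says that the two elements lie on opposite sides of it.\<close>

definition across_facet :: "'a::euclidean_space set \<Rightarrow> 'a \<Rightarrow> 'a set \<Rightarrow> 'a \<Rightarrow> bool" where
  "across_facet E p E' p' \<longleftrightarrow> p \<in> vertices E \<and> p' \<in> vertices E' \<and>
     vertices E - {p} = vertices E' - {p'} \<and> bary (vertices E) p p' < 0"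

locale domain_mesh =
  fixes \<Omega> :: "'a::euclidean_space set" and T :: "'a set set"
  assumes dom: "polyhedral_domain \<Omega>" and mesh: "mesh_of \<Omega> T"
begin

lemma open_domain: "open \<Omega>" and connected_domain: "connected \<Omega>" and bounded_domain: "bounded \<Omega>"
  using dom by (auto simp: polyhedral_domain_def)

lemma finite_mesh: "finite T" and mesh_nonempty: "T \<noteq> {}"
  and mesh_face: "E \<in> T \<Longrightarrow> E' \<in> T \<Longrightarrow> E \<inter> E' face_of E" and mesh_covers: "\<Union>T = closure \<Omega>"
  using mesh by (auto simp: mesh_of_def simplicial_mesh_def triangulation_def)

lemma element_vertices:
  assumes "E \<in> T"
  shows "full_simplex (vertices E)" "convex hull (vertices E) = E"
proof -
  have "int DIM('a) simplex E" using mesh assms by (auto simp: mesh_of_def simplicial_mesh_def)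
  then obtain C where C: "\<not> affine_dependent C" "int (card C) = int DIM('a) + 1" "E = convex hull C"
    by (auto simp: simplex_def)
  then have "vertices E = C" using extreme_point_of_convex_hull_affine_independent by (auto simp: vertices_def)
  then show "full_simplex (vertices E)" "convex hull (vertices E) = E" using C by (auto simp: full_simplex_def)
qed

lemma finite_vertices: "E \<in> T \<Longrightarrow> finite (vertices E)"
  using element_vertices full_simplex_finite by blast

lemma vertex_in_element: "E \<in> T \<Longrightarrow> r \<in> vertices E \<Longrightarrow> r \<in> E"
  using element_vertices hull_inc by metis

lemma compact_element: "E \<in> T \<Longrightarrow> compact E"
  using element_vertices finite_vertices finite_imp_compact_convex_hull by metis

lemma closed_element: "E \<in> T \<Longrightarrow> closed E" using compact_element compact_imp_closed by blast

lemma convex_element: "E \<in> T \<Longrightarrow> convex E" using element_vertices by (metis convex_convex_hull)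

lemma mem_element: "E \<in> T \<Longrightarrow> x \<in> E \<longleftrightarrow> (\<forall>v\<in>vertices E. 0 \<le> bary (vertices E) v x)"
  using simplex_eq_bary_nonneg[of "vertices E"] element_vertices[of E] by auto

lemma mem_interior_element: "E \<in> T \<Longrightarrow> x \<in> interior E \<longleftrightarrow> (\<forall>v\<in>vertices E. 0 < bary (vertices E) v x)"
  using interior_simplex_eq_bary_pos[of "vertices E"] element_vertices[of E] by auto

lemma mem_face: "E \<in> T \<Longrightarrow> F \<subseteq> vertices E \<Longrightarrow>
    x \<in> convex hull F \<longleftrightarrow> x \<in> E \<and> (\<forall>v\<in>vertices E - F. bary (vertices E) v x = 0)"
  using face_eq_bary[of "vertices E" F] element_vertices by auto

lemma interior_element_nonempty:
  assumes E: "E \<in> T" shows "interior E \<noteq> {}"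
proof -
  let ?V = "vertices E"
  have V: "full_simplex ?V" using E element_vertices by auto
  then have c: "card ?V > 0" "?V \<noteq> {}" by (auto simp: full_simplex_def)
  have "bary ?V q (\<Sum>v\<in>?V. (1 / real (card ?V)) *\<^sub>R v) > 0" if "q \<in> ?V" for q
    using bary_mean[OF V subset_refl c(2) that] that c(1) by simp
  then show ?thesis using mem_interior_element[OF E] by blast
qed

lemma closure_interior_element: "E \<in> T \<Longrightarrow> closure (interior E) = E"
  using convex_closure_interior[OF convex_element interior_element_nonempty] closed_element
  by (simp add: closure_closed)

lemma open_meets_interior:
  assumes "E \<in> T" "open N" "x \<in> N" "x \<in> E"
  shows "N \<inter> interior E \<noteq> {}"
  using assms closure_interior_element[OF assms(1)] open_Int_closure_eq_empty[OF assms(2), of "interior E"] by blast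

text \<open>The interior of a closed set is regular open; this is where the absence of slits enters.\<close>

lemma interior_closure_domain: "interior (closure \<Omega>) = \<Omega>"
proof
  obtain P where P: "finite P" "\<And>p. p \<in> P \<Longrightarrow> polytope p" "\<Omega> = interior (\<Union>P)"
    using dom by (auto simp: polyhedral_domain_def)
  have "closed (\<Union>P)" using P polytope_imp_closed by blast
  then have "closure \<Omega> \<subseteq> \<Union>P" using P(3) closure_minimal interior_subset by metis
  then show "interior (closure \<Omega>) \<subseteq> \<Omega>" using P(3) interior_mono by blast
  show "\<Omega> \<subseteq> interior (closure \<Omega>)" using open_domain by (simp add: closure_subset interior_maximal)
qed

lemma interior_element_subset: "E \<in> T \<Longrightarrow> interior E \<subseteq> \<Omega>"
  using interior_mono[of E "closure \<Omega>"] mesh_covers interior_closure_domain by blast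

lemma element_subset: "E \<in> T \<Longrightarrow> E \<subseteq> closure \<Omega>" using mesh_covers by blast

lemma point_in_element: "x \<in> \<Omega> \<Longrightarrow> \<exists>E\<in>T. x \<in> E" using mesh_covers closure_subset by blast

lemma interior_element_unique:
  assumes "E \<in> T" "E' \<in> T" "x \<in> interior E" "x \<in> E'"
  shows "E = E'"
proof -
  have sub: "A \<subseteq> B" if "A \<in> T" "B \<in> T" "y \<in> interior A" "y \<in> B" for A B y
  proof -
    have ri: "rel_interior A = interior A" using that by (intro rel_interior_nonempty_interior) auto
    have "(A \<inter> B) \<inter> rel_interior A \<noteq> {}"
      using that(3,4) interior_subset[of A] unfolding ri by blast
    then have "A \<subseteq> A \<inter> B"
      using subset_of_face_of[OF mesh_face[OF that(1,2)] subset_refl] by blast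
    then show ?thesis by blast
  qed
  have "E \<subseteq> E'" using sub assms by blast
  then have "x \<in> interior E'" using assms(3) interior_mono by blast
  then show ?thesis using sub[of E' E x] assms interior_subset \<open>E \<subseteq> E'\<close> by blast
qed

lemma only_touching_elements_near:
  "\<exists>e>0. \<forall>E\<in>T. ball x e \<inter> E \<noteq> {} \<longrightarrow> x \<in> E"
proof -
  have "closed (\<Union>{E\<in>T. x \<notin> E})" using finite_mesh closed_element by (intro closed_Union) auto
  then have "open (- \<Union>{E\<in>T. x \<notin> E})" by (simp add: open_Compl)
  moreover have "x \<in> - \<Union>{E\<in>T. x \<notin> E}" by auto
  ultimately obtain e where "e > 0" "ball x e \<subseteq> - \<Union>{E\<in>T. x \<notin> E}" using open_contains_ball by blast
  then show ?thesis by blast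
qed

lemma small_step_stays:
  assumes "open S" "(x::'a) \<in> S"
  shows "\<exists>d>0. d \<le> (1::real) \<and> (\<forall>e. 0 \<le> e \<and> e \<le> d \<longrightarrow> x + e *\<^sub>R v \<in> S)"
proof -
  have "open ((\<lambda>e::real. x + e *\<^sub>R v) -` S)" using assms by (intro open_vimage continuous_intros)
  moreover have "0 \<in> (\<lambda>e::real. x + e *\<^sub>R v) -` S" using assms by simp
  ultimately obtain d where d: "d > 0" "ball 0 d \<subseteq> (\<lambda>e::real. x + e *\<^sub>R v) -` S" using open_contains_ball by blast
  show ?thesis
  proof (intro exI[of _ "min 1 (d/2)"] conjI allI impI)
    fix e assume "0 \<le> e \<and> e \<le> min 1 (d / 2)"
    then have "e \<in> ball 0 d" using d by (simp add: dist_real_def)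
    then show "x + e *\<^sub>R v \<in> S" using d by blast
  qed (use d in auto)
qed

text \<open>Both sides are affine in \<open>x\<close>, vanish on the vertices of the common facet and agree at \<open>p'\<close>.\<close>

lemma bary_across:
  assumes "E \<in> T" "E' \<in> T" "p \<in> vertices E" "p' \<in> vertices E'" "vertices E - {p} = vertices E' - {p'}"
  shows "bary (vertices E) p x = bary (vertices E') p' x * bary (vertices E) p p'"
proof -
  let ?V = "vertices E" and ?V' = "vertices E'"
  have V: "full_simplex ?V" and V': "full_simplex ?V'" using assms element_vertices by auto
  have fin: "finite ?V'" using assms finite_vertices by blast
  have "bary ?V p x = (\<Sum>v\<in>?V'. bary ?V' v x * bary ?V p v)"
    using bary_combination[OF bary_repr(1)[OF V'], of ?V p x "\<lambda>v. v"] bary_repr(2)[OF V', of x] by simp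
  also have "\<dots> = (\<Sum>v\<in>?V'. if v = p' then bary ?V' p' x * bary ?V p p' else 0)"
  proof (intro sum.cong refl)
    fix v assume v: "v \<in> ?V'"
    show "bary ?V' v x * bary ?V p v = (if v = p' then bary ?V' p' x * bary ?V p p' else 0)"
    proof (cases "v = p'")
      case False
      then have "v \<in> ?V - {p}" using v assms by blast
      then show ?thesis using False bary_vertex[OF V assms(3), of v] by auto
    qed simp
  qed
  finally show ?thesis using fin assms by simp
qed

text \<open>Stepping out of \<open>E\<close> through a point \<open>x\<close> in the relative interior of the facet leads into some
element \<open>E'\<close> that contains \<open>x\<close>. The intersection of the two elements is a face of both of them, contains
\<open>x\<close>, and is not \<open>E\<close> itself, so it is the facet.\<close>

lemma neighbor_across_interior_facet:
  assumes E: "E \<in> T" and p: "p \<in> vertices E" and F: "convex hull (vertices E - {p}) \<inter> \<Omega> \<noteq> {}"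
  shows "\<exists>E'\<in>T. \<exists>p'. across_facet E p E' p'"
proof -
  let ?V = "vertices E" and ?F = "vertices E - {p}" and ?c = "1 / real (card (vertices E - {p}))"
  have V: "full_simplex ?V" and fin: "finite ?V" using E element_vertices finite_vertices by auto
  obtain y where y: "y \<in> convex hull ?F" "y \<in> \<Omega>" using F by blast
  have F0: "?F \<noteq> {}" using y(1) by (metis convex_hull_empty empty_iff)
  then have card: "card ?F > 0" using fin by (simp add: card_gt_0_iff)
  define m where "m = (\<Sum>v\<in>?F. ?c *\<^sub>R v)"
  have bm: "bary ?V q m = (if q = p then 0 else ?c)" if "q \<in> ?V" for q
    using bary_mean[OF V, of ?F q] F0 that by (auto simp: m_def)
  obtain d where d: "d > 0" "d \<le> 1" "\<And>e. 0 \<le> e \<Longrightarrow> e \<le> d \<Longrightarrow> y + e *\<^sub>R (m - y) \<in> \<Omega>"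
    using small_step_stays[OF open_domain y(2)] by blast
  \<comment> \<open>A point of the facet in the domain that is moved a little towards the mean \<open>m\<close> of the vertices, so that it lies in the relative interior.\<close>
  define x where "x = y + d *\<^sub>R (m - y)"
  have by': "bary ?V p y = 0" "\<And>q. q \<in> ?V \<Longrightarrow> bary ?V q y \<ge> 0"
    using y(1) mem_face[OF E, of ?F] mem_element[OF E] p by auto
  have x\<Omega>: "x \<in> \<Omega>" using d by (simp add: x_def)
  have bx: "bary ?V p x = 0" "\<And>q. q \<in> ?F \<Longrightarrow> bary ?V q x > 0"
  proof -
    show "bary ?V p x = 0" using by' bm[OF p] by (simp add: x_def bary_affine)
    fix q assume q: "q \<in> ?F"
    have "bary ?V q x = (1 - d) * bary ?V q y + d * ?c"
      using bm[of q] q unfolding x_def bary_affine by (simp add: algebra_simps)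
    moreover have "(1 - d) * bary ?V q y \<ge> 0" using d by' q by auto
    moreover have "d * ?c > 0" using d card by simp
    ultimately show "bary ?V q x > 0" by linarith
  qed
  then have xE: "x \<in> E" using mem_element[OF E] by (metis Diff_iff less_imp_le order_refl singletonD)
  obtain e where e: "e > 0" "\<And>E. E \<in> T \<Longrightarrow> ball x e \<inter> E \<noteq> {} \<Longrightarrow> x \<in> E"
    using only_touching_elements_near[of x] by blast
  obtain d' where d': "d' > 0" "\<And>s. 0 \<le> s \<Longrightarrow> s \<le> d' \<Longrightarrow> x + s *\<^sub>R (x - p) \<in> \<Omega> \<inter> ball x e"
    using small_step_stays[of "\<Omega> \<inter> ball x e" x "x - p"] open_domain x\<Omega> e(1)
    by (meson IntI centre_in_ball open_Int open_ball)
  define z where "z = x + d' *\<^sub>R (x - p)"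
  have z: "z \<in> \<Omega>" "z \<in> ball x e" using d' by (auto simp: z_def)
  have bz: "bary ?V p z = - d'" using bx(1) bary_vertex[OF V p p] by (simp add: z_def bary_affine)
  obtain E' where E': "E' \<in> T" "z \<in> E'" using point_in_element z by blast
  then have xE': "x \<in> E'" using e z by blast
  have V': "full_simplex (vertices E')" using E' element_vertices by auto
  have "E \<inter> E' face_of convex hull ?V" using mesh_face[OF E E'(1)] element_vertices[OF E] by simp
  then obtain C where C: "C \<subseteq> ?V" "E \<inter> E' = convex hull C"
    using face_of_convex_hull_affine_independent V unfolding full_simplex_def by blast
  have "E \<inter> E' face_of convex hull (vertices E')"
    using mesh_face[OF E'(1) E] element_vertices[OF E'(1)] by (simp add: Int_commute)
  then obtain C' where C': "C' \<subseteq> vertices E'" "E \<inter> E' = convex hull C'"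
    using face_of_convex_hull_affine_independent V' unfolding full_simplex_def by blast
  have "\<not> affine_dependent C" "\<not> affine_dependent C'"
    using affine_independent_subset C C' V V' unfolding full_simplex_def by blast+
  then have CC': "C = C'"
    using C(2) C'(2) extreme_point_of_convex_hull_affine_independent by (metis subsetI subset_antisym)
  have FC: "?F \<subseteq> C"
  proof
    fix q assume q: "q \<in> ?F"
    have "x \<in> convex hull C" using C xE xE' by blast
    then show "q \<in> C" using mem_face[OF E C(1), of x] bx(2)[OF q] q by force
  qed
  have "p \<notin> C"
  proof
    assume "p \<in> C"
    then have "C = ?V" using FC C by blast
    then have "E \<subseteq> E'" using C element_vertices[OF E] by blast
    moreover obtain w where "w \<in> interior E" using interior_element_nonempty[OF E] by blast
    ultimately have "E = E'" using interior_element_unique[OF E E'(1)] interior_subset by blast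
    then have "0 \<le> bary ?V p z" using mem_element[OF E] E' p by blast
    then show False using bz d' by simp
  qed
  then have C_eq: "C = ?F" using FC C by blast
  then have sub: "?F \<subseteq> vertices E'" using C' CC' by blast
  have "card (vertices E' - ?F) = 1"
    using V V' sub fin p finite_subset[OF sub] finite_vertices[OF E'(1)]
    by (simp add: card_Diff_subset full_simplex_def)
  then obtain p' where p': "vertices E' - ?F = {p'}" by (auto simp: card_1_singleton_iff)
  have same: "?V - {p} = vertices E' - {p'}" using p' sub by blast
  have p'V: "p' \<in> vertices E'" using p' by blast
  have "bary ?V p z = bary (vertices E') p' z * bary ?V p p'"
    using bary_across[OF E E'(1) p p'V same] .
  moreover have "bary (vertices E') p' z \<ge> 0" using mem_element[OF E'(1)] E' p'V by blast
  ultimately have "bary ?V p p' < 0" using bz d'(1) mult_nonneg_nonneg[of _ "bary ?V p p'"]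
    by (metis neg_less_0_iff_less not_le)
  then show ?thesis using E' p p'V same unfolding across_facet_def by blast
qed

text \<open>Near \<open>x\<close> all coordinates belonging to the facet stay positive in both elements, and by
\<open>bary_across\<close> the two remaining ones have opposite signs, so one of them is nonnegative.\<close>

lemma interior_union_across:
  assumes E: "E \<in> T" and E': "E' \<in> T" and ac: "across_facet E p E' p'"
    and x: "bary (vertices E) p x = 0" "\<And>v. v \<in> vertices E - {p} \<Longrightarrow> bary (vertices E) v x > 0"
  shows "x \<in> interior (E \<union> E')"
proof -
  let ?V = "vertices E" and ?V' = "vertices E'" and ?F = "vertices E - {p}"
  have V: "full_simplex ?V" and V': "full_simplex ?V'" and fin: "finite ?V"
    using E E' element_vertices finite_vertices by auto
  note ac = ac[unfolded across_facet_def]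
  define O' where "O' = (\<Inter>v\<in>?F. {y. 0 < bary ?V v y} \<inter> {y. 0 < bary ?V' v y})"
  have "open O'" unfolding O'_def bary_def
    using fin by (intro open_INT ballI open_Int open_Collect_less continuous_intros) auto
  have pV: "p \<in> ?V" using ac by blast
  have xrep: "(\<Sum>w\<in>?F. bary ?V w x *\<^sub>R w) = x" "(\<Sum>w\<in>?F. bary ?V w x) = 1"
    using bary_repr[OF V, of x] x(1) sum.remove[OF fin pV, of "\<lambda>w. bary ?V w x *\<^sub>R w"]
      sum.remove[OF fin pV, of "\<lambda>w. bary ?V w x"] by simp_all
  have "bary ?V' v x = bary ?V v x" if v: "v \<in> ?F" for v
  proof -
    have vV': "v \<in> ?V'" using v ac by blast
    have "bary ?V' v x = (\<Sum>w\<in>?F. bary ?V w x * bary ?V' v w)"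
      using bary_combination[OF xrep(2), of ?V' v "\<lambda>w. w"] xrep(1) by simp
    also have "\<dots> = (\<Sum>w\<in>?F. if w = v then bary ?V w x else 0)"
      using bary_vertex[OF V' vV'] ac by (intro sum.cong) auto
    finally show ?thesis using fin v by simp
  qed
  then have "x \<in> O'" using x by (auto simp: O'_def)
  moreover have "O' \<subseteq> E \<union> E'"
  proof
    fix y assume y: "y \<in> O'"
    show "y \<in> E \<union> E'"
    proof (cases "bary ?V p y \<ge> 0")
      case True
      then have "y \<in> E" unfolding mem_element[OF E] using y ac by (auto simp: O'_def intro: less_imp_le)
      then show ?thesis by simp
    next
      case False
      then have "bary ?V' p' y * bary ?V p p' < 0" using bary_across[OF E E', of p p' y] ac by auto
      then have "bary ?V' p' y > 0" using ac by (simp add: mult_less_0_iff)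
      then have "y \<in> E'" unfolding mem_element[OF E']
      proof (intro ballI)
        fix v assume "v \<in> ?V'"
        then have "v = p' \<or> v \<in> ?F" using ac by blast
        then show "0 \<le> bary ?V' v y" using \<open>bary ?V' p' y > 0\<close> y by (auto simp: O'_def intro: less_imp_le)
      qed
      then show ?thesis by simp
    qed
  qed
  ultimately show ?thesis using \<open>open O'\<close> interior_maximal by blast
qed

text \<open>Connect a point inside an element of \<open>A\<close> with a point of \<open>N\<close> outside the union of \<open>A\<close> by a segment that
avoids all faces of codimension two. This is possible because the excluded end points lie in finitely
many affine subspaces of dimension less than that of the space. The last point of the segment that still
belongs to the union lies in the relative interior of a facet, and the neighbor across that facet
continues the segment inside the union, a contradiction.\<close>

lemma convex_open_covered:
  assumes N: "convex N" "open N" and A: "A \<subseteq> T"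
    and closed_A: "\<And>E p. E \<in> A \<Longrightarrow> p \<in> vertices E \<Longrightarrow> convex hull (vertices E - {p}) \<inter> N \<noteq> {} \<Longrightarrow>
      \<exists>E'\<in>A. \<exists>p'. across_facet E p E' p'"
    and E0: "E0 \<in> A" "interior E0 \<inter> N \<noteq> {}"
  shows "N \<subseteq> \<Union>A"
proof (rule ccontr)
  assume nsub: "\<not> N \<subseteq> \<Union>A"
  have finA: "finite A" using A finite_mesh finite_subset by blast
  have clA: "closed (\<Union>A)" using finA A closed_element by (intro closed_Union) auto
  have intA: "interior E \<subseteq> interior (\<Union>A)" if "E \<in> A" for E using that by (intro interior_mono) auto
  obtain x where x: "x \<in> interior E0" "x \<in> N" using E0 by blast
  \<comment> \<open>End points \<open>z\<close> for which the segment from \<open>x\<close> may hit a face of codimension two.\<close>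
  define bad where "bad = (\<Union>E\<in>A. \<Union>p\<in>vertices E. \<Union>q\<in>vertices E - {p}. affine hull (insert x (vertices E - {p, q})))"
  have negl: "negligible bad"
  proof -
    have "negligible (affine hull (insert x (vertices E - {p, q})))"
      if E: "E \<in> A" and pq: "p \<in> vertices E" "q \<in> vertices E - {p}" for E p q
    proof -
      have fin: "finite (vertices E)" using E A finite_vertices by blast
      have c: "card (vertices E) = DIM('a) + 1" using E A element_vertices full_simplex_def by blast
      have "card (vertices E - {p, q}) = card (vertices E) - 2"
        using pq fin by (subst card_Diff_subset) auto
      then have "card (insert x (vertices E - {p, q})) \<le> DIM('a)"
        using c fin DIM_positive[where 'a='a] by (simp add: card_insert_if)
      then have "aff_dim (insert x (vertices E - {p, q})) < int DIM('a)"
        using aff_dim_le_card[of "insert x (vertices E - {p, q})"] fin by simp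
      then have "interior (affine hull (insert x (vertices E - {p, q}))) = {}"
        using aff_dim_nonempty_interior[of "affine hull (insert x (vertices E - {p, q}))"]
        by (auto simp: aff_dim_affine_hull)
      then show ?thesis using negligible_convex_interior convex_affine_hull by blast
    qed
    moreover have "finite (vertices E)" if "E \<in> A" for E using that A finite_vertices by blast
    ultimately show ?thesis unfolding bad_def
      using finA by (auto intro!: negligible_Union)
  qed
  have "open (N - \<Union>A)" "N - \<Union>A \<noteq> {}" using N clA nsub by (auto simp: open_Diff)
  then have "\<not> N - \<Union>A \<subseteq> bad" using negl negligible_subset open_not_negligible by blast
  then obtain z where z: "z \<in> N" "z \<notin> \<Union>A" "z \<notin> bad" by blast
  define f where "f t = x + t *\<^sub>R (z - x)" for t :: real
  define K where "K = {0..1} \<inter> f -` (\<Union>A)"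
  have contf: "continuous_on UNIV f" unfolding f_def by (intro continuous_intros)
  have "closed (f -` (\<Union>A))" using clA contf by (simp add: closed_vimage continuous_on_eq_continuous_at)
  then have "compact K" unfolding K_def by (simp add: compact_Int_closed)
  moreover have "0 \<in> K" using x E0 interior_subset by (auto simp: K_def f_def)
  ultimately obtain t where t: "t \<in> K" "\<And>s. s \<in> K \<Longrightarrow> s \<le> t" using compact_attains_sup[of K] by blast
  define w where "w = f t"
  have t01: "0 \<le> t" "t \<le> 1" "w \<in> \<Union>A" using t by (auto simp: K_def w_def)
  have "t \<noteq> 1" using t01 z by (auto simp: w_def f_def)
  then have t1: "t < 1" using t01 by simp
  have wN: "w \<in> N"
  proof -
    have "w = (1 - t) *\<^sub>R x + t *\<^sub>R z" by (simp add: w_def f_def algebra_simps)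
    then show ?thesis using N(1) x z t01 by (simp add: convexD)
  qed
  have wint: "w \<notin> interior (\<Union>A)"
  proof
    assume "w \<in> interior (\<Union>A)"
    then obtain d where d: "d > 0" "\<And>e. 0 \<le> e \<Longrightarrow> e \<le> d \<Longrightarrow> w + e *\<^sub>R (z - x) \<in> interior (\<Union>A)"
      using small_step_stays[of "interior (\<Union>A)" w "z - x"] by auto
    define e where "e = min d (1 - t)"
    have "e > 0" "e \<le> d" "t + e \<le> 1" using d t1 by (auto simp: e_def)
    have "f (t + e) = w + e *\<^sub>R (z - x)" by (simp add: w_def f_def algebra_simps)
    then have "t + e \<in> K" using d(2)[of e] \<open>e > 0\<close> \<open>e \<le> d\<close> \<open>t + e \<le> 1\<close> t01 interior_subset[of "\<Union>A"]
      by (auto simp: K_def)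
    then show False using t(2)[of "t + e"] \<open>e > 0\<close> by simp
  qed
  have t0: "t > 0"
  proof (rule ccontr)
    assume "\<not> t > 0"
    then have "w = x" using t01 by (simp add: w_def f_def)
    then show False using wint x intA E0 by blast
  qed
  obtain E where E: "E \<in> A" "w \<in> E" using t01 by blast
  have ET: "E \<in> T" using E A by blast
  have "w \<notin> interior E" using wint intA E by blast
  then obtain p where p: "p \<in> vertices E" "bary (vertices E) p w \<le> 0" using mem_interior_element[OF ET] by force
  then have p0: "bary (vertices E) p w = 0" using mem_element[OF ET] E by force
  have pos: "bary (vertices E) q w > 0" if q: "q \<in> vertices E - {p}" for q
  proof (rule ccontr)
    assume "\<not> bary (vertices E) q w > 0"
    then have "bary (vertices E) q w = 0" using mem_element[OF ET] E q by force
    then have "w \<in> convex hull (vertices E - {p, q})"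
      using mem_face[OF ET, of "vertices E - {p, q}"] p0 E by auto
    then have wa: "w \<in> affine hull (insert x (vertices E - {p, q}))"
      using convex_hull_subset_affine_hull hull_mono[of "vertices E - {p, q}"] by blast
    have xa: "x \<in> affine hull (insert x (vertices E - {p, q}))" by (simp add: hull_inc)
    have "(1 - 1/t) *\<^sub>R x + (1/t) *\<^sub>R w \<in> affine hull (insert x (vertices E - {p, q}))"
      using mem_affine[OF affine_affine_hull xa wa, of "1 - 1/t" "1/t"] by simp
    moreover have "(1 - 1/t) *\<^sub>R x + (1/t) *\<^sub>R w = z" using t0 by (simp add: w_def f_def algebra_simps)
    ultimately have "z \<in> bad" unfolding bad_def using E p q by auto
    then show False using z by blast
  qed
  have "w \<in> convex hull (vertices E - {p})"
    using mem_face[OF ET, of "vertices E - {p}"] p0 E p by auto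
  then obtain E' p' where E': "E' \<in> A" "across_facet E p E' p'" using closed_A[OF E(1) p(1)] wN by blast
  then have "w \<in> interior (E \<union> E')" using interior_union_across[OF ET _ E'(2) p0 pos] A by blast
  moreover have "interior (E \<union> E') \<subseteq> interior (\<Union>A)" using E E' by (intro interior_mono) auto
  ultimately show False using wint by blast
qed

end

context domain_mesh
begin

lemma facet_of_element:
  assumes E: "E \<in> T" and p: "p \<in> vertices E"
  shows "convex hull (vertices E - {p}) facet_of E"
proof -
  have V: "full_simplex (vertices E)" using E element_vertices by blast
  then have "2 \<le> card (vertices E)" using DIM_positive[where 'a='a] by (simp add: full_simplex_def)
  then have "convex hull (vertices E - {p}) facet_of convex hull (vertices E)"
    using V p facet_of_convex_hull_affine_independent_alt unfolding full_simplex_def by blast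
  then show ?thesis using element_vertices E by simp
qed

lemma facet_subset_element: "E \<in> T \<Longrightarrow> convex hull (vertices E - {p}) \<subseteq> E"
  using element_vertices(2)[of E] hull_mono[of "vertices E - {p}" "vertices E"] by blast

text \<open>Otherwise the elements would cover a ball around \<open>x\<close>, and \<open>x\<close> would be an interior point of
the closure of the domain.\<close>

lemma boundary_facet_near:
  assumes x: "x \<in> frontier \<Omega>" and N: "open N" "x \<in> N"
  shows "\<exists>E\<in>T. \<exists>p\<in>vertices E. convex hull (vertices E - {p}) \<subseteq> frontier \<Omega> \<and> convex hull (vertices E - {p}) \<inter> N \<noteq> {}"
proof (rule ccontr)
  assume no: "\<not> ?thesis"
  obtain e where e: "e > 0" "ball x e \<subseteq> N" using N open_contains_ball by blast
  have "x \<in> closure \<Omega>" "x \<notin> \<Omega>" using x open_domain by (auto simp: frontier_def interior_open)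
  then obtain E where E: "E \<in> T" "x \<in> E" using mesh_covers by blast
  have "ball x e \<subseteq> \<Union>T"
  proof (rule convex_open_covered)
    show "interior E \<inter> ball x e \<noteq> {}" using open_meets_interior[OF E(1), of "ball x e" x] E e by auto
    fix E' p assume E': "E' \<in> T" "p \<in> vertices E'" "convex hull (vertices E' - {p}) \<inter> ball x e \<noteq> {}"
    then have "\<not> convex hull (vertices E' - {p}) \<subseteq> frontier \<Omega>" using no e by blast
    moreover have "convex hull (vertices E' - {p}) \<subseteq> closure \<Omega>"
      using facet_subset_element element_subset E' by blast
    ultimately have "convex hull (vertices E' - {p}) \<inter> \<Omega> \<noteq> {}"
      using open_domain by (auto simp: frontier_def interior_open)
    then show "\<exists>E''\<in>T. \<exists>p'. across_facet E' p E'' p'" using neighbor_across_interior_facet E' by blast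
  qed (use E in auto)
  then have "ball x e \<subseteq> interior (closure \<Omega>)" using mesh_covers by (simp add: interior_maximal)
  moreover have "x \<in> ball x e" using e by simp
  ultimately show False using interior_closure_domain \<open>x \<notin> \<Omega>\<close> by blast
qed

text \<open>A facet that meets a relatively open part of the boundary inside \<open>\<Gamma>D\<close> is not contained in the
closure of \<open>\<Gamma>N\<close>.\<close>

lemma dirichlet_facet_exists:
  assumes "boundary_partition \<Omega> \<Gamma>D \<Gamma>N" "facets_resolve \<Omega> \<Gamma>D \<Gamma>N T"
  shows "\<exists>E\<in>T. \<exists>p\<in>vertices E. convex hull (vertices E - {p}) \<subseteq> frontier \<Omega> \<and> convex hull (vertices E - {p}) \<subseteq> closure \<Gamma>D"
proof -
  obtain U where U: "openin (top_of_set (frontier \<Omega>)) U" "U \<noteq> {}" "U \<subseteq> \<Gamma>D"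
    and \<Gamma>: "\<Gamma>D \<union> \<Gamma>N = frontier \<Omega>" "\<Gamma>D \<inter> \<Gamma>N = {}"
    using assms(1) unfolding boundary_partition_def by blast
  obtain N where N: "open N" "U = frontier \<Omega> \<inter> N" using U(1) openin_open by blast
  obtain x where x: "x \<in> U" using U by blast
  obtain E p where E: "E \<in> T" "p \<in> vertices E" "convex hull (vertices E - {p}) \<subseteq> frontier \<Omega>"
      "convex hull (vertices E - {p}) \<inter> N \<noteq> {}"
    using boundary_facet_near[of x N] x N by blast
  have "N \<inter> \<Gamma>N = {}" using U \<Gamma> N by blast
  then have "N \<inter> closure \<Gamma>N = {}" using open_Int_closure_eq_empty[OF N(1)] by blast
  then have "\<not> convex hull (vertices E - {p}) \<subseteq> closure \<Gamma>N" using E by blast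
  moreover have "convex hull (vertices E - {p}) \<in> boundary_facets \<Omega> E"
    using facet_of_element E by (simp add: boundary_facets_def)
  ultimately have "convex hull (vertices E - {p}) \<subseteq> closure \<Gamma>D" using assms(2) E unfolding facets_resolve_def by blast
  then show ?thesis using E by blast
qed

text \<open>The mesh is connected through interior facets: the interiors of the union of the elements where
\<open>f\<close> takes the given value and of the union of the others are disjoint and, by
\<open>convex_open_covered\<close> on small balls, cover the connected domain.\<close>

lemma constant_across_facets:
  assumes step: "\<And>E p E' p'. E \<in> T \<Longrightarrow> E' \<in> T \<Longrightarrow> across_facet E p E' p' \<Longrightarrow> f E = f E'"
    and E: "E \<in> T" "E' \<in> T"
  shows "f E = f E'"
proof -
  define A where "A = {D\<in>T. f D = f E}"
  define B where "B = T - A"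
  have AB: "A \<subseteq> T" "B \<subseteq> T" "A \<union> B = T" "A \<inter> B = {}" by (auto simp: A_def B_def)
  have stepA: "\<exists>D'\<in>X. \<exists>p'. across_facet D p D' p'"
    if X: "X = A \<or> X = B" and D: "D \<in> X" "p \<in> vertices D" "convex hull (vertices D - {p}) \<inter> \<Omega> \<noteq> {}" for X D p
  proof -
    have DT: "D \<in> T" using D X AB by blast
    then obtain D' p' where D': "D' \<in> T" "across_facet D p D' p'" using neighbor_across_interior_facet D by blast
    then have "f D = f D'" using step DT by blast
    then have "D' \<in> X" using D' D X unfolding B_def A_def by auto
    then show ?thesis using D' by blast
  qed
  have cover: "ball x e \<subseteq> \<Union>X"
    if X: "X = A \<or> X = B" and "e > 0" "ball x e \<subseteq> \<Omega>" "D \<in> X" "x \<in> D" for X x e D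
  proof (rule convex_open_covered)
    have DT: "D \<in> T" using that AB by blast
    show "interior D \<inter> ball x e \<noteq> {}" using open_meets_interior[OF DT, of "ball x e" x] that by auto
    fix D' p assume D': "D' \<in> X" "p \<in> vertices D'" "convex hull (vertices D' - {p}) \<inter> ball x e \<noteq> {}"
    then have "convex hull (vertices D' - {p}) \<inter> \<Omega> \<noteq> {}" using that by blast
    then show "\<exists>E'\<in>X. \<exists>p'. across_facet D' p E' p'" using stepA[OF X D'(1,2)] by blast
  qed (use that AB in auto)
  have "\<Omega> \<subseteq> interior (\<Union>A) \<union> interior (\<Union>B)"
  proof
    fix x assume x: "x \<in> \<Omega>"
    then obtain e where e: "e > 0" "ball x e \<subseteq> \<Omega>" using open_domain open_contains_ball by blast
    obtain D where D: "D \<in> T" "x \<in> D" using x point_in_element by blast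
    then obtain X where X: "X = A \<or> X = B" "D \<in> X" using AB by blast
    have "ball x e \<subseteq> interior (\<Union>X)" using cover[OF X(1) e X(2) D(2)] by (simp add: interior_maximal)
    moreover have "x \<in> ball x e" using e by simp
    ultimately show "x \<in> interior (\<Union>A) \<union> interior (\<Union>B)" using X by blast
  qed
  moreover have "interior (\<Union>A) \<inter> interior (\<Union>B) = {}"
  proof (rule ccontr)
    assume "interior (\<Union>A) \<inter> interior (\<Union>B) \<noteq> {}"
    then obtain x where x: "x \<in> interior (\<Union>A) \<inter> interior (\<Union>B)" by blast
    then obtain D where D: "D \<in> A" "x \<in> D" using interior_subset by blast
    then have "(interior (\<Union>A) \<inter> interior (\<Union>B)) \<inter> interior D \<noteq> {}"
      using open_meets_interior[of D "interior (\<Union>A) \<inter> interior (\<Union>B)" x] x AB by auto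
    then obtain y where y: "y \<in> interior (\<Union>B)" "y \<in> interior D" by blast
    then obtain D' where "D' \<in> B" "y \<in> D'" using interior_subset by blast
    then show False using interior_element_unique[of D D' y] y D AB by blast
  qed
  moreover have "interior E \<subseteq> interior (\<Union>A)" using E by (intro interior_mono) (auto simp: A_def)
  moreover have "interior E \<noteq> {}" "interior E \<subseteq> \<Omega>" using interior_element_nonempty interior_element_subset E by auto
  ultimately have none: "interior (\<Union>B) \<inter> \<Omega> = {}"
    using connectedD[OF connected_domain, of "interior (\<Union>A)" "interior (\<Union>B)"] by blast
  have "E' \<notin> B"
  proof
    assume "E' \<in> B"
    then have "interior E' \<subseteq> interior (\<Union>B)" by (intro interior_mono) auto
    then show False using none interior_element_nonempty[OF E(2)] interior_element_subset[OF E(2)] by blast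
  qed
  then show ?thesis using E unfolding A_def B_def by auto
qed

lemma measure_element_pos: "E \<in> T \<Longrightarrow> measure lebesgue E > 0"
proof -
  assume E: "E \<in> T"
  have "E \<in> lmeasurable" using compact_element[OF E] by (rule lmeasurable_compact)
  moreover have "\<not> negligible E" using negligible_convex_interior[OF convex_element[OF E]] interior_element_nonempty[OF E] by blast
  ultimately have "measure lebesgue E \<noteq> 0" using negligible_iff_measure by blast
  then show ?thesis by (simp add: zero_less_measure_iff)
qed

lemma negligible_mesh_skeleton: "negligible (\<Omega> - (\<Union>E\<in>T. interior E))"
proof -
  have "negligible (\<Union>E\<in>T. frontier E)"
    using finite_mesh negligible_convex_frontier convex_element by (auto intro!: negligible_Union)
  moreover have "\<Omega> - (\<Union>E\<in>T. interior E) \<subseteq> (\<Union>E\<in>T. frontier E)"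
    using point_in_element closure_subset by (fastforce simp: frontier_def)
  ultimately show ?thesis using negligible_subset by blast
qed

lemma AE_interior_element: "AE x in lebesgue_on \<Omega>. \<exists>E\<in>T. x \<in> interior E"
proof -
  have "\<Omega> - (\<Union>E\<in>T. interior E) \<in> null_sets lebesgue"
    using negligible_mesh_skeleton negligible_iff_null_sets by blast
  then have "AE x in lebesgue. x \<notin> \<Omega> - (\<Union>E\<in>T. interior E)" by (rule AE_not_in)
  then show ?thesis
    using open_domain by (subst AE_restrict_space_iff) (auto intro: AE_mp)
qed

end

section \<open>Functions orthogonal to all test fields\<close>

text \<open>Boxes form an intersection-stable generator of the Borel sets, so the integral of \<open>f\<close> over every
Borel set vanishes.\<close>

lemma AE_zero_if_zero_on_boxes:
  fixes f :: "'a::euclidean_space \<Rightarrow> real"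
  assumes f: "integrable lebesgue f"
    and box: "\<And>a b. (\<integral>x. indicator (box a b) x * f x \<partial>lebesgue) = 0"
  shows "AE x in lebesgue. f x = 0"
proof -
  obtain g where g: "g \<in> borel_measurable lborel" "AE x in lborel. f x = g x"
    using completion_ex_borel_measurable_real[of f lborel] f by auto
  have AEc: "AE x in lebesgue. f x = g x" using g(2) by (rule AE_completion)
  have gm: "g \<in> borel_measurable lebesgue" using g(1) by (rule measurable_completion)
  have fm: "f \<in> borel_measurable lebesgue" using f by blast
  have gi: "integrable lborel g"
  proof -
    have "integrable lebesgue g"
      using f integrable_cong_AE[OF fm gm AEc] by blast
    then show ?thesis using integrable_completion[OF g(1)] by simp
  qed
  have gbox: "set_lebesgue_integral lborel (box a b) g = 0" for a b
  proof -
    have "(\<integral>x. indicator (box a b) x * g x \<partial>lebesgue) = (\<integral>x. indicator (box a b) x * f x \<partial>lebesgue)"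
      using AEc by (intro integral_cong_AE borel_measurable_times borel_measurable_indicator fm gm) auto
    also have "(\<integral>x. indicator (box a b) x * g x \<partial>lebesgue) = (\<integral>x. indicator (box a b) x * g x \<partial>lborel)"
      using g(1) by (intro integral_completion) auto
    finally show ?thesis using box by (simp add: set_lebesgue_integral_def)
  qed
  have sint: "set_integrable lborel A g" if "A \<in> sets borel" for A
    unfolding set_integrable_def using gi that integrable_mult_indicator[of A lborel g] by simp
  have whole: "(\<integral>x. g x \<partial>lborel) = 0"
  proof -
    let ?B = "\<lambda>n::nat. box (- (real n *\<^sub>R One)) (real n *\<^sub>R One) :: 'a set"
    have "(\<lambda>n. \<integral>x. indicator (?B n) x *\<^sub>R g x \<partial>lborel) \<longlonglongrightarrow> (\<integral>x. g x \<partial>lborel)"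
    proof (rule integral_dominated_convergence[where w = "\<lambda>x. norm (g x)"])
      show "AE x in lborel. (\<lambda>n. indicator (?B n) x *\<^sub>R g x) \<longlonglongrightarrow> g x"
      proof (rule AE_I2)
        fix x :: 'a
        obtain n0 :: nat where n0: "norm x < real n0" using reals_Archimedean2 by blast
        have "x \<in> ?B n" if "n \<ge> n0" for n
        proof -
          have "\<bar>x \<bullet> i\<bar> < real n" if "i \<in> Basis" for i
            using Basis_le_norm[OF that, of x] n0 \<open>n \<ge> n0\<close> by linarith
          then show ?thesis by (force simp: mem_box abs_less_iff)
        qed
        then have "eventually (\<lambda>n. indicator (?B n) x *\<^sub>R g x = g x) sequentially"
          unfolding eventually_sequentially by (intro exI[of _ n0]) (auto simp: indicator_def)
        then show "(\<lambda>n. indicator (?B n) x *\<^sub>R g x) \<longlonglongrightarrow> g x" by (rule tendsto_eventually)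
      qed
    qed (use gi g(1) in \<open>auto simp: indicator_def\<close>)
    moreover have "(\<integral>x. indicator (?B n) x *\<^sub>R g x \<partial>lborel) = 0" for n
      using gbox[of "- (real n *\<^sub>R One)" "real n *\<^sub>R One"] unfolding set_lebesgue_integral_def by simp
    ultimately show ?thesis by (simp add: LIMSEQ_const_iff)
  qed
  have all: "set_lebesgue_integral lborel A g = 0" if A: "A \<in> sets borel" for A
  proof -
    let ?G = "range (\<lambda>(a, b). box a b) :: 'a set set"
    have bs: "sigma_sets UNIV ?G = sets borel" by (subst borel_eq_box) (simp add: sets_measure_of)
    have "Int_stable ?G"
    proof (rule Int_stableI)
      fix X Y :: "'a set" assume "X \<in> ?G" "Y \<in> ?G"
      then obtain a b c d where "X = box a b" "Y = box c d" by auto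
      then show "X \<inter> Y \<in> ?G"
        by (auto simp: box_Int_box intro!: image_eqI[of _ _ "(_, _)"])
    qed
    moreover have "?G \<subseteq> Pow UNIV" by simp
    moreover have "A \<in> sigma_sets UNIV ?G" using A bs by simp
    ultimately show ?thesis
    proof (induction rule: sigma_sets_induct_disjoint)
      fix X assume "X \<in> ?G"
      then show "set_lebesgue_integral lborel X g = 0" using gbox by auto
    next
      show "set_lebesgue_integral lborel {} g = 0" by (simp add: set_lebesgue_integral_def)
    next
      fix X assume X: "X \<in> sigma_sets UNIV ?G" "set_lebesgue_integral lborel X g = 0"
      then have Xb: "X \<in> sets borel" using bs by simp
      have "set_lebesgue_integral lborel (X \<union> (UNIV - X)) g = set_lebesgue_integral lborel X g + set_lebesgue_integral lborel (UNIV - X) g"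
        using Xb sint by (intro set_integral_Un) auto
      then show "set_lebesgue_integral lborel (UNIV - X) g = 0" using X(2) whole by (simp add: set_lebesgue_integral_def)
    next
      fix X :: "nat \<Rightarrow> 'a set" assume X: "disjoint_family X" "range X \<subseteq> sigma_sets UNIV ?G"
        "\<And>i. set_lebesgue_integral lborel (X i) g = 0"
      then have Xb: "X i \<in> sets borel" for i using bs by blast
      have "set_lebesgue_integral lborel (\<Union>i. X i) g = (\<Sum>i. set_lebesgue_integral lborel (X i) g)"
        using Xb X(1) sint by (intro lebesgue_integral_countable_add) (auto simp: disjoint_family_on_def)
      then show "set_lebesgue_integral lborel (\<Union>i. X i) g = 0" using X(3) by simp
    qed
  qed
  have "AE x in lborel. g x = 0" by (rule density_unique_real[OF gi]) (use all in \<open>auto simp: set_lebesgue_integral_def\<close>)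
  then have "AE x in lborel. f x = 0" using g(2) by eventually_elim simp
  then show ?thesis by (rule AE_completion)
qed

text \<open>A continuously differentiable step: zero for \<open>n t \<le> 1\<close>, with values between zero and one, and with
limit one as \<open>n\<close> tends to infinity for every \<open>t > 0\<close>. Products of such steps approximate
indicators of boxes.\<close>

definition ramp :: "real \<Rightarrow> real \<Rightarrow> real" where
  "ramp n t = (max 0 (n * t - 1))\<^sup>2 / (1 + (max 0 (n * t - 1))\<^sup>2)"

lemma ramp_bounds: "0 \<le> ramp n t" "ramp n t \<le> 1"
  by (auto simp: ramp_def divide_le_eq_1 add_pos_nonneg intro!: divide_nonneg_pos)

lemma ramp_eq_0: "n * t \<le> 1 \<Longrightarrow> ramp n t = 0" by (simp add: ramp_def)

lemma ramp_tendsto_1: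
  assumes "t > 0" shows "(\<lambda>n. ramp (real n) t) \<longlonglongrightarrow> 1"
proof -
  have "filterlim (\<lambda>n. real n * t - 1) at_top sequentially"
    using filterlim_tendsto_add_at_top[OF tendsto_const[of "-1"] filterlim_tendsto_pos_mult_at_top[OF tendsto_const assms filterlim_real_sequentially]]
    by (simp add: mult.commute)
  moreover have "((\<lambda>y::real. (max 0 y)\<^sup>2 / (1 + (max 0 y)\<^sup>2)) \<longlongrightarrow> 1) at_top"
  proof (rule Lim_transform_eventually)
    show "((\<lambda>y::real. 1 - inverse (1 + y\<^sup>2)) \<longlongrightarrow> 1) at_top"
    proof -
      have "filterlim (\<lambda>y::real. 1 + y\<^sup>2) at_top at_top"
        by (intro filterlim_tendsto_add_at_top[OF tendsto_const] filterlim_pow_at_top filterlim_ident) simp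
      then show ?thesis using tendsto_diff[OF tendsto_const[of 1] tendsto_inverse_0_at_top] by force
    qed
    have nz: "1 + y\<^sup>2 \<noteq> 0" for y :: real using zero_le_power2[of y] by linarith
    show "eventually (\<lambda>y::real. 1 - inverse (1 + y\<^sup>2) = (max 0 y)\<^sup>2 / (1 + (max 0 y)\<^sup>2)) at_top"
      using eventually_ge_at_top[of 0] by eventually_elim (simp add: field_simps nz)
  qed
  ultimately show ?thesis unfolding ramp_def by (rule filterlim_compose[rotated])
qed

lemma max_power2_has_derivative:
  "((\<lambda>y::real. (max 0 y)\<^sup>2) has_real_derivative 2 * max 0 y) (at y)"
proof -
  consider "y > 0" | "y < 0" | "y = 0" by linarith
  then show ?thesis
  proof cases
    case 1
    then have "eventually (\<lambda>z. (max 0 z)\<^sup>2 = z\<^sup>2) (nhds y)"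
      using eventually_nhds_in_open[of "{0<..}" y] by (auto elim!: eventually_mono)
    moreover have "((\<lambda>z. z\<^sup>2) has_real_derivative 2 * y) (at y)" by (auto intro!: derivative_eq_intros)
    ultimately show ?thesis using 1 DERIV_cong_ev[OF refl, of "\<lambda>z. (max 0 z)\<^sup>2" "\<lambda>z. z\<^sup>2" y] by simp
  next
    case 2
    then have "eventually (\<lambda>z. (max 0 z)\<^sup>2 = (0::real)) (nhds y)"
      using eventually_nhds_in_open[of "{..<0}" y] by (auto elim!: eventually_mono)
    then show ?thesis using 2 DERIV_cong_ev[OF refl, of "\<lambda>z. (max 0 z)\<^sup>2" "\<lambda>z. 0" y] by simp
  next
    case 3
    have "(\<lambda>h::real. (max 0 h)\<^sup>2 / h) \<midarrow>0\<rightarrow> 0"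
    proof (rule Lim_null_comparison)
      show "eventually (\<lambda>h::real. norm ((max 0 h)\<^sup>2 / h) \<le> \<bar>h\<bar>) (at 0)"
        by (auto simp: eventually_at_filter max_def power2_eq_square)
      show "((\<lambda>h::real. \<bar>h\<bar>) \<longlongrightarrow> 0) (at 0)" by (intro tendsto_eq_intros) auto
    qed
    then show ?thesis using 3 by (simp add: DERIV_def)
  qed
qed

lemma C1_scalar_ramp:
  fixes a :: "'a::euclidean_space"
  shows "\<exists>s'. C1_scalar (\<lambda>x. ramp n (a \<bullet> x + b)) s'"
proof -
  define q where "q y = (max 0 (n * y - 1))\<^sup>2" for y
  define q' where "q' y = 2 * max 0 (n * y - 1) * n" for y
  have pos: "1 + q y > 0" for y by (simp add: q_def add_pos_nonneg)
  have dq: "(q has_real_derivative q' y) (at y)" for y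
    unfolding q_def q'_def by (rule DERIV_chain2[OF max_power2_has_derivative]) (auto intro!: derivative_eq_intros)
  have dr: "(ramp n has_real_derivative q' y / (1 + q y)\<^sup>2) (at y)" for y
  proof -
    have "((\<lambda>y. q y / (1 + q y)) has_real_derivative (q' y * (1 + q y) - q y * (0 + q' y)) / ((1 + q y) * (1 + q y))) (at y)"
      using pos[of y] by (intro DERIV_divide DERIV_add DERIV_const dq) simp
    then show ?thesis unfolding ramp_def[abs_def] q_def[symmetric]
      by (simp add: algebra_simps power2_eq_square)
  qed
  have cq: "continuous_on UNIV q" "continuous_on UNIV q'" unfolding q_def q'_def by (intro continuous_intros)+
  have cr: "continuous_on UNIV (\<lambda>y. q' y / (1 + q y)\<^sup>2)"
    using pos by (intro continuous_intros cq) (metis less_irrefl power_eq_0_iff)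
  have "C1_scalar (\<lambda>x. ramp n (a \<bullet> x + b)) (\<lambda>x t. (a \<bullet> t) * (q' (a \<bullet> x + b) / (1 + q (a \<bullet> x + b))\<^sup>2))"
    unfolding C1_scalar_def
  proof (intro conjI allI)
    fix x
    show "((\<lambda>x. ramp n (a \<bullet> x + b)) has_derivative (\<lambda>t. (a \<bullet> t) * (q' (a \<bullet> x + b) / (1 + q (a \<bullet> x + b))\<^sup>2))) (at x)"
    proof -
      have "((\<lambda>x. a \<bullet> x + b) has_derivative (\<lambda>t. a \<bullet> t)) (at x)" by (auto intro!: derivative_eq_intros)
      from has_derivative_compose[OF this dr[unfolded has_field_derivative_def]]
      show ?thesis by (simp add: mult.commute)
    qed
  next
    fix t
    show "continuous_on UNIV (\<lambda>x. (a \<bullet> t) * (q' (a \<bullet> x + b) / (1 + q (a \<bullet> x + b))\<^sup>2))"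
      by (intro continuous_intros continuous_on_compose2[OF cr, of UNIV "\<lambda>x. a \<bullet> x + b"]) auto
  qed
  then show ?thesis by blast
qed

lemma C1_scalar_prod:
  assumes "finite I" "\<And>i. i \<in> I \<Longrightarrow> \<exists>s'. C1_scalar (s i) s'"
  shows "\<exists>s'. C1_scalar (\<lambda>x. \<Prod>i\<in>I. s i x) s'"
  using assms
proof (induction I rule: finite_induct)
  case empty
  show ?case by (intro exI[of _ "\<lambda>x t. 0"]) (auto simp: C1_scalar_def)
next
  case (insert i I)
  then obtain f' g' where f: "C1_scalar (s i) f'" and g: "C1_scalar (\<lambda>x. \<Prod>i\<in>I. s i x) g'" by blast
  have "C1_scalar (\<lambda>x. s i x * (\<Prod>i\<in>I. s i x)) (\<lambda>x t. s i x * g' x t + f' x t * (\<Prod>i\<in>I. s i x))"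
    using f g C1_scalar_continuous[OF f] C1_scalar_continuous[OF g]
    by (auto simp: C1_scalar_def intro!: has_derivative_mult continuous_intros)
  then show ?case using insert.hyps by auto
qed

lemma C1_field_of_scalar:
  fixes s :: "real^'n \<Rightarrow> real" and e :: "real^'n"
  assumes s: "C1_scalar s s'"
  shows "C1_field (\<lambda>x. s x *\<^sub>R e)"
  unfolding C1_field_def
proof
  have d: "((\<lambda>x. s x *\<^sub>R e) has_derivative (\<lambda>t. s' x t *\<^sub>R e)) (at x)" for x
    using s by (auto simp: C1_scalar_def intro!: derivative_eq_intros)
  then show "\<forall>x. (\<lambda>x. s x *\<^sub>R e) differentiable (at x)" by (auto simp: differentiable_def)
  have "jacobian (\<lambda>x. s x *\<^sub>R e) (at x) = (\<chi> i j. s' x (axis j 1) * e $ i)" for x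
    using frechet_derivative_at[OF d[of x], symmetric] by (simp add: jacobian_def matrix_def)
  moreover have "continuous_on UNIV (\<lambda>x. (\<chi> i j. s' x (axis j 1) * e $ i) :: real^'n^'n)"
    using s by (auto simp: C1_scalar_def intro!: continuous_on_vec_lambda continuous_intros)
  ultimately show "continuous_on UNIV (\<lambda>x. jacobian (\<lambda>x. s x *\<^sub>R e) (at x))" by simp
qed

lemma C1_scalar_of_field:
  fixes \<phi> :: "real^'n \<Rightarrow> real^'n"
  assumes \<phi>: "C1_field \<phi>"
  shows "C1_scalar (\<lambda>x. e \<bullet> \<phi> x) (\<lambda>x t. e \<bullet> (jacobian \<phi> (at x) *v t))"
  unfolding C1_scalar_def
proof (intro conjI allI)
  fix x
  have "(\<phi> has_derivative (\<lambda>t. jacobian \<phi> (at x) *v t)) (at x)" using \<phi> jacobian_works by (auto simp: C1_field_def)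
  then show "((\<lambda>x. e \<bullet> \<phi> x) has_derivative (\<lambda>t. e \<bullet> (jacobian \<phi> (at x) *v t))) (at x)"
    by (auto intro!: derivative_eq_intros)
next
  fix t
  show "continuous_on UNIV (\<lambda>x. e \<bullet> (jacobian \<phi> (at x) *v t))"
    using \<phi> unfolding C1_field_def matrix_vector_mult_def
    by (intro continuous_intros continuous_on_vec_lambda) auto
qed

definition test_field :: "(real^'n) set \<Rightarrow> (real^'n \<Rightarrow> real^'n) \<Rightarrow> bool" where
  "test_field \<Omega> \<phi> \<longleftrightarrow> C1_field \<phi> \<and> compact (closure {x. \<phi> x \<noteq> 0}) \<and> closure {x. \<phi> x \<noteq> 0} \<subseteq> \<Omega>"

definition box_cutoff :: "real \<Rightarrow> 'a::euclidean_space \<Rightarrow> 'a \<Rightarrow> 'a \<Rightarrow> real" where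
  "box_cutoff n a b x = (\<Prod>i\<in>Basis. ramp n (i \<bullet> x + - (a \<bullet> i)) * ramp n ((- i) \<bullet> x + b \<bullet> i))"

lemma C1_scalar_box_cutoff: "\<exists>s'. C1_scalar (box_cutoff n a b) s'"
proof -
  have "\<exists>s'. C1_scalar (\<lambda>x. \<Prod>j\<in>UNIV. ramp n ((if j then i else - i) \<bullet> x + (if j then - (a \<bullet> i) else b \<bullet> i))) s'" for i
    by (intro C1_scalar_prod C1_scalar_ramp) simp
  then have "\<exists>s'. C1_scalar (\<lambda>x. ramp n (i \<bullet> x + - (a \<bullet> i)) * ramp n ((- i) \<bullet> x + b \<bullet> i)) s'" for i
    by (simp add: UNIV_bool mult.commute[of "ramp n (b \<bullet> _ - _ \<bullet> _)"])
  then show ?thesis unfolding box_cutoff_def[abs_def] by (intro C1_scalar_prod) auto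
qed

lemma box_cutoff_bounds: "0 \<le> box_cutoff n a b x" "box_cutoff n a b x \<le> 1"
  unfolding box_cutoff_def
  by (auto intro!: prod_nonneg prod_le_1 mult_nonneg_nonneg mult_le_one simp: ramp_bounds)

lemma box_cutoff_support:
  assumes "n > 0"
  shows "\<exists>K. closed K \<and> {x. box_cutoff n a b x \<noteq> 0} \<subseteq> K \<and> K \<subseteq> box a b"
proof (intro exI[of _ "cbox (a + (1/n) *\<^sub>R One) (b - (1/n) *\<^sub>R One)"] conjI)
  show "cbox (a + (1/n) *\<^sub>R One) (b - (1/n) *\<^sub>R One) \<subseteq> box a b"
  proof
    fix x assume x: "x \<in> cbox (a + (1/n) *\<^sub>R One) (b - (1/n) *\<^sub>R One)"
    show "x \<in> box a b" unfolding mem_box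
    proof
      fix i :: 'a assume i: "i \<in> Basis"
      have "a \<bullet> i + 1/n \<le> x \<bullet> i" "x \<bullet> i \<le> b \<bullet> i - 1/n"
        using x i by (auto simp: mem_box algebra_simps)
      moreover have "1/n > 0" using assms by simp
      ultimately show "a \<bullet> i < x \<bullet> i \<and> x \<bullet> i < b \<bullet> i" by linarith
    qed
  qed
  show "{x. box_cutoff n a b x \<noteq> 0} \<subseteq> cbox (a + (1/n) *\<^sub>R One) (b - (1/n) *\<^sub>R One)"
  proof clarify
    fix x assume "box_cutoff n a b x \<noteq> 0"
    then have nz: "ramp n (i \<bullet> x + - (a \<bullet> i)) \<noteq> 0 \<and> ramp n ((- i) \<bullet> x + b \<bullet> i) \<noteq> 0" if "i \<in> Basis" for i
      using that by (auto simp: box_cutoff_def)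
    show "x \<in> cbox (a + (1/n) *\<^sub>R One) (b - (1/n) *\<^sub>R One)" unfolding mem_box
    proof
      fix i :: 'a assume i: "i \<in> Basis"
      have "n * (x \<bullet> i - a \<bullet> i) > 1" "n * (b \<bullet> i - x \<bullet> i) > 1"
        using nz[OF i] ramp_eq_0[of n "i \<bullet> x + - (a \<bullet> i)"] ramp_eq_0[of n "(- i) \<bullet> x + b \<bullet> i"]
        by (auto simp: inner_commute not_le[symmetric])
      then have "x \<bullet> i - a \<bullet> i \<ge> 1/n" "b \<bullet> i - x \<bullet> i \<ge> 1/n" using assms by (auto simp: field_simps)
      then show "(a + (1/n) *\<^sub>R One) \<bullet> i \<le> x \<bullet> i \<and> x \<bullet> i \<le> (b - (1/n) *\<^sub>R One) \<bullet> i"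
        using i by (simp add: algebra_simps)
    qed
  qed
qed auto

lemma box_cutoff_tendsto: "(\<lambda>n. box_cutoff (real (Suc n)) a b x) \<longlonglongrightarrow> indicator (box a b) x"
proof (cases "x \<in> box a b")
  case True
  have "(\<lambda>n. box_cutoff (real n) a b x) \<longlonglongrightarrow> (\<Prod>i\<in>(Basis::'a set). 1 * 1)"
    unfolding box_cutoff_def
    using True by (intro tendsto_prod tendsto_mult ramp_tendsto_1) (auto simp: mem_box inner_commute)
  then have "(\<lambda>n. box_cutoff (real n) a b x) \<longlonglongrightarrow> indicator (box a b) x" using True by simp
  then show ?thesis by (rule LIMSEQ_Suc)
next
  case False
  have "box_cutoff (real (Suc n)) a b x = 0" for n
    using box_cutoff_support[of "real (Suc n)" a b] False by force
  then show ?thesis using False by simp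
qed

lemma L2_integrable_component:
  fixes w :: "real^'n \<Rightarrow> real^'n"
  assumes w: "w \<in> L2 \<Omega>" and \<Omega>: "open \<Omega>" "bounded \<Omega>"
  shows "integrable (lebesgue_on \<Omega>) (\<lambda>x. w x $ k)"
proof -
  have wm: "w \<in> borel_measurable (lebesgue_on \<Omega>)" and wi: "integrable (lebesgue_on \<Omega>) (\<lambda>x. (norm (w x))\<^sup>2)"
    using w by (auto simp: L2_def)
  have lm: "\<Omega> \<in> lmeasurable" using \<Omega> lmeasurable_open by blast
  then interpret finite_measure "lebesgue_on \<Omega>" by (simp add: finite_measure_lebesgue_on)
  have i: "integrable (lebesgue_on \<Omega>) (\<lambda>x. 1 + (norm (w x))\<^sup>2)"
    using wi by simp
  show ?thesis
  proof (rule Bochner_Integration.integrable_bound[OF i])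
    show "(\<lambda>x. w x $ k) \<in> borel_measurable (lebesgue_on \<Omega>)"
      using borel_measurable_continuous_on[OF _ wm, of "\<lambda>v. v $ k"] by (simp add: continuous_on_component)
    have "\<bar>w x $ k\<bar> \<le> 1 + (norm (w x))\<^sup>2" for x
    proof -
      have "\<bar>w x $ k\<bar> \<le> norm (w x)" by (rule component_le_norm_cart)
      also have "\<dots> \<le> 1 + (norm (w x))\<^sup>2"
        using zero_le_power2[of "norm (w x) - 1"] norm_ge_zero[of "w x"]
        unfolding power2_diff power_one mult_1_right by linarith
      finally show ?thesis .
    qed
    then show "AE x in lebesgue_on \<Omega>. norm (w x $ k) \<le> norm (1 + (norm (w x))\<^sup>2)"
      by (auto intro!: AE_I2)
  qed
qed

text \<open>The fundamental lemma of the calculus of variations. The cutoffs of a box inside the domain are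
test functions and converge boundedly to the indicator of the box; the domain is a countable union
of boxes.\<close>

lemma AE_zero_if_orthogonal_to_test_fields:
  fixes w :: "real^'n \<Rightarrow> real^'n"
  assumes w: "w \<in> L2 \<Omega>" and \<Omega>: "open \<Omega>" "bounded \<Omega>"
    and orth: "\<And>\<phi>. test_field \<Omega> \<phi> \<Longrightarrow> L2_inner \<Omega> w \<phi> = 0"
  shows "AE x in lebesgue_on \<Omega>. w x = 0"
proof -
  have S: "\<Omega> \<inter> space lebesgue \<in> sets lebesgue" using \<Omega> by auto
  have comp: "AE x in lebesgue. x \<in> box a b \<longrightarrow> w x $ k = 0" if ab: "box a b \<subseteq> \<Omega>" for a b k
  proof -
    have wk: "integrable (lebesgue_on \<Omega>) (\<lambda>x. w x $ k)" by (rule L2_integrable_component[OF w \<Omega>])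
    have box0: "(\<integral>x. indicator (box c d) x * (w x $ k) \<partial>lebesgue_on \<Omega>) = 0" if cd: "box c d \<subseteq> \<Omega>" for c d
    proof -
      let ?s = "\<lambda>n. box_cutoff (real (Suc n)) c d"
      have "(\<integral>x. ?s n x * (w x $ k) \<partial>lebesgue_on \<Omega>) = 0" for n
      proof -
        obtain s' where s': "C1_scalar (?s n) s'" using C1_scalar_box_cutoff by blast
        obtain K where K: "closed K" "{x. ?s n x \<noteq> 0} \<subseteq> K" "K \<subseteq> box c d"
          using box_cutoff_support[of "real (Suc n)" c d] by auto
        let ?\<phi> = "\<lambda>x. ?s n x *\<^sub>R axis k (1::real)"
        have sub: "closure {x. ?\<phi> x \<noteq> 0} \<subseteq> K" using K by (intro closure_minimal) auto
        have "bounded K" using K(3) bounded_box bounded_subset by blast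
        then have "compact K" using K(1) compact_eq_bounded_closed by blast
        then have "compact (closure {x. ?\<phi> x \<noteq> 0})"
          using sub by (meson bounded_subset closed_closure compact_eq_bounded_closed)
        then have "test_field \<Omega> ?\<phi>" unfolding test_field_def
          using C1_field_of_scalar[OF s'] sub K(3) cd by blast
        from orth[OF this] show ?thesis
          by (simp add: L2_inner_def inner_axis mult.commute)
      qed
      moreover have "(\<lambda>n. \<integral>x. ?s n x * (w x $ k) \<partial>lebesgue_on \<Omega>) \<longlonglongrightarrow> (\<integral>x. indicator (box c d) x * (w x $ k) \<partial>lebesgue_on \<Omega>)"
      proof (rule integral_dominated_convergence[where w = "\<lambda>x. \<bar>w x $ k\<bar>"])
        have mi: "indicator (box c d) \<in> borel_measurable (lebesgue_on \<Omega>)"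
          by (intro measurable_restrict_space1 borel_measurable_indicator) auto
        show "(\<lambda>x. indicator (box c d) x * w x $ k) \<in> borel_measurable (lebesgue_on \<Omega>)"
          using wk by (intro borel_measurable_times mi) blast
        fix n
        have "continuous_on UNIV (?s n)" using C1_scalar_box_cutoff C1_scalar_continuous by blast
        then have "?s n \<in> borel_measurable lborel" by (simp add: borel_measurable_continuous_onI)
        then have "?s n \<in> borel_measurable (lebesgue_on \<Omega>)"
          by (intro measurable_restrict_space1 measurable_completion)
        then show "(\<lambda>x. ?s n x * w x $ k) \<in> borel_measurable (lebesgue_on \<Omega>)"
          using wk by (intro borel_measurable_times) blast+
        show "AE x in lebesgue_on \<Omega>. norm (?s n x * w x $ k) \<le> \<bar>w x $ k\<bar>"
          using box_cutoff_bounds[of "real (Suc n)" c d]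
          by (intro AE_I2) (simp add: abs_mult mult_left_le_one_le del: of_nat_Suc)
      next
        show "integrable (lebesgue_on \<Omega>) (\<lambda>x. \<bar>w x $ k\<bar>)" using wk by simp
        show "AE x in lebesgue_on \<Omega>. (\<lambda>n. ?s n x * w x $ k) \<longlonglongrightarrow> indicator (box c d) x * w x $ k"
          by (intro AE_I2 tendsto_mult box_cutoff_tendsto tendsto_const)
      qed
      ultimately show ?thesis by (simp add: LIMSEQ_const_iff)
    qed
    let ?f = "\<lambda>x. indicator (box a b) x * (w x $ k)"
    have r: "(\<integral>x. indicator (box c d) x * ?f x \<partial>lebesgue) = 0" for c d
    proof -
      define c' where "c' = (\<Sum>i\<in>Basis. (max (c \<bullet> i) (a \<bullet> i)) *\<^sub>R i)"
      define d' where "d' = (\<Sum>i\<in>Basis. (min (d \<bullet> i) (b \<bullet> i)) *\<^sub>R i)"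
      have B: "box c d \<inter> box a b = box c' d'" by (simp add: box_Int_box c'_def d'_def)
      then have sub: "box c' d' \<subseteq> \<Omega>" using ab by blast
      have "(\<integral>x. indicator (box c d) x * ?f x \<partial>lebesgue) = (\<integral>x. indicator \<Omega> x *\<^sub>R (indicator (box c' d') x * (w x $ k)) \<partial>lebesgue)"
        using sub by (intro Bochner_Integration.integral_cong) (auto simp: indicator_def simp flip: B)
      also have "\<dots> = (\<integral>x. indicator (box c' d') x * (w x $ k) \<partial>lebesgue_on \<Omega>)"
        by (rule integral_restrict_space[OF S, symmetric])
      finally show ?thesis using box0[OF sub] by simp
    qed
    have fi: "integrable lebesgue ?f"
    proof -
      have "integrable lebesgue (\<lambda>x. indicator \<Omega> x *\<^sub>R (w x $ k))"
        using wk integrable_restrict_space[OF S, of "\<lambda>x. w x $ k"] by simp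
      from integrable_mult_indicator[OF _ this, of "box a b"]
      have "integrable lebesgue (\<lambda>x. indicator (box a b) x *\<^sub>R (indicator \<Omega> x *\<^sub>R (w x $ k)))" by auto
      moreover have "(\<lambda>x. indicator (box a b) x *\<^sub>R (indicator \<Omega> x *\<^sub>R (w x $ k))) = ?f"
        using ab by (auto simp: indicator_def fun_eq_iff)
      ultimately show ?thesis by simp
    qed
    have "AE x in lebesgue. ?f x = 0" by (rule AE_zero_if_zero_on_boxes[OF fi r])
    then show ?thesis by eventually_elim (auto simp: indicator_def)
  qed
  obtain D where D: "countable D" "D \<subseteq> Pow \<Omega>" "\<And>X. X \<in> D \<Longrightarrow> \<exists>a b. X = box a b" "\<Union>D = \<Omega>"
    using open_countable_Union_open_box[OF \<Omega>(1)] by metis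
  have "AE x in lebesgue. \<forall>X\<in>D. x \<in> X \<longrightarrow> w x = 0"
  proof (subst AE_ball_countable[OF D(1)], intro ballI)
    fix X assume X: "X \<in> D"
    then obtain a b where ab: "X = box a b" using D by blast
    then have "AE x in lebesgue. \<forall>k\<in>UNIV. x \<in> box a b \<longrightarrow> w x $ k = 0"
      using comp[of a b] X D by (intro AE_finite_allI) auto
    then show "AE x in lebesgue. x \<in> X \<longrightarrow> w x = 0"
      by eventually_elim (auto simp: ab vec_eq_iff)
  qed
  then have "AE x in lebesgue. x \<in> \<Omega> \<longrightarrow> w x = 0" by eventually_elim (use D in auto)
  then show ?thesis using S by (simp add: AE_restrict_space_iff)
qed

section \<open>Square integrable fields and the weak divergence\<close>

lemma L2_comb:
  fixes v w :: "'a::euclidean_space \<Rightarrow> 'b::euclidean_space"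
  assumes v: "v \<in> L2 \<Omega>" and w: "w \<in> L2 \<Omega>"
  shows "(\<lambda>x. v x + c *\<^sub>R w x) \<in> L2 \<Omega>"
proof -
  have m: "v \<in> borel_measurable (lebesgue_on \<Omega>)" "w \<in> borel_measurable (lebesgue_on \<Omega>)"
    and i: "integrable (lebesgue_on \<Omega>) (\<lambda>x. (norm (v x))\<^sup>2)" "integrable (lebesgue_on \<Omega>) (\<lambda>x. (norm (w x))\<^sup>2)"
    using v w by (auto simp: L2_def)
  have mm: "(\<lambda>x. v x + c *\<^sub>R w x) \<in> borel_measurable (lebesgue_on \<Omega>)"
    by (intro borel_measurable_add borel_measurable_scaleR borel_measurable_const m)
  have ib: "integrable (lebesgue_on \<Omega>) (\<lambda>x. 2 * (norm (v x))\<^sup>2 + 2 * c\<^sup>2 * (norm (w x))\<^sup>2)"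
    using i by simp
  have "integrable (lebesgue_on \<Omega>) (\<lambda>x. (norm (v x + c *\<^sub>R w x))\<^sup>2)"
  proof (rule Bochner_Integration.integrable_bound[OF ib])
    show "(\<lambda>x. (norm (v x + c *\<^sub>R w x))\<^sup>2) \<in> borel_measurable (lebesgue_on \<Omega>)"
      by (intro borel_measurable_power measurable_compose[OF mm borel_measurable_norm])
    have "(norm (v x + c *\<^sub>R w x))\<^sup>2 \<le> 2 * (norm (v x))\<^sup>2 + 2 * c\<^sup>2 * (norm (w x))\<^sup>2" for x
    proof -
      have "(norm (v x + c *\<^sub>R w x))\<^sup>2 \<le> (norm (v x) + norm (c *\<^sub>R w x))\<^sup>2"
        by (intro power_mono norm_triangle_ineq) simp
      also have "\<dots> \<le> 2 * (norm (v x))\<^sup>2 + 2 * (norm (c *\<^sub>R w x))\<^sup>2"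
        using zero_le_power2[of "norm (v x) - norm (c *\<^sub>R w x)"] unfolding power2_diff power2_sum by linarith
      finally show ?thesis by (simp add: power_mult_distrib)
    qed
    then show "AE x in lebesgue_on \<Omega>. norm ((norm (v x + c *\<^sub>R w x))\<^sup>2) \<le> norm (2 * (norm (v x))\<^sup>2 + 2 * c\<^sup>2 * (norm (w x))\<^sup>2)"
      by (intro AE_I2) (simp add: order_trans[OF _ abs_ge_self])
  qed
  then show ?thesis using mm by (simp add: L2_def)
qed

lemma L2_inner_integrable:
  fixes v w :: "'a::euclidean_space \<Rightarrow> 'b::euclidean_space"
  assumes v: "v \<in> L2 \<Omega>" and w: "w \<in> L2 \<Omega>"
  shows "integrable (lebesgue_on \<Omega>) (\<lambda>x. v x \<bullet> w x)"
proof -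
  have m: "v \<in> borel_measurable (lebesgue_on \<Omega>)" "w \<in> borel_measurable (lebesgue_on \<Omega>)"
    and i: "integrable (lebesgue_on \<Omega>) (\<lambda>x. (norm (v x))\<^sup>2)" "integrable (lebesgue_on \<Omega>) (\<lambda>x. (norm (w x))\<^sup>2)"
    using v w by (auto simp: L2_def)
  have ib: "integrable (lebesgue_on \<Omega>) (\<lambda>x. (norm (v x))\<^sup>2 + (norm (w x))\<^sup>2)" using i by simp
  show ?thesis
  proof (rule Bochner_Integration.integrable_bound[OF ib])
    show "(\<lambda>x. v x \<bullet> w x) \<in> borel_measurable (lebesgue_on \<Omega>)" by (intro borel_measurable_inner m)
    have "\<bar>v x \<bullet> w x\<bar> \<le> (norm (v x))\<^sup>2 + (norm (w x))\<^sup>2" for x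
    proof -
      have "\<bar>v x \<bullet> w x\<bar> \<le> norm (v x) * norm (w x)" by (rule Cauchy_Schwarz_ineq2)
      also have "\<dots> \<le> (norm (v x))\<^sup>2 + (norm (w x))\<^sup>2"
        using zero_le_power2[of "norm (v x) - norm (w x)"] zero_le_power2[of "norm (v x)"] zero_le_power2[of "norm (w x)"]
          mult_nonneg_nonneg[OF norm_ge_zero[of "v x"] norm_ge_zero[of "w x"]] unfolding power2_diff by linarith
      finally show ?thesis .
    qed
    then show "AE x in lebesgue_on \<Omega>. norm (v x \<bullet> w x) \<le> norm ((norm (v x))\<^sup>2 + (norm (w x))\<^sup>2)"
      by (intro AE_I2) simp
  qed
qed

lemma continuous_in_L2:
  fixes v :: "'a::euclidean_space \<Rightarrow> 'b::euclidean_space"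
  assumes v: "continuous_on UNIV v" and \<Omega>: "open \<Omega>" "bounded \<Omega>"
  shows "v \<in> L2 \<Omega>"
proof -
  have lm: "\<Omega> \<in> lmeasurable" using \<Omega> lmeasurable_open by blast
  then interpret finite_measure "lebesgue_on \<Omega>" by (simp add: finite_measure_lebesgue_on)
  have "v \<in> borel_measurable lborel" using v by (simp add: borel_measurable_continuous_onI)
  then have m: "v \<in> borel_measurable (lebesgue_on \<Omega>)" by (intro measurable_restrict_space1 measurable_completion)
  have "compact (closure \<Omega>)" using \<Omega> by (simp add: compact_closure)
  then have "bounded (v ` closure \<Omega>)"
    using compact_continuous_image continuous_on_subset[OF v] compact_imp_bounded by blast
  then obtain B where B: "\<And>x. x \<in> closure \<Omega> \<Longrightarrow> norm (v x) \<le> B" unfolding bounded_iff by blast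
  have "integrable (lebesgue_on \<Omega>) (\<lambda>x. (norm (v x))\<^sup>2)"
  proof (rule integrable_const_bound)
    show "AE x in lebesgue_on \<Omega>. norm ((norm (v x))\<^sup>2) \<le> B\<^sup>2"
      using B closure_subset by (intro AE_I2) (auto intro!: power_mono)
    show "(\<lambda>x. (norm (v x))\<^sup>2) \<in> borel_measurable (lebesgue_on \<Omega>)"
      by (intro borel_measurable_power measurable_compose[OF m borel_measurable_norm])
  qed
  then show ?thesis using m by (simp add: L2_def)
qed

lemma L2_inner_comb_left:
  assumes "v \<in> L2 \<Omega>" "v' \<in> L2 \<Omega>" "w \<in> L2 \<Omega>"
  shows "L2_inner \<Omega> (\<lambda>x. v x + c *\<^sub>R v' x) w = L2_inner \<Omega> v w + c * L2_inner \<Omega> v' w"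
  using L2_inner_integrable[OF assms(1,3)] L2_inner_integrable[OF assms(2,3)]
  by (simp add: L2_inner_def inner_add_left)

lemma L2_inner_commute: "L2_inner \<Omega> v w = L2_inner \<Omega> w v"
  by (simp add: L2_inner_def inner_commute)

lemma L2_inner_comb_right:
  assumes "v \<in> L2 \<Omega>" "w \<in> L2 \<Omega>" "w' \<in> L2 \<Omega>"
  shows "L2_inner \<Omega> v (\<lambda>x. w x + c *\<^sub>R w' x) = L2_inner \<Omega> v w + c * L2_inner \<Omega> v w'"
  using L2_inner_comb_left[OF assms(2,3,1)] by (simp add: L2_inner_commute[of \<Omega> v])

lemma L2_inner_cong_left:
  assumes "AE x in lebesgue_on \<Omega>. v x = v' x" "v \<in> L2 \<Omega>" "v' \<in> L2 \<Omega>" "w \<in> L2 \<Omega>"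
  shows "L2_inner \<Omega> v w = L2_inner \<Omega> v' w"
  unfolding L2_inner_def
  using assms(1) by (intro integral_cong_AE borel_measurable_integrable L2_inner_integrable assms) auto

locale bounded_open_domain =
  fixes \<Omega> :: "(real^'n) set"
  assumes op: "open \<Omega>" and bd: "bounded \<Omega>"
begin

lemma C1_field_L2: "C1_field \<phi> \<Longrightarrow> \<phi> \<in> L2 \<Omega>" "C1_field \<phi> \<Longrightarrow> (\<lambda>x. jacobian \<phi> (at x)) \<in> L2 \<Omega>"
  unfolding C1_field_def
  by (auto intro!: continuous_in_L2 op bd continuous_at_imp_continuous_on differentiable_imp_continuous_within)

lemma has_weak_div_test: "has_weak_div \<Omega> \<tau> w \<longleftrightarrow>
    (\<forall>\<phi>. test_field \<Omega> \<phi> \<longrightarrow> L2_inner \<Omega> w \<phi> = - L2_inner \<Omega> \<tau> (\<lambda>x. jacobian \<phi> (at x)))"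
  unfolding has_weak_div_def test_field_def ..

lemma has_weak_div_comb:
  assumes "has_weak_div \<Omega> \<tau> w" "has_weak_div \<Omega> \<sigma> v" "\<tau> \<in> L2 \<Omega>" "\<sigma> \<in> L2 \<Omega>" "w \<in> L2 \<Omega>" "v \<in> L2 \<Omega>"
  shows "has_weak_div \<Omega> (\<lambda>x. \<tau> x + c *\<^sub>R \<sigma> x) (\<lambda>x. w x + c *\<^sub>R v x)"
  unfolding has_weak_div_test
proof (intro allI impI)
  fix \<phi> assume "test_field \<Omega> \<phi>"
  moreover from this have "C1_field \<phi>" by (simp add: test_field_def)
  ultimately show "L2_inner \<Omega> (\<lambda>x. w x + c *\<^sub>R v x) \<phi> = - L2_inner \<Omega> (\<lambda>x. \<tau> x + c *\<^sub>R \<sigma> x) (\<lambda>x. jacobian \<phi> (at x))"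
    using assms C1_field_L2[of \<phi>] by (simp add: L2_inner_comb_left has_weak_div_test)
qed

lemma has_weak_div_unique:
  assumes w: "has_weak_div \<Omega> \<tau> w" "w \<in> L2 \<Omega>" and v: "has_weak_div \<Omega> \<tau> v" "v \<in> L2 \<Omega>"
  shows "AE x in lebesgue_on \<Omega>. w x = v x"
proof -
  have "AE x in lebesgue_on \<Omega>. w x + (-1) *\<^sub>R v x = 0"
  proof (rule AE_zero_if_orthogonal_to_test_fields[OF L2_comb[OF w(2) v(2)] op bd])
    fix \<phi> assume t: "test_field \<Omega> \<phi>"
    then have "\<phi> \<in> L2 \<Omega>" using C1_field_L2 by (simp add: test_field_def)
    then show "L2_inner \<Omega> (\<lambda>x. w x + (-1) *\<^sub>R v x) \<phi> = 0"
      using t w v L2_inner_comb_left[OF w(2) v(2), of \<phi> "-1"] by (simp add: has_weak_div_test)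
  qed
  then show ?thesis by eventually_elim simp
qed

lemma weak_div_AE:
  assumes "has_weak_div \<Omega> \<tau> w" "w \<in> L2 \<Omega>"
  shows "weak_div \<Omega> \<tau> \<in> L2 \<Omega>" "has_weak_div \<Omega> \<tau> (weak_div \<Omega> \<tau>)"
    "AE x in lebesgue_on \<Omega>. weak_div \<Omega> \<tau> x = w x"
proof -
  have *: "weak_div \<Omega> \<tau> \<in> L2 \<Omega> \<and> has_weak_div \<Omega> \<tau> (weak_div \<Omega> \<tau>)"
    unfolding weak_div_def by (rule someI[where P = "\<lambda>w. w \<in> L2 \<Omega> \<and> has_weak_div \<Omega> \<tau> w"]) (use assms in auto)
  then show "weak_div \<Omega> \<tau> \<in> L2 \<Omega>" "has_weak_div \<Omega> \<tau> (weak_div \<Omega> \<tau>)" by auto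
  show "AE x in lebesgue_on \<Omega>. weak_div \<Omega> \<tau> x = w x"
    using has_weak_div_unique * assms by blast
qed

lemma stress_space_weak_div:
  assumes "\<tau> \<in> stress_space \<Omega> \<Gamma>"
  shows "\<tau> \<in> L2 \<Omega>" "weak_div \<Omega> \<tau> \<in> L2 \<Omega>" "has_weak_div \<Omega> \<tau> (weak_div \<Omega> \<tau>)" "normal_trace_zero \<Omega> \<Gamma> \<tau>"
  using assms weak_div_AE by (auto simp: stress_space_def)

text \<open>The weak divergence is chosen arbitrarily among almost everywhere equal functions, so it is linear
only almost everywhere; this suffices because it is only used inside integrals.\<close>

lemma weak_div_comb:
  assumes \<tau>: "\<tau> \<in> stress_space \<Omega> \<Gamma>" and \<sigma>: "\<sigma> \<in> stress_space \<Omega> \<Gamma>"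
  shows "AE x in lebesgue_on \<Omega>. weak_div \<Omega> (\<lambda>x. \<tau> x + c *\<^sub>R \<sigma> x) x = weak_div \<Omega> \<tau> x + c *\<^sub>R weak_div \<Omega> \<sigma> x"
    and "(\<lambda>x. \<tau> x + c *\<^sub>R \<sigma> x) \<in> stress_space \<Omega> \<Gamma>"
proof -
  let ?w = "\<lambda>x. weak_div \<Omega> \<tau> x + c *\<^sub>R weak_div \<Omega> \<sigma> x" and ?s = "\<lambda>x. \<tau> x + c *\<^sub>R \<sigma> x"
  note t = stress_space_weak_div[OF \<tau>] and s = stress_space_weak_div[OF \<sigma>]
  have w: "has_weak_div \<Omega> ?s ?w" "?w \<in> L2 \<Omega>" using has_weak_div_comb L2_comb t s by auto
  show AE: "AE x in lebesgue_on \<Omega>. weak_div \<Omega> ?s x = ?w x" using weak_div_AE[OF w] by blast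
  have "normal_trace_zero \<Omega> \<Gamma> ?s"
    unfolding normal_trace_zero_def
  proof (intro allI impI)
    fix \<phi> assume \<phi>: "C1_field \<phi> \<and> (\<forall>x\<in>frontier \<Omega> - \<Gamma>. \<phi> x = 0)"
    then have L: "\<phi> \<in> L2 \<Omega>" "(\<lambda>x. jacobian \<phi> (at x)) \<in> L2 \<Omega>" using C1_field_L2 by auto
    have "L2_inner \<Omega> (weak_div \<Omega> ?s) \<phi> = L2_inner \<Omega> ?w \<phi>"
      by (rule L2_inner_cong_left[OF AE weak_div_AE(1)[OF w] w(2) L(1)])
    moreover have "L2_inner \<Omega> \<tau> (\<lambda>x. jacobian \<phi> (at x)) + L2_inner \<Omega> (weak_div \<Omega> \<tau>) \<phi> = 0"
       "L2_inner \<Omega> \<sigma> (\<lambda>x. jacobian \<phi> (at x)) + L2_inner \<Omega> (weak_div \<Omega> \<sigma>) \<phi> = 0"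
      using t(4) s(4) \<phi> unfolding normal_trace_zero_def by blast+
    ultimately show "L2_inner \<Omega> ?s (\<lambda>x. jacobian \<phi> (at x)) + L2_inner \<Omega> (weak_div \<Omega> ?s) \<phi> = 0"
      using t s L by (simp add: L2_inner_comb_left algebra_simps flip: distrib_left)
  qed
  then show "?s \<in> stress_space \<Omega> \<Gamma>" using w L2_comb t s by (auto simp: stress_space_def)
qed

lemma weak_div_AE_zero:
  assumes \<tau>: "\<tau> \<in> stress_space \<Omega> \<Gamma>" and z: "AE x in lebesgue_on \<Omega>. \<tau> x = 0"
  shows "AE x in lebesgue_on \<Omega>. weak_div \<Omega> \<tau> x = 0"
proof -
  have z0: "(\<lambda>x. 0) \<in> L2 \<Omega>" by (intro continuous_in_L2 op bd) simp
  have z0m: "(\<lambda>x. 0 :: real^'n^'n) \<in> L2 \<Omega>" by (intro continuous_in_L2 op bd) simp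
  have "has_weak_div \<Omega> \<tau> (\<lambda>x. 0)" unfolding has_weak_div_test
  proof (intro allI impI)
    fix \<phi> assume "test_field \<Omega> \<phi>"
    then have "(\<lambda>x. jacobian \<phi> (at x)) \<in> L2 \<Omega>" using C1_field_L2 by (simp add: test_field_def)
    then have "L2_inner \<Omega> \<tau> (\<lambda>x. jacobian \<phi> (at x)) = L2_inner \<Omega> (\<lambda>x. 0) (\<lambda>x. jacobian \<phi> (at x))"
      using stress_space_weak_div[OF \<tau>] z z0m by (intro L2_inner_cong_left) auto
    then show "L2_inner \<Omega> (\<lambda>x. 0) \<phi> = - L2_inner \<Omega> \<tau> (\<lambda>x. jacobian \<phi> (at x))" by (simp add: L2_inner_def)
  qed
  then show ?thesis using weak_div_AE z0 by blast
qed

end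

section \<open>Facet basis fields of the stress space\<close>

definition outer :: "real^'n \<Rightarrow> real^'n \<Rightarrow> real^'n^'n" where
  "outer e t = (\<chi> i j. e $ i * t $ j)"

lemma inner_outer: "M \<bullet> outer e t = e \<bullet> (M *v t)"
  by (simp add: outer_def inner_vec_def matrix_vector_mult_def sum_distrib_left mult_ac)

locale cartesian_mesh = domain_mesh \<Omega> T for \<Omega> :: "(real^'n) set" and T
begin

sublocale bounded_open_domain \<Omega>
  by standard (use open_domain bounded_domain in auto)

lemma integral_on_element:
  assumes E: "E \<in> T" and g: "continuous_on UNIV g"
  shows "(\<integral>x. indicator (interior E) x * g x \<partial>lebesgue_on \<Omega>) = (\<integral>x. indicator E x * (g x :: real) \<partial>lborel)"
    and "integrable (lebesgue_on \<Omega>) (\<lambda>x. indicator (interior E) x * g x)"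
proof -
  have S: "\<Omega> \<inter> space lebesgue \<in> sets lebesgue" using op by auto
  have i: "integrable lborel (\<lambda>x. indicator E x * g x)"
    by (rule integrable_indicator_compact[OF compact_element[OF E] g])
  then have il: "integrable lebesgue (\<lambda>x. indicator E x * g x)" using integrable_completion[of "\<lambda>x. indicator E x * g x" lborel] by auto
  have "frontier E \<in> null_sets lebesgue"
    using negligible_convex_frontier[OF convex_element[OF E]] negligible_iff_null_sets by blast
  then have "AE x in lebesgue. x \<notin> frontier E" by (rule AE_not_in)
  then have AE: "AE x in lebesgue. indicator E x * g x = indicator \<Omega> x *\<^sub>R (indicator (interior E) x * g x)"
  proof eventually_elim
    case (elim x)
    then show ?case using interior_element_subset[OF E] closed_element[OF E] interior_subset[of E]
      by (auto simp: indicator_def frontier_def)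
  qed
  have gm: "g \<in> borel_measurable lebesgue" using g by (intro measurable_completion) (simp add: borel_measurable_continuous_onI)
  have m1: "(\<lambda>x. indicator E x * g x) \<in> borel_measurable lebesgue" using il by blast
  have m2: "(\<lambda>x. indicator \<Omega> x *\<^sub>R (indicator (interior E) x * g x)) \<in> borel_measurable lebesgue"
    using op by (intro borel_measurable_scaleR borel_measurable_times borel_measurable_indicator gm) auto
  show "(\<integral>x. indicator (interior E) x * g x \<partial>lebesgue_on \<Omega>) = (\<integral>x. indicator E x * g x \<partial>lborel)"
  proof -
    have "(\<integral>x. indicator (interior E) x * g x \<partial>lebesgue_on \<Omega>) = (\<integral>x. indicator \<Omega> x *\<^sub>R (indicator (interior E) x * g x) \<partial>lebesgue)"
      by (rule integral_restrict_space[OF S])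
    also have "\<dots> = (\<integral>x. indicator E x * g x \<partial>lebesgue)"
      using AE by (intro integral_cong_AE[symmetric] m1 m2) 
    also have "\<dots> = (\<integral>x. indicator E x * g x \<partial>lborel)"
      using i by (intro integral_completion) blast
    finally show ?thesis .
  qed
  show "integrable (lebesgue_on \<Omega>) (\<lambda>x. indicator (interior E) x * g x)"
    using il integrable_cong_AE[OF m1 m2 AE] integrable_restrict_space[OF S] by blast
qed

lemma restricted_in_L2:
  fixes g :: "real^'n \<Rightarrow> 'b::euclidean_space"
  assumes E: "E \<in> T" and g: "continuous_on UNIV g"
  shows "(\<lambda>x. indicator (interior E) x *\<^sub>R g x) \<in> L2 \<Omega>"
proof -
  have "g \<in> borel_measurable (lebesgue_on \<Omega>)" using continuous_in_L2[OF g op bd] by (simp add: L2_def)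
  moreover have "indicator (interior E) \<in> borel_measurable (lebesgue_on \<Omega>)"
    by (intro measurable_restrict_space1 borel_measurable_indicator) auto
  ultimately have m: "(\<lambda>x. indicator (interior E) x *\<^sub>R g x) \<in> borel_measurable (lebesgue_on \<Omega>)"
    by (intro borel_measurable_scaleR)
  have "integrable (lebesgue_on \<Omega>) (\<lambda>x. indicator (interior E) x * (norm (g x))\<^sup>2)"
    by (intro integral_on_element(2)[OF E] continuous_intros g)
  moreover have "(\<lambda>x. indicator (interior E) x * (norm (g x))\<^sup>2) = (\<lambda>x. (norm (indicator (interior E) x *\<^sub>R g x))\<^sup>2)"
    by (auto simp: indicator_def)
  ultimately show ?thesis using m by (simp add: L2_def)
qed

text \<open>The restriction to \<open>E\<close> of a basis function of Brezzi-Douglas-Marini type: it has constant direction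
\<open>r - p\<close>, along an edge of \<open>E\<close>, and vanishes on the facet opposite to \<open>r\<close>. Dividing by the volume
makes its flux through the facet opposite to \<open>p\<close> independent of \<open>E\<close>, up to the sign.\<close>

definition edge_field :: "(real^'n) set \<Rightarrow> real^'n \<Rightarrow> real^'n \<Rightarrow> real^'n \<Rightarrow> real^'n \<Rightarrow> real^'n^'n" where
  "edge_field E p r e x = indicator (interior E) x *\<^sub>R ((bary (vertices E) r x / measure lebesgue E) *\<^sub>R outer e (r - p))"

text \<open>The piecewise divergence of \<open>edge_field\<close>; recall that \<open>bary V r\<close> has derivative one in
direction \<open>r - p\<close>.\<close>

definition edge_div :: "(real^'n) set \<Rightarrow> real^'n \<Rightarrow> real^'n \<Rightarrow> real^'n" where
  "edge_div E e x = indicator (interior E) x *\<^sub>R ((1 / measure lebesgue E) *\<^sub>R e)"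

text \<open>The boundary term in Green's formula, a multiple of the integral of \<open>bary (vertices E) r * (e \<bullet> \<phi>)\<close>
over the facet opposite to \<open>p\<close>, written as a volume integral.\<close>

definition facet_flux :: "(real^'n) set \<Rightarrow> real^'n \<Rightarrow> real^'n \<Rightarrow> real^'n \<Rightarrow> (real^'n \<Rightarrow> real^'n) \<Rightarrow> real" where
  "facet_flux E p r e \<phi> = (\<integral>x. indicator E x * (bary (vertices E) r x * (e \<bullet> (jacobian \<phi> (at x) *v (r - p))) + e \<bullet> \<phi> x) \<partial>lborel)
     / measure lebesgue E"

lemma edge_field_L2: "E \<in> T \<Longrightarrow> edge_field E p r e \<in> L2 \<Omega>" "E \<in> T \<Longrightarrow> edge_div E e \<in> L2 \<Omega>"
proof -
  assume E: "E \<in> T"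
  have "continuous_on UNIV (\<lambda>x. (bary (vertices E) r x * (1 / measure lebesgue E)) *\<^sub>R outer e (r - p))"
    by (intro continuous_intros)
  from restricted_in_L2[OF E this] show "edge_field E p r e \<in> L2 \<Omega>"
    by (simp add: edge_field_def[abs_def])
  have "continuous_on UNIV (\<lambda>x::real^'n. (1 / measure lebesgue E) *\<^sub>R e)" by (intro continuous_intros)
  from restricted_in_L2[OF E this] show "edge_div E e \<in> L2 \<Omega>"
    by (simp add: edge_div_def[abs_def])
qed

lemma edge_field_green:
  assumes E: "E \<in> T" and \<phi>: "C1_field \<phi>"
  shows "L2_inner \<Omega> (edge_field E p r e) (\<lambda>x. jacobian \<phi> (at x)) + L2_inner \<Omega> (edge_div E e) \<phi> = facet_flux E p r e \<phi>"
proof -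
  let ?m = "measure lebesgue E"
  let ?g = "\<lambda>x. bary (vertices E) r x * (e \<bullet> (jacobian \<phi> (at x) *v (r - p))) + e \<bullet> \<phi> x"
  have C1: "C1_scalar (\<lambda>x. e \<bullet> \<phi> x) (\<lambda>x t. e \<bullet> (jacobian \<phi> (at x) *v t))" by (rule C1_scalar_of_field[OF \<phi>])
  have g: "continuous_on UNIV ?g"
    using C1 by (intro continuous_on_add continuous_on_mult continuous_on_bary C1_scalar_continuous[OF C1]) (simp add: C1_scalar_def)
  have "L2_inner \<Omega> (edge_field E p r e) (\<lambda>x. jacobian \<phi> (at x)) + L2_inner \<Omega> (edge_div E e) \<phi>
    = (\<integral>x. edge_field E p r e x \<bullet> jacobian \<phi> (at x) + edge_div E e x \<bullet> \<phi> x \<partial>lebesgue_on \<Omega>)"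
    unfolding L2_inner_def
    using L2_inner_integrable[OF edge_field_L2(1)[OF E] C1_field_L2(2)[OF \<phi>]] L2_inner_integrable[OF edge_field_L2(2)[OF E] C1_field_L2(1)[OF \<phi>]]
    by simp
  also have "\<dots> = (\<integral>x. (indicator (interior E) x * ?g x) / ?m \<partial>lebesgue_on \<Omega>)"
    by (intro Bochner_Integration.integral_cong refl)
      (simp add: edge_field_def edge_div_def inner_commute[of "outer _ _"] inner_outer distrib_left add_divide_distrib mult_ac)
  also have "\<dots> = facet_flux E p r e \<phi>"
    using integral_on_element(1)[OF E g] by (simp add: facet_flux_def)
  finally show ?thesis .
qed

lemma facet_flux_eq_0:
  assumes E: "E \<in> T" and p: "p \<in> vertices E" and r: "r \<in> vertices E - {p}" and \<phi>: "C1_field \<phi>"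
    and z: "\<And>x. x \<in> convex hull (vertices E - {p}) \<Longrightarrow> \<phi> x = 0"
  shows "facet_flux E p r e \<phi> = 0"
proof -
  have "(\<integral>x. indicator (convex hull (vertices E)) x * (bary (vertices E) r x * (e \<bullet> (jacobian \<phi> (at x) *v (r - p))) + e \<bullet> \<phi> x) \<partial>lborel) = 0"
    by (rule edge_flux_eq_0[OF element_vertices(1)[OF E] p _ _ C1_scalar_of_field[OF \<phi>]]) (use r z in auto)
  then show ?thesis using element_vertices(2)[OF E] by (simp add: facet_flux_def)
qed

lemma facet_flux_shared:
  assumes E: "E \<in> T" "E' \<in> T" and ac: "across_facet E p E' p'" and r: "r \<in> vertices E - {p}" and \<phi>: "C1_field \<phi>"
  shows "facet_flux E p r e \<phi> = facet_flux E' p' r e \<phi>"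
  using edge_flux_shared_facet[OF element_vertices(1)[OF E(1)] _ element_vertices(1)[OF E(2)] _ _ r C1_scalar_of_field[OF \<phi>], of p' e]
    ac element_vertices(2)[OF E(1)] element_vertices(2)[OF E(2)]
  unfolding across_facet_def facet_flux_def by simp

text \<open>Green's formula for all test fields that vanish on the rest of the boundary contains both the
weak divergence and the vanishing normal trace, because fields with compact
support in the domain vanish on the whole boundary.\<close>

lemma in_stress_spaceI:
  assumes \<tau>: "\<tau> \<in> L2 \<Omega>" and w: "w \<in> L2 \<Omega>" and \<Gamma>: "\<Gamma> \<subseteq> frontier \<Omega>"
    and green: "\<And>\<phi>. C1_field \<phi> \<Longrightarrow> \<forall>x\<in>frontier \<Omega> - \<Gamma>. \<phi> x = 0 \<Longrightarrow>
      L2_inner \<Omega> \<tau> (\<lambda>x. jacobian \<phi> (at x)) + L2_inner \<Omega> w \<phi> = 0"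
  shows "\<tau> \<in> stress_space \<Omega> \<Gamma>" "AE x in lebesgue_on \<Omega>. weak_div \<Omega> \<tau> x = w x"
proof -
  have wd: "has_weak_div \<Omega> \<tau> w" unfolding has_weak_div_test
  proof (intro allI impI)
    fix \<phi> assume t: "test_field \<Omega> \<phi>"
    have "\<phi> x = 0" if "x \<in> frontier \<Omega>" for x
    proof (rule ccontr)
      assume "\<phi> x \<noteq> 0"
      then have "x \<in> closure {x. \<phi> x \<noteq> 0}" by (intro subsetD[OF closure_subset]) simp
      then have "x \<in> \<Omega>" using t unfolding test_field_def by blast
      then show False using that op by (simp add: frontier_def interior_open)
    qed
    then have "L2_inner \<Omega> \<tau> (\<lambda>x. jacobian \<phi> (at x)) + L2_inner \<Omega> w \<phi> = 0"
      using green t by (auto simp: test_field_def)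
    then show "L2_inner \<Omega> w \<phi> = - L2_inner \<Omega> \<tau> (\<lambda>x. jacobian \<phi> (at x))" by simp
  qed
  show AE: "AE x in lebesgue_on \<Omega>. weak_div \<Omega> \<tau> x = w x" using weak_div_AE[OF wd w] by blast
  have "normal_trace_zero \<Omega> \<Gamma> \<tau>" unfolding normal_trace_zero_def
  proof (intro allI impI)
    fix \<phi> assume \<phi>: "C1_field \<phi> \<and> (\<forall>x\<in>frontier \<Omega> - \<Gamma>. \<phi> x = 0)"
    have "L2_inner \<Omega> (weak_div \<Omega> \<tau>) \<phi> = L2_inner \<Omega> w \<phi>"
      using L2_inner_cong_left[OF AE weak_div_AE(1)[OF wd w] w] C1_field_L2 \<phi> by blast
    then show "L2_inner \<Omega> \<tau> (\<lambda>x. jacobian \<phi> (at x)) + L2_inner \<Omega> (weak_div \<Omega> \<tau>) \<phi> = 0"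
      using green \<phi> by simp
  qed
  then show "\<tau> \<in> stress_space \<Omega> \<Gamma>" using \<tau> w wd by (auto simp: stress_space_def)
qed

lemma edge_field_P1: assumes E: "E \<in> T" and D: "D \<in> T" shows "P1_on D (edge_field E p r e)"
proof (cases "D = E")
  case True
  define g where "g = bary_grad (vertices E) r"
  define M where "M = (1 / measure lebesgue E) *\<^sub>R outer e (r - p)"
  have "linear (\<lambda>x. (g \<bullet> x) *\<^sub>R M)" by (intro linearI) (auto simp: algebra_simps)
  moreover have "edge_field E p r e x = (g \<bullet> x) *\<^sub>R M + (1 - g \<bullet> r) *\<^sub>R M" if "x \<in> interior D" for x
    using that True by (simp add: edge_field_def bary_def g_def M_def algebra_simps divide_inverse)
  ultimately show ?thesis unfolding P1_on_def by blast
next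
  case False
  have "edge_field E p r e x = 0" if "x \<in> interior D" for x
    using that False interior_element_unique[OF D E that] interior_subset[of E] by (auto simp: edge_field_def indicator_def)
  then show ?thesis unfolding P1_on_def by (intro exI[of _ "\<lambda>x. 0"] conjI) (auto intro!: linearI)
qed

lemma P1_comb:
  assumes "P1_on D v" "P1_on D w" shows "P1_on D (\<lambda>x. v x + c *\<^sub>R w x)"
proof -
  obtain L b L' b' where *: "linear L" "\<And>x. x \<in> interior D \<Longrightarrow> v x = L x + b" "linear L'" "\<And>x. x \<in> interior D \<Longrightarrow> w x = L' x + b'"
    using assms unfolding P1_on_def by blast
  have "linear (\<lambda>x. L x + c *\<^sub>R L' x)" using *(1,3) by (intro linear_compose_add linear_compose_scale_right)
  moreover have "\<forall>x\<in>interior D. v x + c *\<^sub>R w x = (L x + c *\<^sub>R L' x) + (b + c *\<^sub>R b')"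
    using * by (simp add: algebra_simps)
  ultimately show ?thesis unfolding P1_on_def by blast
qed

definition facet_field :: "(real^'n) set \<Rightarrow> real^'n \<Rightarrow> (real^'n) set \<Rightarrow> real^'n \<Rightarrow> real^'n \<Rightarrow> real^'n \<Rightarrow> real^'n \<Rightarrow> real^'n^'n" where
  "facet_field E p E' p' r e = (\<lambda>x. edge_field E p r e x + (-1) *\<^sub>R edge_field E' p' r e x)"

text \<open>The boundary terms of the two sides agree by \<open>facet_flux_shared\<close> and cancel.\<close>

lemma interior_facet_field:
  assumes E: "E \<in> T" "E' \<in> T" and ac: "across_facet E p E' p'" and r: "r \<in> vertices E - {p}" and \<Gamma>: "\<Gamma> \<subseteq> frontier \<Omega>"
  shows "facet_field E p E' p' r e \<in> Xh \<Omega> \<Gamma> T" "AE x in lebesgue_on \<Omega>. weak_div \<Omega> (facet_field E p E' p' r e) x = edge_div E e x + (-1) *\<^sub>R edge_div E' e x"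
proof -
  have L: "facet_field E p E' p' r e \<in> L2 \<Omega>" "(\<lambda>x. edge_div E e x + (-1) *\<^sub>R edge_div E' e x) \<in> L2 \<Omega>"
    unfolding facet_field_def by (intro L2_comb edge_field_L2 E)+
  have green: "L2_inner \<Omega> (facet_field E p E' p' r e) (\<lambda>x. jacobian \<phi> (at x)) + L2_inner \<Omega> (\<lambda>x. edge_div E e x + (-1) *\<^sub>R edge_div E' e x) \<phi> = 0"
    if \<phi>: "C1_field \<phi>" for \<phi>
    unfolding facet_field_def
    using edge_field_green[OF E(1) \<phi>, of p r e] edge_field_green[OF E(2) \<phi>, of p' r e] facet_flux_shared[OF E ac r \<phi>, of e]
      L2_inner_comb_left[OF edge_field_L2(1)[OF E(1)] edge_field_L2(1)[OF E(2)] C1_field_L2(2)[OF \<phi>], of p r e "-1" p' r e]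
      L2_inner_comb_left[OF edge_field_L2(2)[OF E(1)] edge_field_L2(2)[OF E(2)] C1_field_L2(1)[OF \<phi>], of e "-1" e]
    by linarith
  note s = in_stress_spaceI[OF L \<Gamma> green]
  show "AE x in lebesgue_on \<Omega>. weak_div \<Omega> (facet_field E p E' p' r e) x = edge_div E e x + (-1) *\<^sub>R edge_div E' e x" using s by blast
  have "\<forall>D\<in>T. P1_on D (facet_field E p E' p' r e)" unfolding facet_field_def using P1_comb edge_field_P1 E by blast
  then show "facet_field E p E' p' r e \<in> Xh \<Omega> \<Gamma> T" using s by (simp add: Xh_def)
qed

text \<open>The test fields vanish on \<open>\<Gamma>D\<close>, hence on its closure, which contains the facet; so the boundary
term is zero.\<close>

lemma dirichlet_facet_field:
  assumes E: "E \<in> T" and p: "p \<in> vertices E" and r: "r \<in> vertices E - {p}"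
    and \<Gamma>: "boundary_partition \<Omega> \<Gamma>D \<Gamma>N" and F: "convex hull (vertices E - {p}) \<subseteq> closure \<Gamma>D"
  shows "edge_field E p r e \<in> Xh \<Omega> \<Gamma>N T" "AE x in lebesgue_on \<Omega>. weak_div \<Omega> (edge_field E p r e) x = edge_div E e x"
proof -
  have \<Gamma>': "\<Gamma>N \<subseteq> frontier \<Omega>" "frontier \<Omega> - \<Gamma>N = \<Gamma>D" using \<Gamma> by (auto simp: boundary_partition_def)
  have green: "L2_inner \<Omega> (edge_field E p r e) (\<lambda>x. jacobian \<phi> (at x)) + L2_inner \<Omega> (edge_div E e) \<phi> = 0"
    if \<phi>: "C1_field \<phi>" and z: "\<forall>x\<in>frontier \<Omega> - \<Gamma>N. \<phi> x = 0" for \<phi>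
  proof -
    have c: "continuous_on UNIV \<phi>" using \<phi> unfolding C1_field_def
      by (intro continuous_at_imp_continuous_on) (auto intro: differentiable_imp_continuous_within)
    have "\<phi> x = 0" if "x \<in> closure \<Gamma>D" for x
      by (rule continuous_constant_on_closure[OF continuous_on_subset[OF c] _ that]) (use z \<Gamma>' in auto)
    then have "facet_flux E p r e \<phi> = 0" using F by (intro facet_flux_eq_0 E p r \<phi>) auto
    then show ?thesis using edge_field_green[OF E \<phi>] by simp
  qed
  note s = in_stress_spaceI[OF edge_field_L2[OF E] \<Gamma>'(1) green]
  show "AE x in lebesgue_on \<Omega>. weak_div \<Omega> (edge_field E p r e) x = edge_div E e x" using s by blast
  show "edge_field E p r e \<in> Xh \<Omega> \<Gamma>N T" using s edge_field_P1 E by (simp add: Xh_def)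
qed

end

section \<open>Vertex values and the quadrature rule\<close>

context domain_mesh
begin

lemma at_within_interior_element_nontrivial:
  assumes E: "E \<in> T" and x: "x \<in> E" shows "at x within interior E \<noteq> bot"
proof -
  have "x islimpt interior E"
  proof (cases "x \<in> interior E")
    case True
    then show ?thesis using interior_limit_point[of x "interior E"] by simp
  next
    case False
    then show ?thesis using x closure_interior_element[OF E] by (auto simp: closure_def)
  qed
  then show ?thesis using trivial_limit_within by blast
qed

lemma value_from_eqI:
  "E \<in> T \<Longrightarrow> x \<in> E \<Longrightarrow> (w \<longlongrightarrow> l) (at x within interior E) \<Longrightarrow> value_from E w x = l"
  unfolding value_from_def using at_within_interior_element_nontrivial by (intro tendsto_Lim) auto

lemma value_from_cong_interior:
  "(\<And>x. x \<in> interior E \<Longrightarrow> v x = w x) \<Longrightarrow> value_from E v x = value_from E w x"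
proof -
  assume *: "\<And>x. x \<in> interior E \<Longrightarrow> v x = w x"
  have "(v \<longlongrightarrow> l) (at x within interior E) \<longleftrightarrow> (w \<longlongrightarrow> l) (at x within interior E)" for l
    by (rule tendsto_cong) (auto simp: eventually_at_filter *)
  then show ?thesis by (simp add: value_from_def t2_space_class.Lim_def)
qed

lemma P1_value_from:
  fixes w :: "'a \<Rightarrow> 'b::euclidean_space"
  assumes E: "E \<in> T" and w: "P1_on E w"
  shows "\<exists>L b. linear L \<and> (\<forall>x\<in>interior E. w x = L x + b) \<and> (\<forall>x\<in>E. value_from E w x = L x + b)"
proof -
  obtain L b where L: "linear L" "\<And>x. x \<in> interior E \<Longrightarrow> w x = L x + b" using w unfolding P1_on_def by blast
  have "value_from E w x = L x + b" if x: "x \<in> E" for x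
  proof (rule value_from_eqI[OF E x])
    have bl: "bounded_linear L" using L linear_conv_bounded_linear by blast
    have "((\<lambda>x. L x + b) \<longlongrightarrow> L x + b) (at x within interior E)"
      by (intro tendsto_add tendsto_const bounded_linear.tendsto[OF bl] tendsto_ident_at)
    then show "(w \<longlongrightarrow> L x + b) (at x within interior E)"
      by (rule Lim_transform_eventually) (auto simp: eventually_at_filter L(2))
  qed
  then show ?thesis using L by blast
qed

lemma value_from_interior:
  assumes "E \<in> T" "P1_on E w" "x \<in> interior E"
  shows "value_from E w x = w x"
  using P1_value_from[OF assms(1,2)] assms(3) interior_subset by force

lemma value_from_comb:
  assumes E: "E \<in> T" and v: "P1_on E v" and w: "P1_on E w" and x: "x \<in> E"
  shows "value_from E (\<lambda>x. v x + c *\<^sub>R w x) x = value_from E v x + c *\<^sub>R value_from E w x"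
proof -
  obtain L b where L: "linear L" "\<And>x. x \<in> interior E \<Longrightarrow> v x = L x + b" "\<And>x. x \<in> E \<Longrightarrow> value_from E v x = L x + b"
    using P1_value_from[OF E v] by blast
  obtain L' b' where L': "linear L'" "\<And>x. x \<in> interior E \<Longrightarrow> w x = L' x + b'" "\<And>x. x \<in> E \<Longrightarrow> value_from E w x = L' x + b'"
    using P1_value_from[OF E w] by blast
  have bl: "bounded_linear L" "bounded_linear L'" using L L' linear_conv_bounded_linear by blast+
  have "((\<lambda>x. (L x + b) + c *\<^sub>R (L' x + b')) \<longlongrightarrow> (L x + b) + c *\<^sub>R (L' x + b')) (at x within interior E)"
    by (intro tendsto_intros bounded_linear.tendsto[OF bl(1)] bounded_linear.tendsto[OF bl(2)])
  then have "((\<lambda>x. v x + c *\<^sub>R w x) \<longlongrightarrow> (L x + b) + c *\<^sub>R (L' x + b')) (at x within interior E)"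
    by (rule Lim_transform_eventually) (auto simp: eventually_at_filter L(2) L'(2))
  then show ?thesis using value_from_eqI[OF E x] L(3)[OF x] L'(3)[OF x] by simp
qed

lemma value_from_zero:
  assumes "E \<in> T" "x \<in> E" "\<And>x. x \<in> interior E \<Longrightarrow> w x = 0" shows "value_from E w x = 0"
  by (rule value_from_eqI[OF assms(1,2)])
    (rule tendsto_eventually, auto simp: eventually_at_filter assms(3))

lemma P1_affine_value:
  fixes w :: "'a \<Rightarrow> 'b::euclidean_space"
  assumes E: "E \<in> T" and w: "P1_on E w" and x: "x \<in> E"
  shows "value_from E w x = (\<Sum>v\<in>vertices E. bary (vertices E) v x *\<^sub>R value_from E w v)"
proof -
  obtain L b where L: "linear L" "\<And>x. x \<in> E \<Longrightarrow> value_from E w x = L x + b"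
    using P1_value_from[OF E w] by blast
  have V: "full_simplex (vertices E)" using E element_vertices by blast
  have "(\<Sum>v\<in>vertices E. bary (vertices E) v x *\<^sub>R value_from E w v)
    = (\<Sum>v\<in>vertices E. bary (vertices E) v x *\<^sub>R (L v + b))"
    using L(2) vertex_in_element[OF E] by (intro sum.cong) auto
  also have "\<dots> = L (\<Sum>v\<in>vertices E. bary (vertices E) v x *\<^sub>R v) + (\<Sum>v\<in>vertices E. bary (vertices E) v x) *\<^sub>R b"
    by (simp add: linear_sum[OF L(1)] linear_scale[OF L(1)] scaleR_add_right sum.distrib scaleR_sum_left)
  finally show ?thesis using bary_repr[OF V, of x] L(2)[OF x] by simp
qed

lemma P1_constant_if_vertex_values:
  fixes w :: "'a \<Rightarrow> 'b::euclidean_space"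
  assumes E: "E \<in> T" and w: "P1_on E w" and k: "\<And>r. r \<in> vertices E \<Longrightarrow> value_from E w r = k" and x: "x \<in> interior E"
  shows "w x = k"
proof -
  have xE: "x \<in> E" using x interior_subset by blast
  have "w x = (\<Sum>v\<in>vertices E. bary (vertices E) v x *\<^sub>R k)"
    using P1_affine_value[OF E w xE] value_from_interior[OF E w x] k by simp
  also have "\<dots> = (\<Sum>v\<in>vertices E. bary (vertices E) v x) *\<^sub>R k" by (simp add: scaleR_sum_left)
  finally show ?thesis using bary_repr(1)[of "vertices E" x] element_vertices[OF E] by simp
qed

lemma P0_imp_P1: "P0_on E w \<Longrightarrow> P1_on E w"
  unfolding P0_on_def P1_on_def by (metis add_0 linear_zero)

lemma P0_value:
  assumes E: "E \<in> T" and w: "P0_on E w" and x: "x \<in> E" and y: "y \<in> interior E"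
  shows "value_from E w x = w y"
proof -
  obtain b where b: "\<And>x. x \<in> interior E \<Longrightarrow> w x = b" using w unfolding P0_on_def by blast
  have "value_from E w x = b"
    by (rule value_from_eqI[OF E x], rule tendsto_eventually) (auto simp: eventually_at_filter b)
  then show ?thesis using b y by simp
qed

lemma quad_comb_right:
  assumes "\<And>E. E \<in> T \<Longrightarrow> P1_on E w" "\<And>E. E \<in> T \<Longrightarrow> P1_on E w'"
  shows "quad T v (\<lambda>x. w x + c *\<^sub>R w' x) = quad T v w + c * quad T v w'"
proof -
  have "quad_elem E v (\<lambda>x. w x + c *\<^sub>R w' x) = quad_elem E v w + c * quad_elem E v w'" if E: "E \<in> T" for E
  proof -
    have "(\<Sum>r\<in>vertices E. value_from E v r \<bullet> value_from E (\<lambda>x. w x + c *\<^sub>R w' x) r)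
      = (\<Sum>r\<in>vertices E. value_from E v r \<bullet> value_from E w r + c * (value_from E v r \<bullet> value_from E w' r))"
      using value_from_comb[OF E assms(1)[OF E] assms(2)[OF E]] vertex_in_element[OF E]
      by (intro sum.cong) (auto simp: inner_add_right)
    then show ?thesis by (simp add: quad_elem_def sum.distrib sum_distrib_left algebra_simps)
  qed
  then show ?thesis by (simp add: quad_def sum.distrib sum_distrib_left)
qed

lemma quad_commute: "quad T v w = quad T w v"
  by (simp add: quad_def quad_elem_def inner_commute)

lemma quad_zero_left:
  assumes "\<And>E x. E \<in> T \<Longrightarrow> x \<in> interior E \<Longrightarrow> w x = 0" shows "quad T w v = 0"
  unfolding quad_def quad_elem_def
  using value_from_zero[OF _ vertex_in_element assms] by (auto intro!: sum.neutral)

end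

context cartesian_mesh
begin

lemma edge_field_vertex_value:
  assumes E: "E \<in> T" and D: "D \<in> T" and r: "r \<in> vertices E" and q: "q \<in> vertices D"
  shows "value_from D (edge_field E p r e) q = (if D = E \<and> q = r then (1 / measure lebesgue E) *\<^sub>R outer e (r - p) else 0)"
proof (cases "D = E")
  case True
  have qE: "q \<in> E" using vertex_in_element D q True by blast
  have "((\<lambda>x. (bary (vertices E) r x / measure lebesgue E) *\<^sub>R outer e (r - p)) \<longlongrightarrow>
     (bary (vertices E) r q / measure lebesgue E) *\<^sub>R outer e (r - p)) (at q within interior E)"
    unfolding bary_def using measure_element_pos[OF E] by (intro tendsto_intros) auto
  then have "(edge_field E p r e \<longlongrightarrow> (bary (vertices E) r q / measure lebesgue E) *\<^sub>R outer e (r - p)) (at q within interior E)"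
    by (rule Lim_transform_eventually) (auto simp: eventually_at_filter edge_field_def)
  then have "value_from E (edge_field E p r e) q = (bary (vertices E) r q / measure lebesgue E) *\<^sub>R outer e (r - p)"
    by (rule value_from_eqI[OF E qE])
  then show ?thesis using bary_vertex[of "vertices E" r q] element_vertices[OF E] r q True by auto
next
  case False
  have "edge_field E p r e x = 0" if "x \<in> interior D" for x
    using that False interior_element_unique[OF D E that] interior_subset[of E] by (auto simp: edge_field_def indicator_def)
  then have "value_from D (edge_field E p r e) q = 0" by (intro value_from_zero[OF D vertex_in_element[OF D q]])
  then show ?thesis using False by simp
qed

text \<open>Only the value at the vertex \<open>r\<close> of \<open>E\<close> contributes, and there the volume in the quadrature weight cancels the
normalization of the field.\<close>

lemma quad_edge_field:
  assumes E: "E \<in> T" and r: "r \<in> vertices E"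
  shows "quad T \<gamma> (edge_field E p r e) = (e \<bullet> (value_from E \<gamma> r *v (r - p))) / (real CARD('n) + 1)"
proof -
  let ?k = "real CARD('n) + 1" and ?m = "measure lebesgue E"
  have "quad_elem D \<gamma> (edge_field E p r e) = (if D = E then (e \<bullet> (value_from E \<gamma> r *v (r - p))) / ?k else 0)" if D: "D \<in> T" for D
  proof -
    have "(\<Sum>q\<in>vertices D. value_from D \<gamma> q \<bullet> value_from D (edge_field E p r e) q)
      = (\<Sum>q\<in>vertices D. if D = E \<and> q = r then (e \<bullet> (value_from E \<gamma> r *v (r - p))) / ?m else 0)"
      using edge_field_vertex_value[OF E D r] by (intro sum.cong) (auto simp: inner_outer)
    also have "\<dots> = (if D = E then (e \<bullet> (value_from E \<gamma> r *v (r - p))) / ?m else 0)"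
      using r finite_vertices[OF E] by auto
    finally show ?thesis using measure_element_pos[OF E] by (simp add: quad_elem_def)
  qed
  then show ?thesis using finite_mesh E by (simp add: quad_def)
qed

lemma L2_inner_edge_div:
  assumes E: "E \<in> T" and u: "P0_on E u" and x: "x \<in> E"
  shows "L2_inner \<Omega> u (edge_div E e) = value_from E u x \<bullet> e"
proof -
  obtain y where y: "y \<in> interior E" using interior_element_nonempty[OF E] by blast
  let ?b = "value_from E u x"
  have b: "u y = ?b" if "y \<in> interior E" for y using P0_value[OF E u x that] by simp
  have "L2_inner \<Omega> u (edge_div E e) = (\<integral>x. indicator (interior E) x * ((?b \<bullet> e) / measure lebesgue E) \<partial>lebesgue_on \<Omega>)"
    unfolding L2_inner_def by (intro Bochner_Integration.integral_cong) (auto simp: edge_div_def indicator_def b)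
  also have "\<dots> = (\<integral>x. indicator E x * ((?b \<bullet> e) / measure lebesgue E) \<partial>lborel)"
    by (intro integral_on_element E continuous_intros)
  also have "\<dots> = measure lborel E * ((?b \<bullet> e) / measure lebesgue E)"
    using borel_compact[OF compact_element[OF E]] by simp
  also have "measure lborel E = measure lebesgue E"
    using borel_compact[OF compact_element[OF E]] by (simp add: measure_completion)
  finally show ?thesis using measure_element_pos[OF E] by simp
qed

end

text \<open>The one-sided value of the coefficient at a vertex; the bounds on \<open>A\<close> survive the limit.\<close>

definition vertex_tensor :: "(real^'n \<Rightarrow> real^'n^'n \<Rightarrow> real^'n^'n) \<Rightarrow> (real^'n) set \<Rightarrow> real^'n \<Rightarrow> real^'n^'n \<Rightarrow> real^'n^'n" where
  "vertex_tensor A E r S = value_from E (\<lambda>x. A x S) r"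

locale elastic_mesh = cartesian_mesh \<Omega> T for \<Omega> :: "(real^'n) set" and T +
  fixes A :: "real^'n \<Rightarrow> real^'n^'n \<Rightarrow> real^'n^'n"
  assumes compliance: "compliance_tensor \<Omega> A" and vertex_values: "has_vertex_values T A"
begin

lemma vertex_tensor_tendsto:
  assumes E: "E \<in> T" and r: "r \<in> vertices E"
  shows "((\<lambda>x. A x S) \<longlongrightarrow> vertex_tensor A E r S) (at r within interior E)"
proof -
  obtain R where R: "((\<lambda>x. A x S) \<longlongrightarrow> R) (at r within interior E)"
    using vertex_values E r unfolding has_vertex_values_def by blast
  then show ?thesis using value_from_eqI[OF E vertex_in_element[OF E r] R] by (simp add: vertex_tensor_def)
qed

lemma eventually_near_vertex: "E \<in> T \<Longrightarrow> (\<And>x. x \<in> \<Omega> \<Longrightarrow> P x) \<Longrightarrow> eventually P (at r within interior E)"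
  using interior_element_subset[of E] unfolding eventually_at_filter by (intro always_eventually) blast

lemma vertex_tensor_symmetric:
  assumes E: "E \<in> T" and r: "r \<in> vertices E"
  shows "vertex_tensor A E r S \<bullet> R = S \<bullet> vertex_tensor A E r R"
proof -
  note nb = at_within_interior_element_nontrivial[OF E vertex_in_element[OF E r]]
  have "((\<lambda>x. A x S \<bullet> R) \<longlongrightarrow> vertex_tensor A E r S \<bullet> R) (at r within interior E)"
    by (intro tendsto_intros vertex_tensor_tendsto E r)
  moreover have "((\<lambda>x. A x S \<bullet> R) \<longlongrightarrow> S \<bullet> vertex_tensor A E r R) (at r within interior E)"
  proof (rule Lim_transform_eventually)
    show "((\<lambda>x. S \<bullet> A x R) \<longlongrightarrow> S \<bullet> vertex_tensor A E r R) (at r within interior E)"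
      by (intro tendsto_intros vertex_tensor_tendsto E r)
    show "eventually (\<lambda>x. S \<bullet> A x R = A x S \<bullet> R) (at r within interior E)"
      using compliance by (intro eventually_near_vertex E) (auto simp: compliance_tensor_def)
  qed
  ultimately show ?thesis using tendsto_unique[OF nb] by blast
qed

lemma vertex_tensor_coercive:
  "\<exists>\<alpha>>0. \<forall>E\<in>T. \<forall>r\<in>vertices E. \<forall>S. vertex_tensor A E r S \<bullet> S \<ge> \<alpha> * (norm S)\<^sup>2"
proof -
  obtain \<alpha> where \<alpha>: "\<alpha> > 0" "\<And>x S. x \<in> \<Omega> \<Longrightarrow> A x S \<bullet> S \<ge> \<alpha> * (norm S)\<^sup>2"
    using compliance unfolding compliance_tensor_def by blast
  have "vertex_tensor A E r S \<bullet> S \<ge> \<alpha> * (norm S)\<^sup>2" if E: "E \<in> T" and r: "r \<in> vertices E" for E r S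
  proof (rule tendsto_lowerbound)
    show "((\<lambda>x. A x S \<bullet> S) \<longlongrightarrow> vertex_tensor A E r S \<bullet> S) (at r within interior E)"
      by (intro tendsto_intros vertex_tensor_tendsto E r)
    show "eventually (\<lambda>x. \<alpha> * (norm S)\<^sup>2 \<le> A x S \<bullet> S) (at r within interior E)"
      by (intro eventually_near_vertex E \<alpha>)
    show "at r within interior E \<noteq> bot" using at_within_interior_element_nontrivial[OF E vertex_in_element[OF E r]] .
  qed
  then show ?thesis using \<alpha> by blast
qed

text \<open>The coefficient has a limit only for each fixed matrix; uniform boundedness takes care of
the variation of the argument \<open>\<sigma> x\<close>.\<close>

lemma value_from_tensor:
  assumes E: "E \<in> T" and r: "r \<in> vertices E" and \<sigma>: "P1_on E \<sigma>"
  shows "value_from E (\<lambda>x. A x (\<sigma> x)) r = vertex_tensor A E r (value_from E \<sigma> r)"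
proof (rule value_from_eqI[OF E vertex_in_element[OF E r]])
  let ?S = "value_from E \<sigma> r" and ?F = "at r within interior E"
  obtain L b where L: "linear L" "\<And>x. x \<in> interior E \<Longrightarrow> \<sigma> x = L x + b" "\<And>x. x \<in> E \<Longrightarrow> value_from E \<sigma> x = L x + b"
    using P1_value_from[OF E \<sigma>] by blast
  have bl: "bounded_linear L" using L linear_conv_bounded_linear by blast
  have rE: "r \<in> E" using E r vertex_in_element by blast
  have "((\<lambda>x. L x + b) \<longlongrightarrow> L r + b) ?F"
    by (intro tendsto_intros bounded_linear.tendsto[OF bl])
  then have \<sigma>l: "(\<sigma> \<longlongrightarrow> ?S) ?F"
    unfolding L(3)[OF rE] by (rule Lim_transform_eventually) (auto simp: eventually_at_filter L(2))
  obtain C where C: "\<And>x S. x \<in> \<Omega> \<Longrightarrow> norm (A x S) \<le> C * norm S"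
    using compliance unfolding compliance_tensor_def by blast
  have "((\<lambda>x. A x (\<sigma> x - ?S)) \<longlongrightarrow> 0) ?F"
  proof (rule Lim_null_comparison)
    show "eventually (\<lambda>x. norm (A x (\<sigma> x - ?S)) \<le> C * norm (\<sigma> x - ?S)) ?F" by (intro eventually_near_vertex E C)
    have "((\<lambda>x. C * norm (\<sigma> x - ?S)) \<longlongrightarrow> C * norm (?S - ?S)) ?F" by (intro tendsto_intros \<sigma>l)
    then show "((\<lambda>x. C * norm (\<sigma> x - ?S)) \<longlongrightarrow> 0) ?F" by simp
  qed
  then have "((\<lambda>x. A x ?S + A x (\<sigma> x - ?S)) \<longlongrightarrow> vertex_tensor A E r ?S + 0) ?F"
    by (intro tendsto_add vertex_tensor_tendsto E r)
  then have "((\<lambda>x. A x ?S + A x (\<sigma> x - ?S)) \<longlongrightarrow> vertex_tensor A E r ?S) ?F" by simp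
  then show "((\<lambda>x. A x (\<sigma> x)) \<longlongrightarrow> vertex_tensor A E r ?S) ?F"
  proof (rule Lim_transform_eventually)
    show "eventually (\<lambda>x. A x ?S + A x (\<sigma> x - ?S) = A x (\<sigma> x)) ?F"
    proof (rule eventually_near_vertex[OF E])
      fix x assume "x \<in> \<Omega>"
      then have "linear (A x)" using compliance unfolding compliance_tensor_def by blast
      then show "A x ?S + A x (\<sigma> x - ?S) = A x (\<sigma> x)" by (simp flip: linear_add)
    qed
  qed
qed

lemma quad_tensor:
  assumes "\<And>E. E \<in> T \<Longrightarrow> P1_on E \<sigma>"
  shows "quad T (\<lambda>x. A x (\<sigma> x)) \<tau> = (\<Sum>E\<in>T. measure lebesgue E / real (DIM(real^'n) + 1) *
     (\<Sum>r\<in>vertices E. vertex_tensor A E r (value_from E \<sigma> r) \<bullet> value_from E \<tau> r))"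
  unfolding quad_def quad_elem_def using value_from_tensor assms by simp

lemma quad_tensor_symmetric:
  assumes "\<And>E. E \<in> T \<Longrightarrow> P1_on E \<sigma>" "\<And>E. E \<in> T \<Longrightarrow> P1_on E \<tau>"
  shows "quad T (\<lambda>x. A x (\<sigma> x)) \<tau> = quad T (\<lambda>x. A x (\<tau> x)) \<sigma>"
  by (subst quad_tensor, rule assms, assumption, subst quad_tensor, rule assms, assumption,
      intro sum.cong refl arg_cong2[where f = "(*)"]) (metis inner_commute vertex_tensor_symmetric)

lemma quad_tensor_definite:
  assumes \<sigma>: "\<And>E. E \<in> T \<Longrightarrow> P1_on E \<sigma>" and z: "quad T (\<lambda>x. A x (\<sigma> x)) \<sigma> = 0" and E: "E \<in> T" and x: "x \<in> interior E"
  shows "\<sigma> x = 0"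
proof -
  obtain \<alpha> where \<alpha>: "\<alpha> > 0" "\<And>E r S. E \<in> T \<Longrightarrow> r \<in> vertices E \<Longrightarrow> vertex_tensor A E r S \<bullet> S \<ge> \<alpha> * (norm S)\<^sup>2"
    using vertex_tensor_coercive by blast
  let ?t = "\<lambda>E r. vertex_tensor A E r (value_from E \<sigma> r) \<bullet> value_from E \<sigma> r"
  have nn: "?t E r \<ge> 0" if "E \<in> T" "r \<in> vertices E" for E r
    using \<alpha>(2)[OF that, of "value_from E \<sigma> r"] \<alpha>(1) by (meson mult_nonneg_nonneg less_imp_le order_trans zero_le_power2)
  have qt: "quad T (\<lambda>x. A x (\<sigma> x)) \<sigma> = (\<Sum>E\<in>T. measure lebesgue E / real (DIM(real^'n) + 1) * (\<Sum>r\<in>vertices E. ?t E r))"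
    by (rule quad_tensor) (rule \<sigma>)
  have "\<forall>E\<in>T. measure lebesgue E / real (DIM(real^'n) + 1) * (\<Sum>r\<in>vertices E. ?t E r) = 0"
    using z unfolding qt
    by (rule sum_nonneg_eq_0_iff[OF finite_mesh, THEN iffD1, rotated]) (auto intro!: mult_nonneg_nonneg divide_nonneg_nonneg sum_nonneg nn)
  then have "(\<Sum>r\<in>vertices E. ?t E r) = 0" using E measure_element_pos[OF E] by auto
  then have "\<forall>r\<in>vertices E. ?t E r = 0"
    using nn[OF E] by (subst (asm) sum_nonneg_eq_0_iff[OF finite_vertices[OF E]]) auto
  then have "\<alpha> * (norm (value_from E \<sigma> r))\<^sup>2 \<le> 0" if "r \<in> vertices E" for r using \<alpha>(2)[OF E that, of "value_from E \<sigma> r"] that by simp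
  then have "value_from E \<sigma> r = 0" if "r \<in> vertices E" for r using \<alpha>(1) that
    by (simp add: mult_le_0_iff)
  then show ?thesis using P1_constant_if_vertex_values[OF E \<sigma>[OF E] _ x] by blast
qed

end

section \<open>The algebraic kernel equations\<close>

lemma skew_mat_entries: "skew_mat D \<longleftrightarrow> (\<forall>a b. D $ a $ b = - (D $ b $ a))"
proof -
  have "skew_mat D \<longleftrightarrow> (\<forall>b a. D $ a $ b = - (D $ b $ a))"
    by (simp add: skew_mat_def transpose_def vec_eq_iff)
  then show ?thesis by (simp only: all_comm[of "\<lambda>a b. D $ a $ b = - (D $ b $ a)"])
qed

lemma skew_mat_entry: "skew_mat D \<Longrightarrow> D $ a $ b = - (D $ b $ a)"
  unfolding skew_mat_entries by blast

lemma skew_mat_diff: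
  assumes "skew_mat D" "skew_mat E" shows "skew_mat (D - E)"
  unfolding skew_mat_entries
proof (intro allI)
  fix a b
  have "D $ a $ b - E $ a $ b = - (D $ b $ a - E $ b $ a)"
    using skew_mat_entry[OF assms(1), of a b] skew_mat_entry[OF assms(2), of a b] by linarith
  then show "(D - E) $ a $ b = - ((D - E) $ b $ a)" by simp
qed

text \<open>Normalizing a spanning vector \<open>w\<close> of the kernel by \<open>w $ k = 1\<close> makes the \<open>k\<close>-th coordinate a parameter
of the kernel. In dimension three, \<open>w\<close> is a multiple of the axial vector of \<open>D\<close>.\<close>

lemma skew_kernel:
  fixes D :: "real^'n^'n"
  assumes card: "CARD('n) \<in> {2, 3}" and sk: "skew_mat D" and nz: "D \<noteq> 0"
  shows "\<exists>k w. w $ k = 1 \<and> (\<forall>x. D *v x = 0 \<longrightarrow> x = (x $ k) *\<^sub>R w) \<and> (CARD('n) = 2 \<longrightarrow> (\<forall>x. D *v x = 0 \<longrightarrow> x = 0))"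
proof -
  have anti: "D $ a $ b = - D $ b $ a" for a b
    by (rule skew_mat_entry[OF sk])
  obtain i j where ij: "D $ i $ j \<noteq> 0" using nz by (auto simp: vec_eq_iff)
  have diag: "D $ a $ a = 0" for a using anti[of a a] by simp
  have "i \<noteq> j" using ij diag by auto
  have fin: "finite (UNIV :: 'n set)" by simp
  have expand: "(D *v x) $ a = (\<Sum>b\<in>UNIV. D $ a $ b * x $ b)" for x a by (simp add: matrix_vector_mult_def)
  consider "CARD('n) = 2" | "CARD('n) = 3" using card by auto
  then show ?thesis
  proof cases
    case 1
    have U: "UNIV = {i, j}" using \<open>i \<noteq> j\<close> 1 by (intro card_seteq[symmetric]) auto
    have "x = 0" if "D *v x = 0" for x
    proof -
      have "(D *v x) $ i = 0" "(D *v x) $ j = 0" using that by auto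
      then have "x $ j = 0" "x $ i = 0" using ij \<open>i \<noteq> j\<close> diag anti[of j i] unfolding expand U by auto
      then show ?thesis using U by (metis (full_types) UNIV_I empty_iff insert_iff vec_eq_iff zero_index)
    qed
    then show ?thesis by (intro exI[of _ i] exI[of _ "axis i 1"]) fastforce
  next
    case 2
    have "card (UNIV - {i, j}) = 1" using 2 \<open>i \<noteq> j\<close> by (simp add: card_Diff_subset)
    then obtain k where k: "UNIV - {i, j} = {k}" by (auto simp: card_1_singleton_iff)
    then have U: "UNIV = {i, j, k}" "k \<noteq> i" "k \<noteq> j" by auto
    define w :: "real^'n" where "w = (\<chi> a. if a = i then D $ j $ k / D $ i $ j else if a = j then - D $ i $ k / D $ i $ j else 1)"
    have "x = (x $ k) *\<^sub>R w" if "D *v x = 0" for x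
    proof -
      have "(D *v x) $ i = 0" "(D *v x) $ j = 0" using that by auto
      then have "D $ i $ j * x $ j + D $ i $ k * x $ k = 0" "- D $ i $ j * x $ i + D $ j $ k * x $ k = 0"
        using U \<open>i \<noteq> j\<close> diag anti[of j i] unfolding expand U(1) by auto
      then have "x $ j = (x $ k) * w $ j" "x $ i = (x $ k) * w $ i" "x $ k = (x $ k) * w $ k"
        using ij \<open>i \<noteq> j\<close> U by (auto simp: w_def field_simps)
      note c = this
      show ?thesis unfolding vec_eq_iff vector_scaleR_component real_scaleR_def
      proof
        fix a
        have "a \<in> {i, j, k}" using U(1) by blast
        then show "x $ a = x $ k * w $ a" using c by (elim insertE) (simp_all only: empty_iff)
      qed
    qed
    moreover have "w $ k = 1" using U by (simp add: w_def)
    ultimately show ?thesis using 2 by (intro exI[of _ k] exI[of _ w]) auto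
  qed
qed

context cartesian_mesh
begin

text \<open>The mean of the vertices of the facet is interior to the union of the two elements, and the
domain is regular open.\<close>

lemma across_facet_interior:
  assumes E: "E \<in> T" "E' \<in> T" and ac: "across_facet E p E' p'"
  shows "convex hull (vertices E - {p}) \<inter> \<Omega> \<noteq> {}"
proof -
  let ?V = "vertices E" and ?F = "vertices E - {p}" and ?c = "1 / real (card (vertices E - {p}))"
  have V: "full_simplex ?V" and fin: "finite ?V" using E element_vertices finite_vertices by auto
  have pV: "p \<in> ?V" using ac by (simp add: across_facet_def)
  have cF: "card ?F > 0" using V fin pV DIM_positive[where 'a="real^'n"] by (simp add: full_simplex_def)
  then have F0: "?F \<noteq> {}" by (metis card.empty less_irrefl)
  have c: "?c > 0" using cF by simp
  define m where "m = (\<Sum>v\<in>?F. ?c *\<^sub>R v)"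
  have bm: "bary ?V q m = (if q = p then 0 else ?c)" if "q \<in> ?V" for q
    using bary_mean[OF V, of ?F q] F0 that by (auto simp: m_def)
  have "m \<in> interior (E \<union> E')"
    by (rule interior_union_across[OF E ac]) (use bm pV c in auto)
  moreover have "interior (E \<union> E') \<subseteq> \<Omega>"
    using interior_mono[of "E \<union> E'" "closure \<Omega>"] element_subset[OF E(1)] element_subset[OF E(2)] interior_closure_domain by auto
  moreover have "m \<in> convex hull ?F"
    using mem_face[OF E(1), of ?F m] mem_element[OF E(1), of m] bm c pV by auto
  ultimately show ?thesis by blast
qed

lemma facet_vertices:
  assumes "E \<in> T" "p \<in> vertices E"
  shows "finite (vertices E - {p})" "card (vertices E - {p}) = CARD('n)" "vertices E - {p} \<noteq> {}"
proof -
  have "full_simplex (vertices E)" "finite (vertices E)" using assms element_vertices finite_vertices by auto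
  then show f: "finite (vertices E - {p})" "card (vertices E - {p}) = CARD('n)"
    using assms by (auto simp: full_simplex_def)
  have "CARD('n) \<noteq> 0" by simp
  then show "vertices E - {p} \<noteq> {}" using f(2) by (metis card.empty)
qed

text \<open>Let \<open>D = G E0 s - G E0 c\<close> be nonzero. All facets that contain \<open>c\<close> are interior, so one can
cross any facet that contains the edge \<open>cs\<close>, which does not change \<open>D\<close> and gives \<open>D (p' - p) = 0\<close>.
In the plane this contradicts injectivity of \<open>D\<close>. In space the kernel of \<open>D\<close> is spanned by some
\<open>w\<close>. Among all tetrahedra with edge \<open>cs\<close> reached in this way and all their vertices off the edge,
let \<open>p\<close> be one with maximal coordinate along \<open>w\<close>. Going around the edge in either direction to
the vertex after next changes this coordinate by a nonzero amount, and orientation forces the two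
changes to have opposite signs, against maximality.

Orientation around the edge is measured in the coordinates of the first tetrahedron, by
\<open>\<omega>(x, y) = \<lambda>\<^sub>a(x) \<lambda>\<^sub>p(y) - \<lambda>\<^sub>a(y) \<lambda>\<^sub>p(x)\<close>, an area form on the plane transversal to the edge.\<close>

lemma kernel_rotation_local:
  fixes G :: "(real^'n) set \<Rightarrow> real^'n \<Rightarrow> real^'n^'n" and U :: "(real^'n) set \<Rightarrow> real^'n"
  assumes card: "CARD('n) \<in> {2, 3}"
    and skew: "\<And>E r. E \<in> T \<Longrightarrow> r \<in> vertices E \<Longrightarrow> skew_mat (G E r)"
    and cont: "\<And>E p E' p' r. E \<in> T \<Longrightarrow> E' \<in> T \<Longrightarrow> across_facet E p E' p' \<Longrightarrow> r \<in> vertices E - {p} \<Longrightarrow> G E' r = G E r"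
    and eq: "\<And>E p E' p' r. E \<in> T \<Longrightarrow> E' \<in> T \<Longrightarrow> across_facet E p E' p' \<Longrightarrow> r \<in> vertices E - {p} \<Longrightarrow>
        K *\<^sub>R (U E - U E') + G E r *v (p' - p) = 0"
    and c: "c \<in> \<Omega>" and E0: "E0 \<in> T" "c \<in> vertices E0" "s \<in> vertices E0"
  shows "G E0 s = G E0 c"
proof (rule ccontr)
  assume ne: "G E0 s \<noteq> G E0 c"
  then have cs: "s \<noteq> c" by auto
  define D where "D = G E0 s - G E0 c"
  have "D \<noteq> 0" using ne by (simp add: D_def)
  moreover have "skew_mat D" unfolding D_def by (intro skew_mat_diff skew E0)
  ultimately obtain k w where w: "w $ k = 1" "\<And>x. D *v x = 0 \<Longrightarrow> x = (x $ k) *\<^sub>R w"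
      "\<And>x. CARD('n) = 2 \<Longrightarrow> D *v x = 0 \<Longrightarrow> x = 0"
    using skew_kernel[OF card] by blast
  define S where "S = {E\<in>T. c \<in> vertices E \<and> s \<in> vertices E \<and> G E s - G E c = D}"
  have step: "\<exists>E'\<in>S. \<exists>p'. across_facet E p E' p' \<and> D *v (p' - p) = 0"
    if E: "E \<in> S" and p: "p \<in> vertices E - {c, s}" for E p
  proof -
    have ET: "E \<in> T" using E by (simp add: S_def)
    have cF: "c \<in> vertices E - {p}" "s \<in> vertices E - {p}" using E p by (auto simp: S_def)
    then have "convex hull (vertices E - {p}) \<inter> \<Omega> \<noteq> {}" using c hull_inc[OF cF(1), of convex] by blast
    then obtain E' p' where E': "E' \<in> T" "across_facet E p E' p'" using neighbor_across_interior_facet[OF ET] p by blast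
    have "G E' s = G E s" "G E' c = G E c" using cont[OF ET E'] cF by auto
    moreover have "c \<in> vertices E'" "s \<in> vertices E'" using cF E'(2) by (auto simp: across_facet_def)
    ultimately have "E' \<in> S" using E' E by (simp add: S_def)
    moreover have "D *v (p' - p) = 0"
    proof -
      have "K *\<^sub>R (U E - U E') + G E s *v (p' - p) = K *\<^sub>R (U E - U E') + G E c *v (p' - p)"
        using eq[OF ET E' cF(1)] eq[OF ET E' cF(2)] by simp
      then have "(G E s - G E c) *v (p' - p) = 0" by (simp add: matrix_vector_mult_diff_rdistrib)
      then show ?thesis using E by (simp add: S_def)
    qed
    ultimately show ?thesis using E' by blast
  qed
  have E0S: "E0 \<in> S" using E0 by (simp add: S_def D_def)
  have Vcard: "card (vertices E) = CARD('n) + 1" "finite (vertices E)" if "E \<in> T" for E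
    using element_vertices[OF that] finite_vertices[OF that] by (auto simp: full_simplex_def)
  have others: "card (vertices E - {c, s}) = CARD('n) - 1" if "E \<in> S" for E
    using that Vcard[of E] cs by (auto simp: S_def card_Diff_subset)
  have "card (vertices E0 - {c, s}) \<noteq> 0" using others[OF E0S] card by simp linarith
  then have "vertices E0 - {c, s} \<noteq> {}" by (metis card.empty)
  then obtain q0 where q0: "q0 \<in> vertices E0 - {c, s}" by blast
  \<comment> \<open>Candidates for the extremal vertex, together with a tetrahedron that contains them.\<close>
  define Q where "Q = {(E, p). E \<in> S \<and> p \<in> vertices E - {c, s}}"
  have finQ: "finite Q"
  proof -
    have "Q \<subseteq> (SIGMA E:T. vertices E)" by (auto simp: Q_def S_def)
    moreover have "finite (SIGMA E:T. vertices E)" using finite_mesh Vcard by blast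
    ultimately show ?thesis using finite_subset by blast
  qed
  have "Q \<noteq> {}" using q0 E0S by (auto simp: Q_def)
  then have "Max ((\<lambda>y. snd y $ k) ` Q) \<in> (\<lambda>y. snd y $ k) ` Q" using finQ by (intro Max_in) auto
  then obtain y where y: "y \<in> Q" "snd y $ k = Max ((\<lambda>y. snd y $ k) ` Q)" by force
  obtain E p where "y = (E, p)" by (cases y)
  have Ep: "(E, p) \<in> Q" "\<And>E' p'. (E', p') \<in> Q \<Longrightarrow> p' $ k \<le> p $ k"
  proof -
    show "(E, p) \<in> Q" using y \<open>y = (E, p)\<close> by simp
    fix E' p' assume "(E', p') \<in> Q"
    then have "snd (E', p') $ k \<le> Max ((\<lambda>y. snd y $ k) ` Q)" using finQ by (intro Max_ge) blast+
    then show "p' $ k \<le> p $ k" using y(2) \<open>y = (E, p)\<close> by simp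
  qed
  have E: "E \<in> S" "E \<in> T" and p: "p \<in> vertices E - {c, s}" using Ep by (auto simp: Q_def S_def)
  let ?V = "vertices E"
  have V: "full_simplex ?V" using element_vertices E by blast
  obtain E1 p1 where E1: "E1 \<in> S" "across_facet E p E1 p1" "D *v (p1 - p) = 0" using step[OF E(1) p] by blast
  have b1: "bary ?V p p1 < 0" using E1 by (simp add: across_facet_def)
  have bpp: "bary ?V p p = 1" using bary_vertex[OF V] p by auto
  have "p1 \<noteq> p" using b1 bpp by auto
  then have not2: "CARD('n) \<noteq> 2" using w(3)[OF _ E1(3)] by auto
  then have c3: "CARD('n) = 3" using card by auto
  have "card (?V - {c, s} - {p}) = 1" using others[OF E(1)] p c3 Vcard(2)[OF E(2)] by (simp add: card_Diff_subset)
  then obtain a where a: "?V - {c, s} - {p} = {a}" by (auto simp: card_1_singleton_iff)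
  have Vset: "?V = {c, s, a, p}" and dist: "a \<noteq> c" "a \<noteq> s" "a \<noteq> p" using a p E(1) by (auto simp: S_def)
  obtain E2 a2 where E2: "E2 \<in> S" "across_facet E a E2 a2" "D *v (a2 - a) = 0" using step[OF E(1), of a] a by blast
  have b2: "bary ?V a a2 < 0" using E2 by (simp add: across_facet_def)
  have V2: "vertices E2 = {c, s, p, a2}" "a2 \<notin> {c, s, p}"
    using E2(2) dist p unfolding across_facet_def Vset by auto
  have E2T: "E2 \<in> T" using E2 by (simp add: S_def)
  have p2: "p \<in> vertices E2 - {c, s}" using V2 p by auto
  obtain E3 p3 where E3: "E3 \<in> S" "across_facet E2 p E3 p3" "D *v (p3 - p) = 0" using step[OF E2(1) p2] by blast
  have b3: "bary (vertices E2) p p3 < 0" using E3 by (simp add: across_facet_def)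
  define \<mu> where "\<mu> = (p - p1) $ k"
  define \<mu>' where "\<mu>' = (p3 - p) $ k"
  define \<nu> where "\<nu> = (a2 - a) $ k"
  have "p1 - p = ((p1 - p) $ k) *\<^sub>R w" using w(2)[OF E1(3)] .
  then have \<mu>: "p - p1 = \<mu> *\<^sub>R w" by (metis \<mu>_def minus_diff_eq scaleR_minus_left vector_minus_component vector_uminus_component)
  have \<mu>': "p3 - p = \<mu>' *\<^sub>R w" unfolding \<mu>'_def by (rule w(2)[OF E3(3)])
  have \<nu>: "a2 - a = \<nu> *\<^sub>R w" unfolding \<nu>_def by (rule w(2)[OF E2(3)])
  define gp where "gp = bary_grad ?V p \<bullet> w"
  define ga where "ga = bary_grad ?V a \<bullet> w"
  have bva: "bary ?V a a = 1" "bary ?V a c = 0" "bary ?V a s = 0" "bary ?V a p = 0"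
    and bvp: "bary ?V p a = 0" "bary ?V p c = 0" "bary ?V p s = 0"
    using bary_vertex[OF V] p dist Vset E(1) cs by (auto simp: S_def)
  have "\<mu> * gp = bary ?V p p - bary ?V p p1" unfolding bary_diff \<mu> by (simp add: gp_def)
  then have pos1: "\<mu> * gp > 0" using b1 bpp by simp
  have ba2: "bary ?V a a2 = 1 + \<nu> * ga" using bary_diff[of ?V a a2 a] bva by (simp add: \<nu> ga_def)
  have bp2: "bary ?V p a2 = \<nu> * gp" using bary_diff[of ?V p a2 a] bvp by (simp add: \<nu> gp_def)
  \<comment> \<open>The area form with first argument \<open>a2\<close>; it vanishes at \<open>c\<close>, \<open>s\<close> and \<open>a2\<close>, so that on \<open>E2\<close> it is a multiple of the coordinate of \<open>p\<close>.\<close>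
  define W where "W x = bary ?V a a2 * bary ?V p x - bary ?V a x * bary ?V p a2" for x
  have W0: "W c = 0" "W s = 0" "W a2 = 0" "W p = bary ?V a a2" using bva bvp bpp by (auto simp: W_def)
  have "W p3 = bary (vertices E2) p p3 * W p"
  proof -
    let ?b = "\<lambda>v. bary (vertices E2) v p3"
    have F2: "full_simplex (vertices E2)" "finite (vertices E2)" using element_vertices E2T finite_vertices by auto
    note rep = bary_repr[OF F2(1), of p3]
    have "bary ?V v p3 = (\<Sum>q\<in>vertices E2. ?b q * bary ?V v q)" for v
      using bary_combination[OF rep(1), of ?V v "\<lambda>q. q"] rep(2) by simp
    then have "W p3 = (\<Sum>q\<in>vertices E2. ?b q * W q)"
      unfolding W_def by (simp add: sum_distrib_left sum_distrib_right sum_subtractf algebra_simps)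
    also have "\<dots> = (\<Sum>q\<in>vertices E2. if q = p then ?b p * W p else 0)"
      using W0 V2 by (intro sum.cong) auto
    also have "\<dots> = ?b p * W p" using F2 p2 by simp
    finally show ?thesis .
  qed
  then have "W p3 > 0" using b2 b3 W0 by (simp add: mult_neg_neg)
  then have "W p3 - W p > 0" using W0 b2 by simp
  moreover have "W p3 - W p = bary ?V a a2 * (bary ?V p p3 - bary ?V p p) - (bary ?V a p3 - bary ?V a p) * bary ?V p a2"
    by (simp add: W_def algebra_simps)
  moreover have "\<dots> = \<mu>' * gp"
    unfolding bary_diff \<mu>' ba2 bp2 by (simp flip: gp_def ga_def add: algebra_simps)
  ultimately have pos2: "\<mu>' * gp > 0" by simp
  have inS: "c \<in> vertices E" "s \<in> vertices E" "c \<in> vertices E2" "s \<in> vertices E2" using E(1) E2(1) by (auto simp: S_def)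
  have "p1 \<in> vertices E1 - {c,s}"
    using E1(2) inS p unfolding across_facet_def by blast
  moreover have "p3 \<in> vertices E3 - {c,s}"
    using E3(2) inS p2 unfolding across_facet_def by blast
  ultimately have "(E1, p1) \<in> Q" "(E3, p3) \<in> Q" using E1 E3 by (auto simp: Q_def)
  then have "p1 $ k \<le> p $ k" "p3 $ k \<le> p $ k" using Ep by blast+
  then have "\<mu> \<ge> 0" "\<mu>' \<le> 0" by (auto simp: \<mu>_def \<mu>'_def)
  then show False using pos1 pos2 by (metis mult_nonneg_nonneg mult_nonpos_nonneg mult_nonneg_nonpos not_less linorder_linear)
qed

text \<open>The kernel equations in terms of the vertex values \<open>G\<close> of the rotation and the element values \<open>U\<close> of
the displacement. Once \<open>G\<close> is a constant \<open>G0\<close>, the equations on the Dirichlet facet say that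
\<open>G0\<close> annihilates all differences of vertices of that facet, whereas the kernel of a nonzero skew
matrix has dimension at most \<open>d - 2\<close>.\<close>

lemma kernel_trivial:
  fixes G :: "(real^'n) set \<Rightarrow> real^'n \<Rightarrow> real^'n^'n" and U :: "(real^'n) set \<Rightarrow> real^'n"
  assumes card: "CARD('n) \<in> {2, 3}" and K: "K \<noteq> 0"
    and skew: "\<And>E r. E \<in> T \<Longrightarrow> r \<in> vertices E \<Longrightarrow> skew_mat (G E r)"
    and cont: "\<And>E p E' p' r. E \<in> T \<Longrightarrow> E' \<in> T \<Longrightarrow> across_facet E p E' p' \<Longrightarrow> r \<in> vertices E - {p} \<Longrightarrow> G E' r = G E r"
    and eq: "\<And>E p E' p' r. E \<in> T \<Longrightarrow> E' \<in> T \<Longrightarrow> across_facet E p E' p' \<Longrightarrow> r \<in> vertices E - {p} \<Longrightarrow>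
        K *\<^sub>R (U E - U E') + G E r *v (p' - p) = 0"
    and star: "\<And>E. E \<in> T \<Longrightarrow> \<exists>c\<in>\<Omega>. c \<in> vertices E"
    and E0: "E0 \<in> T" "p0 \<in> vertices E0" "\<And>r. r \<in> vertices E0 - {p0} \<Longrightarrow> K *\<^sub>R U E0 + G E0 r *v (r - p0) = 0"
    and E: "E \<in> T" and r: "r \<in> vertices E"
  shows "G E r = 0" "U E = 0"
proof -
  have loc: "G E r = G E s" if "E \<in> T" "r \<in> vertices E" "s \<in> vertices E" for E r s
  proof -
    have "\<exists>c\<in>\<Omega>. c \<in> vertices E" by (rule star[OF that(1)])
    then obtain c where c: "c \<in> \<Omega>" "c \<in> vertices E" by blast
    note * = kernel_rotation_local[where G = G and K = K and U = U, OF card skew cont eq c(1) that(1) c(2)]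
    have "G E r = G E c" by (rule *) (use that in auto)
    moreover have "G E s = G E c" by (rule *) (use that in auto)
    ultimately show ?thesis by simp
  qed
  define f where "f E = G E (SOME r. r \<in> vertices E)" for E
  have Vn: "vertices E \<noteq> {}" "finite (vertices E)" "card (vertices E) = CARD('n) + 1" if "E \<in> T" for E
    using element_vertices[OF that] finite_vertices[OF that] by (auto simp: full_simplex_def)
  have f: "G E r = f E" if "E \<in> T" "r \<in> vertices E" for E r
    unfolding f_def using loc[OF that] someI[of "\<lambda>r. r \<in> vertices E", OF that(2)] by blast
  have fc: "f E = f E'" if E: "E \<in> T" "E' \<in> T" for E E'
  proof (rule constant_across_facets[OF _ E])
    fix E p E' p' assume *: "E \<in> T" "E' \<in> T" "across_facet E p E' p'"
    have "p \<in> vertices E" using *(3) by (simp add: across_facet_def)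
    then obtain r where r: "r \<in> vertices E - {p}" using facet_vertices(3)[OF *(1)] by blast
    then have "r \<in> vertices E'" using * by (auto simp: across_facet_def)
    then show "f E = f E'" using cont[OF * r] f[of E r] f[of E' r] * r by auto
  qed
  define G0 where "G0 = f E0"
  have G: "G E r = G0" if "E \<in> T" "r \<in> vertices E" for E r using f[OF that] fc[OF that(1) E0(1)] by (simp add: G0_def)
  have sk: "skew_mat G0" using skew[OF E r] G[OF E r] by simp
  have G00: "G0 = 0"
  proof (rule ccontr)
    assume "G0 \<noteq> 0"
    then obtain k w where w: "w $ k = 1" "\<And>x. G0 *v x = 0 \<Longrightarrow> x = (x $ k) *\<^sub>R w"
      "\<And>x. CARD('n) = 2 \<Longrightarrow> G0 *v x = 0 \<Longrightarrow> x = 0"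
      using skew_kernel[OF card sk] by blast
    let ?V = "vertices E0" and ?F = "vertices E0 - {p0}"
    have V: "full_simplex ?V" using element_vertices E0 by blast
    have cF: "card ?F = CARD('n)" "finite ?F" using facet_vertices[OF E0(1,2)] by auto
    have tang: "G0 *v (r - s) = 0" if "r \<in> ?F" "s \<in> ?F" for r s
    proof -
      have "G0 *v (r - p0) = G0 *v (s - p0)" using E0(3)[OF that(1)] E0(3)[OF that(2)] G[OF E0(1)] that
        by (metis DiffD1 add_left_cancel)
      then show ?thesis by (simp add: matrix_vector_mult_diff_distrib)
    qed
    obtain r1 where r1: "r1 \<in> ?F" using facet_vertices(3)[OF E0(1,2)] by blast
    have "card (?F - {r1}) = CARD('n) - 1" using cF r1 by (simp only: card_Diff_singleton)
    then have "card (?F - {r1}) \<noteq> 0" using card by simp linarith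
    then have "?F - {r1} \<noteq> {}" by (metis card.empty)
    then obtain r2 where r2: "r2 \<in> ?F" "r2 \<noteq> r1" by blast
    show False
    proof (cases "CARD('n) = 2")
      case True
      then show False using w(3)[OF True tang[OF r2(1) r1]] r2 by simp
    next
      case False
      then have c3: "CARD('n) = 3" using card by auto
      have "card (?F - {r1, r2}) = card ?F - card {r1, r2}" using r1 r2 by (intro card_Diff_subset) auto
      then have "card (?F - {r1, r2}) = 1" using cF c3 r2 by simp
      then have "?F - {r1, r2} \<noteq> {}" by (metis card.empty zero_neq_one)
      then obtain r3 where r3: "r3 \<in> ?F" "r3 \<noteq> r1" "r3 \<noteq> r2" by blast
      define m2 where "m2 = (r2 - r1) $ k"
      define m3 where "m3 = (r3 - r1) $ k"
      have m2: "r2 - r1 = m2 *\<^sub>R w" and m3: "r3 - r1 = m3 *\<^sub>R w"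
        using w(2)[OF tang[OF r2(1) r1]] w(2)[OF tang[OF r3(1) r1]] unfolding m2_def m3_def by blast+
      have "bary_grad ?V r2 \<bullet> (r2 - r1) = 1" "bary_grad ?V r2 \<bullet> (r3 - r1) = 0"
        using bary_vertex[OF V, of r2] r1 r2 r3 unfolding bary_diff[symmetric] by auto
      then have "m3 = 0" unfolding m2 m3 by auto
      then show False using m3 r3 by simp
    qed
  qed
  then show "G E r = 0" using G E r by blast
  have "K *\<^sub>R U E0 = 0"
  proof -
    obtain r where r: "r \<in> vertices E0 - {p0}" using facet_vertices(3)[OF E0(1,2)] by blast
    then show ?thesis using E0(3)[OF r] G[OF E0(1), of r] G00 by simp
  qed
  then have "U E0 = 0" using K by simp
  moreover have "U E = U E0"
  proof (rule constant_across_facets[OF _ E E0(1)])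
    fix E p E' p' assume *: "E \<in> T" "E' \<in> T" "across_facet E p E' p'"
    have "p \<in> vertices E" using *(3) by (simp add: across_facet_def)
    then obtain r where r: "r \<in> vertices E - {p}" using facet_vertices(3)[OF *(1)] by blast
    then have "K *\<^sub>R (U E - U E') = 0" using eq[OF * r] G[OF *(1), of r] G00 by simp
    then show "U E = U E'" using K by simp
  qed
  ultimately show "U E = 0" by simp
qed

end

section \<open>The boundary pairing\<close>

context cartesian_mesh
begin

lemma facet_polytope:
  assumes E: "E \<in> T" and F: "F facet_of E"
  shows "polytope F" "aff_dim F = int DIM(real^'n) - 1" "F \<subseteq> E" "F \<noteq> {}"
    "\<exists>n. norm n = 1 \<and> (\<forall>x\<in>F. \<forall>y\<in>F. n \<bullet> (x - y) = 0)"
proof -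
  let ?V = "vertices E"
  have V: "full_simplex ?V" "convex hull ?V = E" "finite ?V" using element_vertices E finite_vertices by auto
  have "F facet_of convex hull ?V" using F V by simp
  then obtain p where p: "p \<in> ?V" "F = convex hull (?V - {p})" "F \<noteq> {}"
    using facet_of_convex_hull_affine_independent V(1) unfolding full_simplex_def by blast
  show "polytope F" unfolding polytope_def using p V by blast
  show "F \<noteq> {}" "F \<subseteq> E" using p F facet_of_imp_subset by auto
  have "aff_dim E = int DIM(real^'n)"
    using aff_dim_nonempty_interior interior_element_nonempty[OF E] by blast
  then show "aff_dim F = int DIM(real^'n) - 1" using F by (simp add: facet_of_def)
  let ?g = "bary_grad ?V p"
  obtain q where q: "q \<in> ?V - {p}" using p by (metis all_not_in_conv convex_hull_empty)
  have "?g \<bullet> (p - q) = 1" using bary_vertex[OF V(1) p(1)] p q unfolding bary_diff[symmetric] by auto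
  then have g0: "?g \<noteq> 0" by auto
  have "?g \<bullet> (x - y) = 0" if "x \<in> F" "y \<in> F" for x y
  proof -
    have "bary ?V p x = 0" "bary ?V p y = 0" using that mem_face[OF E, of "?V - {p}"] p by auto
    then show ?thesis by (simp flip: bary_diff)
  qed
  then show "\<exists>n. norm n = 1 \<and> (\<forall>x\<in>F. \<forall>y\<in>F. n \<bullet> (x - y) = 0)"
    using g0 by (intro exI[of _ "(1 / norm ?g) *\<^sub>R ?g"]) auto
qed

text \<open>The prism over the facet is compact, hence of finite measure, and since its direction is normal to
the facet, the closest point projection maps it onto the facet.\<close>

lemma surface_measure_facet:
  assumes E: "E \<in> T" and F: "F facet_of E"
  shows "finite_measure (surface_measure F)" "AE x in surface_measure F. x \<in> F"
    "f \<in> borel_measurable borel \<Longrightarrow> f \<in> borel_measurable (surface_measure F)"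
proof -
  note fp = facet_polytope[OF E F]
  define n where "n = (SOME n. norm n = 1 \<and> (\<forall>x\<in>F. \<forall>y\<in>F. n \<bullet> (x - y) = 0))"
  have n: "norm n = 1 \<and> (\<forall>x\<in>F. \<forall>y\<in>F. n \<bullet> (x - y) = 0)"
    unfolding n_def by (rule someI_ex[OF fp(5)])
  define prism where "prism = {x + t *\<^sub>R n |x t. x \<in> F \<and> 0 \<le> t \<and> t \<le> 1}"
  define cp where "cp = closest_point (affine hull F)"
  define R where "R = restrict_space lborel prism"
  have sm: "surface_measure F = completion (distr R borel cp)"
    by (simp add: surface_measure_def Let_def n_def prism_def cp_def R_def)
  have cF: "compact F" using fp(1) polytope_imp_compact by blast
  have "prism = (\<lambda>(x, t). x + t *\<^sub>R n) ` (F \<times> {0..1})" by (auto simp: prism_def) blast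
  moreover have "compact ((\<lambda>(x, t). x + t *\<^sub>R n) ` (F \<times> {0..1}))"
    by (intro compact_continuous_image compact_Times cF compact_Icc)
      (auto simp: case_prod_beta intro!: continuous_intros)
  ultimately have cpr: "compact prism" by simp
  then have prb: "prism \<in> sets lborel" using borel_compact by simp
  have "continuous_on UNIV cp" unfolding cp_def
    by (intro continuous_on_closest_point) (use fp(4) in auto)
  then have "cp \<in> borel_measurable borel" by (rule borel_measurable_continuous_onI)
  then have "cp \<in> borel_measurable lborel" by simp
  then have cpm: "cp \<in> measurable R borel" unfolding R_def by (rule measurable_restrict_space1)
  have finR: "finite_measure R"
  proof
    have "emeasure R (space R) = emeasure lborel prism"
      unfolding R_def using prb by (simp add: space_restrict_space emeasure_restrict_space)
    also have "\<dots> < \<infinity>" using cpr compact_imp_bounded emeasure_bounded_finite by blast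
    finally show "emeasure R (space R) \<noteq> \<infinity>" by simp
  qed
  then have finD: "finite_measure (distr R borel cp)" using cpm by (rule finite_measure.finite_measure_distr)
  then show "finite_measure (surface_measure F)" unfolding sm
  proof -
    interpret finite_measure "distr R borel cp" by (rule finD)
    have "emeasure (completion (distr R borel cp)) (space (distr R borel cp)) = emeasure (distr R borel cp) (space (distr R borel cp))"
      by simp
    then show "finite_measure (completion (distr R borel cp))"
      using emeasure_finite[of "space (distr R borel cp)"] by (intro finite_measureI) simp
  qed
  have proj: "cp x \<in> F" if xp: "x \<in> prism" for x
  proof -
    obtain y t where y: "y \<in> F" "x = y + t *\<^sub>R n" using xp unfolding prism_def by blast
    have sub: "affine hull F \<subseteq> {z. n \<bullet> z = n \<bullet> y}"
    proof (rule hull_minimal)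
      show "F \<subseteq> {z. n \<bullet> z = n \<bullet> y}" proof
        fix z assume "z \<in> F"
        then have "n \<bullet> (z - y) = 0" using n y(1) by blast
        then show "z \<in> {z. n \<bullet> z = n \<bullet> y}" by (simp add: inner_diff_right)
      qed
      show "affine {z. n \<bullet> z = n \<bullet> y}" by (rule affine_hyperplane)
    qed
    have "y = cp x" unfolding cp_def
    proof (rule closest_point_unique)
      show "y \<in> affine hull F" using y hull_inc by fast
      show "\<forall>z\<in>affine hull F. dist x y \<le> dist x z"
      proof
        fix z assume "z \<in> affine hull F"
        then have "n \<bullet> (y - z) = 0" using sub by (auto simp: inner_diff_right)
        then have "(norm (t *\<^sub>R n + (y - z)))\<^sup>2 = (norm (t *\<^sub>R n))\<^sup>2 + (norm (y - z))\<^sup>2"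
          by (intro norm_add_Pythagorean) (simp add: orthogonal_def)
        then have "(norm (t *\<^sub>R n))\<^sup>2 \<le> (norm (t *\<^sub>R n + (y - z)))\<^sup>2" by simp
        then have "norm (t *\<^sub>R n) \<le> norm (t *\<^sub>R n + (y - z))" by (rule power2_le_imp_le) simp
        then show "dist x y \<le> dist x z" by (simp add: dist_norm y(2) algebra_simps)
      qed
    qed auto
    then show ?thesis using y by simp
  qed
  have "AE x in distr R borel cp. x \<in> F"
  proof (subst AE_distr_iff[OF cpm])
    show "{x \<in> space borel. x \<in> F} \<in> sets borel" using borel_compact[OF cF] by simp
    show "AE x in R. cp x \<in> F" using proj by (intro AE_I2) (simp add: R_def space_restrict_space)
  qed
  then show "AE x in surface_measure F. x \<in> F" unfolding sm by (rule AE_completion)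
  show "f \<in> borel_measurable borel \<Longrightarrow> f \<in> borel_measurable (surface_measure F)" for f
    unfolding sm by (rule measurable_completion) simp
qed

text \<open>Off the element the one-sided value is a limit along the trivial filter, an unspecified
constant; this makes the one-sided value a Borel function on the whole space.\<close>

lemma value_from_outside:
  assumes E: "E \<in> T" and x: "x \<notin> E"
  shows "value_from E w x = Lim bot w"
proof -
  have "x \<notin> closure (interior E)" using closure_interior_element[OF E] x by simp
  then have "\<not> x islimpt interior E" by (simp add: closure_def)
  then have "at x within interior E = bot" using trivial_limit_within by blast
  then show ?thesis by (simp add: value_from_def)
qed

lemma value_from_bounded_measurable:
  fixes w :: "real^'n \<Rightarrow> 'b::euclidean_space"
  assumes E: "E \<in> T" and w: "P1_on E w"
  shows "value_from E w \<in> borel_measurable borel" "\<exists>B. \<forall>x. norm (value_from E w x) \<le> B"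
proof -
  obtain L b where L: "linear L" "\<And>x. x \<in> E \<Longrightarrow> value_from E w x = L x + b" using P1_value_from[OF E w] by blast
  have cL: "continuous_on UNIV (\<lambda>x. L x + b)"
    using L(1) by (intro continuous_intros linear_continuous_on) (simp add: linear_conv_bounded_linear)
  define k where "k = Lim bot w"
  have eq: "value_from E w = (\<lambda>x. if x \<in> E then L x + b else k)"
    using L(2) value_from_outside[OF E, of _ w] by (simp add: k_def fun_eq_iff)
  have "E \<in> sets borel" using compact_element[OF E] borel_compact by blast
  then show "value_from E w \<in> borel_measurable borel" unfolding eq
    by (intro measurable_If_set borel_measurable_continuous_onI cL borel_measurable_const) auto
  have "bounded ((\<lambda>x. L x + b) ` E)"
    using compact_continuous_image[OF continuous_on_subset[OF cL] compact_element[OF E]] compact_imp_bounded by blast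
  then obtain B where B: "\<And>x. x \<in> E \<Longrightarrow> norm (L x + b) \<le> B" unfolding bounded_iff by blast
  show "\<exists>B. \<forall>x. norm (value_from E w x) \<le> B"
  proof (intro exI allI)
    fix x show "norm (value_from E w x) \<le> max B (norm k)" using B[of x] by (auto simp: eq le_max_iff_disj)
  qed
qed

lemma boundary_integrand_integrable:
  fixes \<tau> :: "real^'n \<Rightarrow> real^'n^'n" and N :: "real^'n"
  assumes E: "E \<in> T" and F: "F \<in> boundary_facets \<Omega> E" and g: "g \<in> L2_boundary \<Omega> \<Gamma>" and \<tau>: "P1_on E \<tau>"
  shows "set_integrable (surface_measure F) \<Gamma> (\<lambda>x. g x \<bullet> (value_from E \<tau> x *v N))"
proof -
  let ?M = "surface_measure F"
  have Ff: "F facet_of E" and Fs: "F \<subseteq> frontier \<Omega>" using F by (auto simp: boundary_facets_def)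
  note fp = facet_polytope[OF E Ff] and sm = surface_measure_facet[OF E Ff]
  have gm: "(\<lambda>x. indicator \<Gamma> x *\<^sub>R g x) \<in> borel_measurable ?M"
    and gi: "integrable ?M (\<lambda>x. indicator \<Gamma> x *\<^sub>R (norm (g x))\<^sup>2)"
    using g fp Fs unfolding L2_boundary_def set_borel_measurable_def set_integrable_def by blast+
  interpret finite_measure ?M by (rule sm(1))
  obtain B where B: "\<And>x. norm (value_from E \<tau> x) \<le> B" using value_from_bounded_measurable(2)[OF E \<tau>] by blast
  have bl: "bounded_linear (\<lambda>S :: real^'n^'n. S *v N)"
    unfolding linear_conv_bounded_linear[symmetric]
    by (intro linearI) (auto simp: matrix_vector_mult_add_rdistrib scaleR_matrix_vector_assoc)
  have vm: "(\<lambda>x. value_from E \<tau> x *v N) \<in> borel_measurable ?M"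
    using borel_measurable_continuous_on[OF linear_continuous_on[OF bl] value_from_bounded_measurable(1)[OF E \<tau>]]
    by (intro sm(3))
  obtain C where C: "\<And>S :: real^'n^'n. norm (S *v N) \<le> C * norm S" "C \<ge> 0"
    using bounded_linear.nonneg_bounded[OF bl] by (metis mult.commute)
  have ib: "integrable ?M (\<lambda>x. (C * B) * (1 + indicator \<Gamma> x *\<^sub>R (norm (g x))\<^sup>2))" using gi by simp
  show ?thesis unfolding set_integrable_def
  proof (rule Bochner_Integration.integrable_bound[OF ib])
    have "(\<lambda>x. indicator \<Gamma> x *\<^sub>R (g x \<bullet> (value_from E \<tau> x *v N))) = (\<lambda>x. (indicator \<Gamma> x *\<^sub>R g x) \<bullet> (value_from E \<tau> x *v N))"
      by simp
    then show "(\<lambda>x. indicator \<Gamma> x *\<^sub>R (g x \<bullet> (value_from E \<tau> x *v N))) \<in> borel_measurable ?M"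
      using borel_measurable_inner[OF gm vm] by simp
    show "AE x in ?M. norm (indicator \<Gamma> x *\<^sub>R (g x \<bullet> (value_from E \<tau> x *v N))) \<le> norm ((C * B) * (1 + indicator \<Gamma> x *\<^sub>R (norm (g x))\<^sup>2))"
    proof (intro AE_I2)
      fix x
      have "norm (value_from E \<tau> x *v N) \<le> C * B"
        using C(1)[of "value_from E \<tau> x"] mult_left_mono[OF B[of x] C(2)] by linarith
      moreover have "norm (g x) \<le> 1 + (norm (g x))\<^sup>2"
        using zero_le_power2[of "norm (g x) - 1"] norm_ge_zero[of "g x"]
        unfolding power2_diff power_one mult_1_right by linarith
      moreover have "\<bar>g x \<bullet> (value_from E \<tau> x *v N)\<bar> \<le> norm (g x) * norm (value_from E \<tau> x *v N)"
        by (rule Cauchy_Schwarz_ineq2)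
      ultimately have "\<bar>g x \<bullet> (value_from E \<tau> x *v N)\<bar> \<le> (1 + (norm (g x))\<^sup>2) * (C * B)"
        by (meson mult_mono norm_ge_zero order_trans add_nonneg_nonneg zero_le_one zero_le_power2)
      then show "norm (indicator \<Gamma> x *\<^sub>R (g x \<bullet> (value_from E \<tau> x *v N))) \<le> norm ((C * B) * (1 + indicator \<Gamma> x *\<^sub>R (norm (g x))\<^sup>2))"
        by (cases "x \<in> \<Gamma>") (simp_all add: mult.commute order_trans[OF _ abs_ge_self])
    qed
  qed
qed

text \<open>The Bochner integral is additive only on integrable functions, and one-sided values are linear in the
field only on the element; the second point is harmless since the surface measure is concentrated
on the facet.\<close>

lemma boundary_pairing_comb:
  fixes \<tau> \<sigma> :: "real^'n \<Rightarrow> real^'n^'n"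
  assumes g: "g \<in> L2_boundary \<Omega> \<Gamma>" and \<tau>: "\<And>E. E \<in> T \<Longrightarrow> P1_on E \<tau>" and \<sigma>: "\<And>E. E \<in> T \<Longrightarrow> P1_on E \<sigma>"
  shows "boundary_pairing \<Omega> \<Gamma> T g (\<lambda>x. \<tau> x + c *\<^sub>R \<sigma> x) = boundary_pairing \<Omega> \<Gamma> T g \<tau> + c * boundary_pairing \<Omega> \<Gamma> T g \<sigma>"
proof -
  have one: "(LINT x:\<Gamma>|surface_measure F. g x \<bullet> (value_from E (\<lambda>x. \<tau> x + c *\<^sub>R \<sigma> x) x *v N))
    = (LINT x:\<Gamma>|surface_measure F. g x \<bullet> (value_from E \<tau> x *v N)) + c * (LINT x:\<Gamma>|surface_measure F. g x \<bullet> (value_from E \<sigma> x *v N))"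
    if E: "E \<in> T" and F: "F \<in> boundary_facets \<Omega> E" for E F and N :: "real^'n"
  proof -
    let ?M = "surface_measure F"
    let ?t = "\<lambda>x. indicator \<Gamma> x *\<^sub>R (g x \<bullet> (value_from E \<tau> x *v N))"
    let ?s = "\<lambda>x. indicator \<Gamma> x *\<^sub>R (g x \<bullet> (value_from E \<sigma> x *v N))"
    let ?ts = "\<lambda>x. indicator \<Gamma> x *\<^sub>R (g x \<bullet> (value_from E (\<lambda>x. \<tau> x + c *\<^sub>R \<sigma> x) x *v N))"
    have Ff: "F facet_of E" using F by (simp add: boundary_facets_def)
    note i = boundary_integrand_integrable[OF E F g, unfolded set_integrable_def]
    have it: "integrable ?M ?t" and is': "integrable ?M ?s" and its: "integrable ?M ?ts"
      using i[OF \<tau>[OF E]] i[OF \<sigma>[OF E]] i[OF P1_comb[OF \<tau>[OF E] \<sigma>[OF E]]] by auto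
    have "AE x in ?M. ?ts x = ?t x + c * ?s x"
      using surface_measure_facet(2)[OF E Ff]
    proof eventually_elim
      case (elim x)
      then have xE: "x \<in> E" using facet_polytope(3)[OF E Ff] by blast
      show ?case unfolding value_from_comb[OF E \<tau>[OF E] \<sigma>[OF E] xE]
        by (simp add: matrix_vector_mult_add_rdistrib inner_add_right algebra_simps flip: scaleR_matrix_vector_assoc)
    qed
    then have "(\<integral>x. ?ts x \<partial>?M) = (\<integral>x. ?t x + c * ?s x \<partial>?M)"
      using it is' its by (intro integral_cong_AE) auto
    also have "\<dots> = (\<integral>x. ?t x \<partial>?M) + c * (\<integral>x. ?s x \<partial>?M)" using it is' by simp
    finally show ?thesis by (simp add: set_lebesgue_integral_def)
  qed
  show ?thesis unfolding boundary_pairing_def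
    by (simp add: one sum.distrib sum_distrib_left cong: sum.cong)
qed

lemma boundary_pairing_zero:
  assumes z: "\<And>E x. E \<in> T \<Longrightarrow> x \<in> interior E \<Longrightarrow> \<tau> x = 0"
  shows "boundary_pairing \<Omega> \<Gamma> T g \<tau> = 0"
proof -
  have "(LINT x:\<Gamma>|surface_measure F. g x \<bullet> (value_from E \<tau> x *v N)) = 0"
    if E: "E \<in> T" and F: "F \<in> boundary_facets \<Omega> E" for E F N
  proof -
    have Ff: "F facet_of E" using F by (simp add: boundary_facets_def)
    have "AE x in surface_measure F. indicator \<Gamma> x *\<^sub>R (g x \<bullet> (value_from E \<tau> x *v N)) = 0"
      using surface_measure_facet(2)[OF E Ff]
    proof eventually_elim
      case (elim x)
      then have "x \<in> E" using facet_polytope(3)[OF E Ff] by blast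
      then have "value_from E \<tau> x = 0" using z[OF E] by (intro value_from_zero E)
      then show ?case by simp
    qed
    then show ?thesis unfolding set_lebesgue_integral_def by (rule integral_eq_zero_AE)
  qed
  then show ?thesis unfolding boundary_pairing_def by (intro sum.neutral ballI) blast
qed

end

section \<open>The mixed bilinear form\<close>

context elastic_mesh
begin

type_synonym 'm triple = "(real^'m \<Rightarrow> real^'m^'m) \<times> (real^'m \<Rightarrow> real^'m) \<times> (real^'m \<Rightarrow> real^'m^'m)"

definition mixed_space :: "(real^'n) set \<Rightarrow> 'n triple set" where
  "mixed_space \<Gamma>N = Xh \<Omega> \<Gamma>N T \<times> Vh \<Omega> T \<times> Wh1 \<Omega> T"

definition comb3 :: "'n triple \<Rightarrow> real \<Rightarrow> 'n triple \<Rightarrow> 'n triple" where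
  "comb3 = (\<lambda>(\<sigma>, u, \<gamma>) c (\<tau>, v, \<xi>). ((\<lambda>x. \<sigma> x + c *\<^sub>R \<tau> x), (\<lambda>x. u x + c *\<^sub>R v x), (\<lambda>x. \<gamma> x + c *\<^sub>R \<xi> x)))"

text \<open>The sum of the three left-hand sides. With the trial and test spaces coinciding, the form is
symmetric, which makes the compatibility condition for existence the same as uniqueness.\<close>

definition mixed_form :: "'n triple \<Rightarrow> 'n triple \<Rightarrow> real" where
  "mixed_form = (\<lambda>(\<sigma>, u, \<gamma>) (\<tau>, v, \<xi>).
     quad T (\<lambda>x. A x (\<sigma> x)) \<tau> + L2_inner \<Omega> u (weak_div \<Omega> \<tau>) + quad T \<gamma> \<tau>
     + L2_inner \<Omega> (weak_div \<Omega> \<sigma>) v + quad T \<sigma> \<xi>)"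

lemma XhD: "\<tau> \<in> Xh \<Omega> \<Gamma> T \<Longrightarrow> \<tau> \<in> stress_space \<Omega> \<Gamma>" "\<tau> \<in> Xh \<Omega> \<Gamma> T \<Longrightarrow> E \<in> T \<Longrightarrow> P1_on E \<tau>"
  by (auto simp: Xh_def)

lemma VhD: "v \<in> Vh \<Omega> T \<Longrightarrow> v \<in> L2 \<Omega>" "v \<in> Vh \<Omega> T \<Longrightarrow> E \<in> T \<Longrightarrow> P0_on E v"
  by (auto simp: Vh_def)

lemma WhD: "\<xi> \<in> Wh1 \<Omega> T \<Longrightarrow> E \<in> T \<Longrightarrow> P1_on E \<xi>" by (auto simp: Wh1_def)

lemma Xh_comb: "\<tau> \<in> Xh \<Omega> \<Gamma> T \<Longrightarrow> \<sigma> \<in> Xh \<Omega> \<Gamma> T \<Longrightarrow> (\<lambda>x. \<tau> x + c *\<^sub>R \<sigma> x) \<in> Xh \<Omega> \<Gamma> T"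
  by (auto simp: Xh_def intro: weak_div_comb(2) P1_comb)

lemma Vh_comb: "v \<in> Vh \<Omega> T \<Longrightarrow> w \<in> Vh \<Omega> T \<Longrightarrow> (\<lambda>x. v x + c *\<^sub>R w x) \<in> Vh \<Omega> T"
proof -
  assume v: "v \<in> Vh \<Omega> T" and w: "w \<in> Vh \<Omega> T"
  have "P0_on E (\<lambda>x. v x + c *\<^sub>R w x)" if E: "E \<in> T" for E
  proof -
    obtain a b where "\<And>x. x \<in> interior E \<Longrightarrow> v x = a" "\<And>x. x \<in> interior E \<Longrightarrow> w x = b"
      using VhD(2)[OF v E] VhD(2)[OF w E] unfolding P0_on_def by blast
    then show ?thesis unfolding P0_on_def by (intro exI[of _ "a + c *\<^sub>R b"]) simp
  qed
  then show ?thesis using v w L2_comb by (auto simp: Vh_def)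
qed

lemma Wh_comb: "v \<in> Wh1 \<Omega> T \<Longrightarrow> w \<in> Wh1 \<Omega> T \<Longrightarrow> (\<lambda>x. v x + c *\<^sub>R w x) \<in> Wh1 \<Omega> T"
proof -
  assume v: "v \<in> Wh1 \<Omega> T" and w: "w \<in> Wh1 \<Omega> T"
  have "skew_mat (S + c *\<^sub>R R)" if S: "skew_mat S" and R: "skew_mat R" for S R :: "real^'n^'n"
    unfolding skew_mat_entries
  proof (intro allI)
    fix a b
    have "S $ a $ b + c * R $ a $ b = - (S $ b $ a + c * R $ b $ a)"
      using skew_mat_entry[OF S, of a b] skew_mat_entry[OF R, of a b] by simp
    then show "(S + c *\<^sub>R R) $ a $ b = - ((S + c *\<^sub>R R) $ b $ a)" by simp
  qed
  then show ?thesis using v w unfolding Wh1_def by (auto intro!: continuous_intros intro: P1_comb)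
qed

lemma comb3_closed: "comb_closed comb3 (mixed_space \<Gamma>)"
  using Xh_comb Vh_comb Wh_comb by (auto simp: comb_closed_def comb3_def mixed_space_def)

lemma L2_inner_weak_div_comb:
  assumes "\<tau> \<in> Xh \<Omega> \<Gamma> T" "\<sigma> \<in> Xh \<Omega> \<Gamma> T" "v \<in> L2 \<Omega>"
  shows "L2_inner \<Omega> (weak_div \<Omega> (\<lambda>x. \<tau> x + c *\<^sub>R \<sigma> x)) v = L2_inner \<Omega> (weak_div \<Omega> \<tau>) v + c * L2_inner \<Omega> (weak_div \<Omega> \<sigma>) v"
proof -
  note s = XhD(1)[OF assms(1)] XhD(1)[OF assms(2)]
  note L = stress_space_weak_div(2)[OF s(1)] stress_space_weak_div(2)[OF s(2)]
  have "L2_inner \<Omega> (weak_div \<Omega> (\<lambda>x. \<tau> x + c *\<^sub>R \<sigma> x)) v = L2_inner \<Omega> (\<lambda>x. weak_div \<Omega> \<tau> x + c *\<^sub>R weak_div \<Omega> \<sigma> x) v"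
    by (rule L2_inner_cong_left[OF weak_div_comb(1)[OF s] stress_space_weak_div(2)[OF weak_div_comb(2)[OF s]] L2_comb[OF L] assms(3)])
  then show ?thesis using L2_inner_comb_left[OF L assms(3)] by simp
qed

lemma quad_comb_right_Xh:
  assumes "\<tau> \<in> Xh \<Omega> \<Gamma> T" "\<sigma> \<in> Xh \<Omega> \<Gamma> T"
  shows "quad T v (\<lambda>x. \<tau> x + c *\<^sub>R \<sigma> x) = quad T v \<tau> + c * quad T v \<sigma>"
  by (rule quad_comb_right) (use XhD assms in auto)

lemma mixed_form_symmetric:
  assumes "z \<in> mixed_space \<Gamma>" "w \<in> mixed_space \<Gamma>"
  shows "mixed_form z w = mixed_form w z"
proof -
  obtain \<sigma> u \<gamma> \<tau> v \<xi> where zw: "z = (\<sigma>, u, \<gamma>)" "w = (\<tau>, v, \<xi>)" by (cases z; cases w)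
  have X: "\<sigma> \<in> Xh \<Omega> \<Gamma> T" "\<tau> \<in> Xh \<Omega> \<Gamma> T" using assms by (auto simp: zw mixed_space_def)
  have "quad T (\<lambda>x. A x (\<sigma> x)) \<tau> = quad T (\<lambda>x. A x (\<tau> x)) \<sigma>"
    by (rule quad_tensor_symmetric) (use X XhD in auto)
  then show ?thesis by (simp add: zw mixed_form_def L2_inner_commute[of \<Omega> "weak_div \<Omega> _"] quad_commute[of \<gamma>] quad_commute[of \<xi>])
qed

lemma mixed_form_right_linear:
  assumes z: "z \<in> mixed_space \<Gamma>"
  shows "comb_linear comb3 (mixed_space \<Gamma>) (mixed_form z)"
  unfolding comb_linear_def
proof (intro ballI allI)
  fix w w' c assume w: "w \<in> mixed_space \<Gamma>" and w': "w' \<in> mixed_space \<Gamma>"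
  obtain \<sigma> u \<gamma> \<tau> v \<xi> \<tau>' v' \<xi>' where e: "z = (\<sigma>, u, \<gamma>)" "w = (\<tau>, v, \<xi>)" "w' = (\<tau>', v', \<xi>')"
    by (cases z; cases w; cases w')
  have X: "\<sigma> \<in> Xh \<Omega> \<Gamma> T" "\<tau> \<in> Xh \<Omega> \<Gamma> T" "\<tau>' \<in> Xh \<Omega> \<Gamma> T"
    and V: "u \<in> Vh \<Omega> T" "v \<in> Vh \<Omega> T" "v' \<in> Vh \<Omega> T" and W: "\<xi> \<in> Wh1 \<Omega> T" "\<xi>' \<in> Wh1 \<Omega> T"
    using z w w' by (auto simp: e mixed_space_def)
  have 1: "quad T r (\<lambda>x. \<tau> x + c *\<^sub>R \<tau>' x) = quad T r \<tau> + c * quad T r \<tau>'" for r :: "real^'n \<Rightarrow> real^'n^'n"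
    by (rule quad_comb_right_Xh[OF X(2,3)])
  have 2: "quad T \<sigma> (\<lambda>x. \<xi> x + c *\<^sub>R \<xi>' x) = quad T \<sigma> \<xi> + c * quad T \<sigma> \<xi>'"
    by (rule quad_comb_right) (use WhD W in auto)
  have 3: "L2_inner \<Omega> u (weak_div \<Omega> (\<lambda>x. \<tau> x + c *\<^sub>R \<tau>' x)) = L2_inner \<Omega> u (weak_div \<Omega> \<tau>) + c * L2_inner \<Omega> u (weak_div \<Omega> \<tau>')"
    using L2_inner_weak_div_comb[OF X(2,3) VhD(1)[OF V(1)]] by (simp only: L2_inner_commute[of \<Omega> u])
  have 4: "L2_inner \<Omega> (weak_div \<Omega> \<sigma>) (\<lambda>x. v x + c *\<^sub>R v' x) = L2_inner \<Omega> (weak_div \<Omega> \<sigma>) v + c * L2_inner \<Omega> (weak_div \<Omega> \<sigma>) v'"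
    by (rule L2_inner_comb_right[OF stress_space_weak_div(2)[OF XhD(1)[OF X(1)]] VhD(1)[OF V(2)] VhD(1)[OF V(3)]])
  show "mixed_form z (comb3 w c w') = mixed_form z w + c * mixed_form z w'"
    by (simp add: e mixed_form_def comb3_def 1 2 3 4 algebra_simps)
qed

lemma mixed_form_left_linear:
  assumes w: "w \<in> mixed_space \<Gamma>"
  shows "comb_linear comb3 (mixed_space \<Gamma>) (\<lambda>z. mixed_form z w)"
  unfolding comb_linear_def
proof (intro ballI allI)
  fix z z' c assume z: "z \<in> mixed_space \<Gamma>" "z' \<in> mixed_space \<Gamma>"
  have "comb3 z c z' \<in> mixed_space \<Gamma>" using comb3_closed z unfolding comb_closed_def by blast
  then show "mixed_form (comb3 z c z') w = mixed_form z w + c * mixed_form z' w"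
    using mixed_form_right_linear[OF w] z mixed_form_symmetric w unfolding comb_linear_def by metis
qed

text \<open>Vanishing inside all elements: for members of the discrete spaces this means being zero almost
everywhere.\<close>

definition discretely_zero :: "'n triple \<Rightarrow> bool" where
  "discretely_zero = (\<lambda>(\<sigma>, u, \<gamma>). \<forall>E\<in>T. \<forall>x\<in>interior E. \<sigma> x = 0 \<and> u x = 0 \<and> \<gamma> x = 0)"

lemma AE_zero_of_interior:
  assumes "\<And>E x. E \<in> T \<Longrightarrow> x \<in> interior E \<Longrightarrow> w x = 0"
  shows "AE x in lebesgue_on \<Omega>. w x = 0"
  using AE_interior_element by eventually_elim (use assms in auto)

lemma zero_in_L2: "(\<lambda>x. 0) \<in> L2 \<Omega>" by (intro continuous_in_L2 op bd) simp

lemma L2_inner_zero_left: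
  assumes "w \<in> L2 \<Omega>" "v \<in> L2 \<Omega>" "AE x in lebesgue_on \<Omega>. w x = 0" shows "L2_inner \<Omega> w v = 0"
  using L2_inner_cong_left[OF assms(3,1) zero_in_L2 assms(2)] by (simp add: L2_inner_def)

lemma mixed_form_zero_left:
  assumes z: "z \<in> mixed_space \<Gamma>" and w: "w \<in> mixed_space \<Gamma>" and z0: "discretely_zero z"
  shows "mixed_form z w = 0"
proof -
  obtain \<sigma> u \<gamma> \<tau> v \<xi> where e: "z = (\<sigma>, u, \<gamma>)" "w = (\<tau>, v, \<xi>)" by (cases z; cases w)
  have X: "\<sigma> \<in> Xh \<Omega> \<Gamma> T" "\<tau> \<in> Xh \<Omega> \<Gamma> T" and V: "u \<in> Vh \<Omega> T" "v \<in> Vh \<Omega> T" using z w by (auto simp: e mixed_space_def)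
  have 0: "\<And>E x. E \<in> T \<Longrightarrow> x \<in> interior E \<Longrightarrow> \<sigma> x = 0" "\<And>E x. E \<in> T \<Longrightarrow> x \<in> interior E \<Longrightarrow> u x = 0"
    "\<And>E x. E \<in> T \<Longrightarrow> x \<in> interior E \<Longrightarrow> \<gamma> x = 0"
    using z0 by (auto simp: e discretely_zero_def)
  have "A x (\<sigma> x) = 0" if "E \<in> T" "x \<in> interior E" for E x
  proof -
    have "linear (A x)" using that interior_element_subset compliance unfolding compliance_tensor_def by blast
    then show ?thesis using 0(1)[OF that] linear_0 by metis
  qed
  then have "quad T (\<lambda>x. A x (\<sigma> x)) \<tau> = 0" by (rule quad_zero_left)
  moreover have "quad T \<gamma> \<tau> = 0" "quad T \<sigma> \<xi> = 0" by (rule quad_zero_left, rule 0, assumption+)+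
  moreover have "L2_inner \<Omega> u (weak_div \<Omega> \<tau>) = 0"
    using VhD(1)[OF V(1)] stress_space_weak_div(2)[OF XhD(1)[OF X(2)]] AE_zero_of_interior[OF 0(2)] by (rule L2_inner_zero_left)
  moreover have "L2_inner \<Omega> (weak_div \<Omega> \<sigma>) v = 0"
    using stress_space_weak_div(2)[OF XhD(1)[OF X(1)]] VhD(1)[OF V(2)] weak_div_AE_zero[OF XhD(1)[OF X(1)] AE_zero_of_interior[OF 0(1)]]
    by (rule L2_inner_zero_left)
  ultimately show ?thesis by (simp add: e mixed_form_def)
qed

lemma zero_in_Xh: "(\<lambda>x. 0) \<in> Xh \<Omega> \<Gamma> T" if "\<Gamma> \<subseteq> frontier \<Omega>" for \<Gamma>
proof -
  have "(\<lambda>x. 0) \<in> stress_space \<Omega> \<Gamma>"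
    by (rule in_stress_spaceI[where w = "\<lambda>x. 0"]) (auto simp: that zero_in_L2 L2_inner_def)
  moreover have "P1_on E (\<lambda>x. 0 :: real^'n^'n)" for E :: "(real^'n) set" by (rule P0_imp_P1) (auto simp: P0_on_def)
  ultimately show ?thesis by (simp add: Xh_def)
qed

lemma zero_in_Vh: "(\<lambda>x. 0) \<in> Vh \<Omega> T" using zero_in_L2 by (auto simp: Vh_def P0_on_def)

lemma zero_in_Wh: "(\<lambda>x. 0) \<in> Wh1 \<Omega> T"
proof -
  have "P1_on E (\<lambda>x. 0 :: real^'n^'n)" for E :: "(real^'n) set" by (rule P0_imp_P1) (auto simp: P0_on_def)
  then show ?thesis by (auto simp: Wh1_def skew_mat_entries)
qed

lemma Wh1_vertex_skew:
  assumes \<gamma>: "\<gamma> \<in> Wh1 \<Omega> T" and E: "E \<in> T" and x: "x \<in> E"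
  shows "skew_mat (value_from E \<gamma> x)"
  unfolding skew_mat_entries
proof (intro allI)
  fix a b
  obtain L k where L: "linear L" "\<And>x. x \<in> interior E \<Longrightarrow> \<gamma> x = L x + k" "\<And>x. x \<in> E \<Longrightarrow> value_from E \<gamma> x = L x + k"
    using P1_value_from[OF E WhD[OF \<gamma> E]] by blast
  have cL: "continuous_on UNIV (\<lambda>x. L x + k)"
    using L(1) by (intro continuous_intros linear_continuous_on) (simp add: linear_conv_bounded_linear)
  let ?f = "\<lambda>x. (L x + k) $ a $ b + (L x + k) $ b $ a"
  have cf: "continuous_on (closure (interior E)) ?f"
    by (intro continuous_intros continuous_on_subset[OF cL]) auto
  have "?f x = 0"
  proof (rule continuous_constant_on_closure[OF cf])
    fix y assume y: "y \<in> interior E"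
    then have "skew_mat (\<gamma> y)" using \<gamma> interior_element_subset[OF E] by (auto simp: Wh1_def)
    from skew_mat_entry[OF this, of a b] show "?f y = 0" using L(2)[OF y] by simp
  qed (use x closure_interior_element[OF E] in auto)
  then show "value_from E \<gamma> x $ a $ b = - (value_from E \<gamma> x $ b $ a)" using L(3)[OF x] by simp
qed

lemma Wh1_value_in_domain:
  assumes \<gamma>: "\<gamma> \<in> Wh1 \<Omega> T" and E: "E \<in> T" and x: "x \<in> E" "x \<in> \<Omega>"
  shows "value_from E \<gamma> x = \<gamma> x"
proof (rule value_from_eqI[OF E x(1)])
  have "continuous_on \<Omega> \<gamma>" using \<gamma> by (simp add: Wh1_def)
  then have "(\<gamma> \<longlongrightarrow> \<gamma> x) (at x within \<Omega>)" using x by (simp add: continuous_on_def)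
  then show "(\<gamma> \<longlongrightarrow> \<gamma> x) (at x within interior E)" using interior_element_subset[OF E] tendsto_within_subset by blast
qed

text \<open>A vertex \<open>r\<close> on the boundary may carry different one-sided values from different elements. Across an
interior facet they agree: the two affine extensions coincide at two points of the facet inside the domain on a
segment towards \<open>r\<close>.\<close>

lemma Wh1_continuous_across:
  assumes \<gamma>: "\<gamma> \<in> Wh1 \<Omega> T" and E: "E \<in> T" "E' \<in> T" and ac: "across_facet E p E' p'" and r: "r \<in> vertices E - {p}"
  shows "value_from E' \<gamma> r = value_from E \<gamma> r"
proof -
  let ?F = "convex hull (vertices E - {p})"
  obtain q where q: "q \<in> ?F" "q \<in> \<Omega>" using across_facet_interior[OF E ac] by blast
  have FE: "?F \<subseteq> E" "?F \<subseteq> E'"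
    using facet_subset_element[OF E(1), of p] facet_subset_element[OF E(2), of p'] ac by (auto simp: across_facet_def)
  obtain d where d: "d > 0" "d \<le> 1" "\<And>e. 0 \<le> e \<Longrightarrow> e \<le> d \<Longrightarrow> q + e *\<^sub>R (r - q) \<in> \<Omega>"
    using small_step_stays[OF open_domain q(2)] by blast
  define y where "y = q + d *\<^sub>R (r - q)"
  have rF: "r \<in> ?F" using r by (rule hull_inc)
  have y\<Omega>: "y \<in> \<Omega>" using d by (simp add: y_def)
  have "y = (1 - d) *\<^sub>R q + d *\<^sub>R r" by (simp add: y_def algebra_simps)
  then have yF: "y \<in> ?F" using convexD[OF convex_convex_hull q(1) rF, of "1 - d" d] d by simp
  have val: "value_from D \<gamma> r = \<gamma> q + (1 / d) *\<^sub>R (\<gamma> y - \<gamma> q)" if D: "D \<in> T" and sub: "?F \<subseteq> D" for D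
  proof -
    obtain L k where L: "linear L" "\<And>x. x \<in> D \<Longrightarrow> value_from D \<gamma> x = L x + k"
      using P1_value_from[OF D WhD[OF \<gamma> D]] by blast
    have "\<gamma> y = L y + k" "\<gamma> q = L q + k" "value_from D \<gamma> r = L r + k"
      using L(2) Wh1_value_in_domain[OF \<gamma> D] sub yF q y\<Omega> rF by auto
    moreover have "L y = L q + d *\<^sub>R (L r - L q)"
      unfolding y_def by (simp add: linear_add[OF L(1)] linear_scale[OF L(1)] linear_diff[OF L(1)])
    ultimately show ?thesis using d by simp
  qed
  show ?thesis using val[OF E(1) FE(1)] val[OF E(2) FE(2)] by simp
qed

text \<open>Tests with \<open>(\<sigma>, -u, -\<gamma>)\<close> and then with the facet fields for all vectors \<open>e\<close> reduce the claim
to \<open>kernel_trivial\<close>.\<close>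

lemma mixed_form_nondegenerate:
  assumes card: "CARD('n) \<in> {2, 3}" and \<Gamma>: "boundary_partition \<Omega> \<Gamma>D \<Gamma>N" "facets_resolve \<Omega> \<Gamma>D \<Gamma>N T"
    and star: "\<And>E. E \<in> T \<Longrightarrow> \<exists>c\<in>\<Omega>. c \<in> vertices E"
    and z: "z \<in> mixed_space \<Gamma>N" and orth: "\<And>w. w \<in> mixed_space \<Gamma>N \<Longrightarrow> mixed_form z w = 0"
  shows "discretely_zero z"
proof -
  obtain \<sigma> u \<gamma> where e: "z = (\<sigma>, u, \<gamma>)" by (cases z)
  have X: "\<sigma> \<in> Xh \<Omega> \<Gamma>N T" and V: "u \<in> Vh \<Omega> T" and W: "\<gamma> \<in> Wh1 \<Omega> T" using z by (auto simp: e mixed_space_def)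
  have \<Gamma>f: "\<Gamma>N \<subseteq> frontier \<Omega>" using \<Gamma>(1) by (auto simp: boundary_partition_def)
  have V': "(\<lambda>x. 0 + (-1) *\<^sub>R u x) \<in> Vh \<Omega> T" by (rule Vh_comb[OF zero_in_Vh V])
  have W': "(\<lambda>x. 0 + (-1) *\<^sub>R \<gamma> x) \<in> Wh1 \<Omega> T" by (rule Wh_comb[OF zero_in_Wh W])
  \<comment> \<open>The negatives are written as combinations with zero to match the closure properties of the spaces.\<close>
  have "mixed_form z (\<sigma>, \<lambda>x. 0 + (-1) *\<^sub>R u x, \<lambda>x. 0 + (-1) *\<^sub>R \<gamma> x) = 0"
    by (rule orth) (use X V' W' in \<open>simp add: mixed_space_def\<close>)
  moreover have "L2_inner \<Omega> (weak_div \<Omega> \<sigma>) (\<lambda>x. 0 + (-1) *\<^sub>R u x) = - L2_inner \<Omega> u (weak_div \<Omega> \<sigma>)"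
    by (simp add: L2_inner_def inner_commute)
  moreover have "quad T \<sigma> (\<lambda>x. 0 + (-1) *\<^sub>R \<gamma> x) = - quad T \<gamma> \<sigma>"
  proof -
    have "quad T \<sigma> (\<lambda>x. 0 + (-1) *\<^sub>R \<gamma> x) = quad T \<sigma> (\<lambda>x. 0) + (-1) * quad T \<sigma> \<gamma>"
      by (rule quad_comb_right) (use WhD zero_in_Wh W in auto)
    moreover have "quad T \<sigma> (\<lambda>x. 0) = 0" unfolding quad_commute[of \<sigma>] by (rule quad_zero_left) simp
    ultimately show ?thesis by (simp add: quad_commute)
  qed
  ultimately have "quad T (\<lambda>x. A x (\<sigma> x)) \<sigma> = 0" by (simp add: e mixed_form_def)
  then have \<sigma>0: "\<sigma> x = 0" if "E \<in> T" "x \<in> interior E" for E x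
    using quad_tensor_definite[of \<sigma> E x] XhD(2)[OF X] that by blast
  have A0: "quad T (\<lambda>x. A x (\<sigma> x)) \<tau> = 0" for \<tau>
  proof (rule quad_zero_left)
    fix E x assume *: "E \<in> T" "x \<in> interior E"
    have "linear (A x)" using * interior_element_subset compliance unfolding compliance_tensor_def by blast
    then show "A x (\<sigma> x) = 0" using \<sigma>0[OF *] linear_0 by metis
  qed
  have test: "L2_inner \<Omega> u (weak_div \<Omega> \<tau>) + quad T \<gamma> \<tau> = 0" if "\<tau> \<in> Xh \<Omega> \<Gamma>N T" for \<tau>
  proof -
    have "mixed_form z (\<tau>, \<lambda>x. 0, \<lambda>x. 0) = 0"
      by (rule orth) (use that zero_in_Vh zero_in_Wh in \<open>simp add: mixed_space_def\<close>)
    moreover have "quad T \<sigma> (\<lambda>x. 0) = 0" unfolding quad_commute[of \<sigma>] by (rule quad_zero_left) simp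
    ultimately show ?thesis by (simp add: e mixed_form_def A0 L2_inner_def)
  qed
  define K where "K = real CARD('n) + 1"
  have K: "K > 0" by (simp add: K_def)
  define G where "G E r = value_from E \<gamma> r" for E r
  define U where "U E = value_from E u (SOME r. r \<in> vertices E)" for E
  have Uval: "value_from E u x = U E" if E: "E \<in> T" and x: "x \<in> E" for E x
  proof -
    obtain p where "p \<in> vertices E" using star[OF E] by blast
    then have r: "(SOME r. r \<in> vertices E) \<in> E" using vertex_in_element[OF E] someI[of "\<lambda>r. r \<in> vertices E"] by blast
    obtain y where "y \<in> interior E" using interior_element_nonempty[OF E] by blast
    then show ?thesis unfolding U_def using P0_value[OF E VhD(2)[OF V E] x] P0_value[OF E VhD(2)[OF V E] r] by simp
  qed
  have udiv: "L2_inner \<Omega> u (edge_div E e) = U E \<bullet> e" if E: "E \<in> T" for E e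
  proof -
    obtain y where "y \<in> E" using interior_element_nonempty[OF E] interior_subset by blast
    then show ?thesis using L2_inner_edge_div[OF E VhD(2)[OF V E]] Uval[OF E] by simp
  qed
  have uL: "u \<in> L2 \<Omega>" using VhD V by blast
  obtain E0 p0 where E0: "E0 \<in> T" "p0 \<in> vertices E0" "convex hull (vertices E0 - {p0}) \<subseteq> closure \<Gamma>D"
    using dirichlet_facet_exists[OF \<Gamma>] by blast
  have triv: "G E r = 0 \<and> U E = 0" if Er: "E \<in> T" "r \<in> vertices E" for E r
  proof -
    have skew: "skew_mat (G E r)" if "E \<in> T" "r \<in> vertices E" for E r
      unfolding G_def using Wh1_vertex_skew[OF W that(1)] vertex_in_element that by blast
    have cont: "G E' r = G E r" if "E \<in> T" "E' \<in> T" "across_facet E p E' p'" "r \<in> vertices E - {p}" for E p E' p' r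
      unfolding G_def using Wh1_continuous_across[OF W] that by blast
    have eq: "K *\<^sub>R (U E - U E') + G E r *v (p' - p) = 0"
      if E: "E \<in> T" "E' \<in> T" and ac: "across_facet E p E' p'" and r: "r \<in> vertices E - {p}" for E p E' p' r
    proof -
      have r': "r \<in> vertices E'" using r ac by (auto simp: across_facet_def)
      have "e \<bullet> (K *\<^sub>R (U E - U E') + G E r *v (p' - p)) = 0" for e
      proof -
        let ?t = "facet_field E p E' p' r e"
        note ff = interior_facet_field[OF E ac r \<Gamma>f, of e]
        have "L2_inner \<Omega> (weak_div \<Omega> ?t) u = L2_inner \<Omega> (\<lambda>x. edge_div E e x + (-1) *\<^sub>R edge_div E' e x) u"
          by (rule L2_inner_cong_left[OF ff(2) _ _ uL])
            (use stress_space_weak_div(2)[OF XhD(1)[OF ff(1)]] L2_comb[OF edge_field_L2(2)[OF E(1)] edge_field_L2(2)[OF E(2)]] in blast)+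
        also have "\<dots> = U E \<bullet> e - U E' \<bullet> e"
          using L2_inner_comb_left[OF edge_field_L2(2)[OF E(1)] edge_field_L2(2)[OF E(2)] uL, of e "-1" e]
            udiv[OF E(1)] udiv[OF E(2)] by (simp add: L2_inner_commute[of \<Omega> "edge_div _ _"])
        finally have 1: "L2_inner \<Omega> u (weak_div \<Omega> ?t) = U E \<bullet> e - U E' \<bullet> e" by (simp add: L2_inner_commute[of \<Omega> u])
        have "quad T \<gamma> ?t = quad T \<gamma> (edge_field E p r e) + (-1) * quad T \<gamma> (edge_field E' p' r e)"
          unfolding facet_field_def by (rule quad_comb_right) (use edge_field_P1 E in auto)
        also have "\<dots> = (e \<bullet> (G E r *v (r - p))) / K - (e \<bullet> (G E r *v (r - p'))) / K"
          using quad_edge_field[OF E(1), of r \<gamma> p e] quad_edge_field[OF E(2) r', of \<gamma> p' e] r cont[OF E ac r]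
          by (simp add: G_def K_def)
        also have "\<dots> = (e \<bullet> (G E r *v (p' - p))) / K"
          by (simp add: matrix_vector_mult_diff_distrib inner_diff_right diff_divide_distrib)
        finally have "U E \<bullet> e - U E' \<bullet> e + (e \<bullet> (G E r *v (p' - p))) / K = 0" using test[OF ff(1)] 1 by simp
        then show ?thesis using K by (simp add: field_simps inner_add_right inner_diff_right inner_commute)
      qed
      from this[of "K *\<^sub>R (U E - U E') + G E r *v (p' - p)"] show ?thesis by simp
    qed
    have dir: "K *\<^sub>R U E0 + G E0 r *v (r - p0) = 0" if r: "r \<in> vertices E0 - {p0}" for r
    proof -
      have "e \<bullet> (K *\<^sub>R U E0 + G E0 r *v (r - p0)) = 0" for e
      proof -
        note df = dirichlet_facet_field[OF E0(1,2) r \<Gamma>(1) E0(3), of e]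
        have "L2_inner \<Omega> (weak_div \<Omega> (edge_field E0 p0 r e)) u = L2_inner \<Omega> (edge_div E0 e) u"
          by (rule L2_inner_cong_left[OF df(2) stress_space_weak_div(2)[OF XhD(1)[OF df(1)]] edge_field_L2(2)[OF E0(1)] uL])
        then have 1: "L2_inner \<Omega> u (weak_div \<Omega> (edge_field E0 p0 r e)) = U E0 \<bullet> e"
          using udiv[OF E0(1)] by (simp add: L2_inner_commute[of \<Omega> u])
        have "quad T \<gamma> (edge_field E0 p0 r e) = (e \<bullet> (G E0 r *v (r - p0))) / K"
          using quad_edge_field[OF E0(1), of r \<gamma> p0 e] r by (simp add: G_def K_def)
        then have "U E0 \<bullet> e + (e \<bullet> (G E0 r *v (r - p0))) / K = 0" using test[OF df(1)] 1 by simp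
        then show ?thesis using K by (simp add: field_simps inner_add_right inner_commute)
      qed
      from this[of "K *\<^sub>R U E0 + G E0 r *v (r - p0)"] show ?thesis by simp
    qed
    have "K \<noteq> 0" using K by simp
    have "G E r = 0"
      by (rule kernel_trivial(1)[where G = G and U = U and K = K and ?E0.0 = E0 and ?p0.0 = p0])
        (fact | rule skew cont eq star dir; assumption)+
    moreover have "U E = 0"
      by (rule kernel_trivial(2)[where G = G and U = U and K = K and ?E0.0 = E0 and ?p0.0 = p0 and r = r])
        (fact | rule skew cont eq star dir; assumption)+
    ultimately show ?thesis by blast
  qed
  have "u x = 0" "\<gamma> x = 0" if E: "E \<in> T" and x: "x \<in> interior E" for E x
  proof -
    obtain p where p: "p \<in> vertices E" using star[OF E] by blast
    have "u x = value_from E u x" using value_from_interior[OF E P0_imp_P1[OF VhD(2)[OF V E]] x] by simp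
    then show "u x = 0" using Uval[OF E] x interior_subset triv[OF E p] by auto
    show "\<gamma> x = 0" by (rule P1_constant_if_vertex_values[OF E WhD[OF W E] _ x]) (use triv[OF E] G_def in auto)
  qed
  then show ?thesis using \<sigma>0 by (auto simp: e discretely_zero_def)
qed

end

section \<open>Existence and uniqueness\<close>

context elastic_mesh
begin

lemma mixed_space_nonempty:
  assumes "\<Gamma> \<subseteq> frontier \<Omega>" shows "mixed_space \<Gamma> \<noteq> {}"
  using zero_in_Xh[OF assms] zero_in_Vh zero_in_Wh by (auto simp: mixed_space_def)

text \<open>Finitely many functionals that determine a triple up to null sets. They are not independent: the
value of \<open>u\<close> on an element is repeated at each of its vertices.\<close>

definition nodal_value :: "('n + 'n \<times> 'n + 'n \<times> 'n) \<times> (real^'n) set \<times> (real^'n) \<Rightarrow> 'n triple \<Rightarrow> real" where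
  "nodal_value = (\<lambda>(k, E, r) (\<sigma>, u, \<gamma>). case k of
     Inl i \<Rightarrow> value_from E u r $ i
   | Inr (Inl (i, j)) \<Rightarrow> value_from E \<sigma> r $ i $ j
   | Inr (Inr (i, j)) \<Rightarrow> value_from E \<gamma> r $ i $ j)"

lemma nodal_value_linear:
  assumes E: "E \<in> T" and r: "r \<in> vertices E"
  shows "comb_linear comb3 (mixed_space \<Gamma>) (nodal_value (k, E, r))"
  unfolding comb_linear_def
proof (intro ballI allI)
  fix z w c assume z: "z \<in> mixed_space \<Gamma>" and w: "w \<in> mixed_space \<Gamma>"
  obtain \<sigma> u \<gamma> \<tau> v \<xi> where e: "z = (\<sigma>, u, \<gamma>)" "w = (\<tau>, v, \<xi>)" by (cases z; cases w)
  note rE = vertex_in_element[OF E r]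
  have "P1_on E \<sigma>" "P1_on E \<tau>" "P1_on E u" "P1_on E v" "P1_on E \<gamma>" "P1_on E \<xi>"
    using z w E XhD(2) WhD P0_imp_P1[OF VhD(2)] by (auto simp: e mixed_space_def)
  then show "nodal_value (k, E, r) (comb3 z c w) = nodal_value (k, E, r) z + c * nodal_value (k, E, r) w"
    using value_from_comb[OF E _ _ rE, of \<sigma> \<tau> c] value_from_comb[OF E _ _ rE, of u v c] value_from_comb[OF E _ _ rE, of \<gamma> \<xi> c]
    by (auto simp: e nodal_value_def comb3_def split: sum.split)
qed

lemma nodal_values_zero:
  assumes z: "z \<in> mixed_space \<Gamma>"
    and 0: "\<And>k E r. E \<in> T \<Longrightarrow> r \<in> vertices E \<Longrightarrow> nodal_value (k, E, r) z = 0"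
  shows "discretely_zero z"
proof -
  obtain \<sigma> u \<gamma> where e: "z = (\<sigma>, u, \<gamma>)" by (cases z)
  have "\<sigma> x = 0 \<and> u x = 0 \<and> \<gamma> x = 0" if E: "E \<in> T" and x: "x \<in> interior E" for E x
  proof -
    have P: "P1_on E \<sigma>" "P1_on E u" "P1_on E \<gamma>"
      using z E XhD(2) WhD P0_imp_P1[OF VhD(2)] by (auto simp: e mixed_space_def)
    have "value_from E u r = 0" "value_from E \<sigma> r = 0" "value_from E \<gamma> r = 0" if r: "r \<in> vertices E" for r
      using 0[OF E r, of "Inl _"] 0[OF E r, of "Inr (Inl (_, _))"] 0[OF E r, of "Inr (Inr (_, _))"]
      by (auto simp: e nodal_value_def vec_eq_iff)
    then show ?thesis
      using P1_constant_if_vertex_values[OF E P(1) _ x] P1_constant_if_vertex_values[OF E P(2) _ x]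
        P1_constant_if_vertex_values[OF E P(3) _ x] by blast
  qed
  then show ?thesis by (auto simp: e discretely_zero_def)
qed

definition load :: "(real^'n) set \<Rightarrow> (real^'n \<Rightarrow> real^'n) \<Rightarrow> (real^'n \<Rightarrow> real^'n) \<Rightarrow> 'n triple \<Rightarrow> real" where
  "load \<Gamma>D f g = (\<lambda>(\<tau>, v, \<xi>). boundary_pairing \<Omega> \<Gamma>D T g \<tau> + L2_inner \<Omega> f v)"

lemma load_linear:
  assumes f: "f \<in> L2 \<Omega>" and g: "g \<in> L2_boundary \<Omega> \<Gamma>D"
  shows "comb_linear comb3 (mixed_space \<Gamma>) (load \<Gamma>D f g)"
  unfolding comb_linear_def
proof (intro ballI allI)
  fix z w c assume z: "z \<in> mixed_space \<Gamma>" and w: "w \<in> mixed_space \<Gamma>"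
  obtain \<sigma> u \<gamma> \<tau> v \<xi> where e: "z = (\<sigma>, u, \<gamma>)" "w = (\<tau>, v, \<xi>)" by (cases z; cases w)
  have X: "\<sigma> \<in> Xh \<Omega> \<Gamma> T" "\<tau> \<in> Xh \<Omega> \<Gamma> T" and V: "u \<in> L2 \<Omega>" "v \<in> L2 \<Omega>"
    using z w VhD by (auto simp: e mixed_space_def)
  have "boundary_pairing \<Omega> \<Gamma>D T g (\<lambda>x. \<sigma> x + c *\<^sub>R \<tau> x) = boundary_pairing \<Omega> \<Gamma>D T g \<sigma> + c * boundary_pairing \<Omega> \<Gamma>D T g \<tau>"
    by (rule boundary_pairing_comb[OF g]) (use X XhD in auto)
  then show "load \<Gamma>D f g (comb3 z c w) = load \<Gamma>D f g z + c * load \<Gamma>D f g w"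
    using L2_inner_comb_right[OF f V, of c] by (simp add: e load_def comb3_def algebra_simps)
qed

lemma load_zero:
  assumes f: "f \<in> L2 \<Omega>" and z: "z \<in> mixed_space \<Gamma>" and z0: "discretely_zero z"
  shows "load \<Gamma>D f g z = 0"
proof -
  obtain \<sigma> u \<gamma> where e: "z = (\<sigma>, u, \<gamma>)" by (cases z)
  have 0: "\<And>E x. E \<in> T \<Longrightarrow> x \<in> interior E \<Longrightarrow> \<sigma> x = 0" "\<And>E x. E \<in> T \<Longrightarrow> x \<in> interior E \<Longrightarrow> u x = 0"
    using z0 by (auto simp: e discretely_zero_def)
  have "u \<in> L2 \<Omega>" using z VhD by (auto simp: e mixed_space_def)
  moreover have "AE x in lebesgue_on \<Omega>. u x = 0" by (rule AE_zero_of_interior) (rule 0(2))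
  ultimately have "L2_inner \<Omega> u f = 0" using L2_inner_zero_left f by blast
  moreover have "boundary_pairing \<Omega> \<Gamma>D T g \<sigma> = 0" by (rule boundary_pairing_zero) (rule 0(1))
  ultimately show ?thesis by (simp add: e load_def L2_inner_commute[of \<Omega> f])
qed

text \<open>The three equations are recovered from the single one by testing with triples that have
one nonzero component.\<close>

lemma msmfe1_solution_iff:
  assumes \<Gamma>: "\<Gamma>N \<subseteq> frontier \<Omega>"
  shows "msmfe1_solution \<Omega> \<Gamma>D \<Gamma>N T A f g \<sigma> u \<gamma> \<longleftrightarrow>
    (\<sigma>, u, \<gamma>) \<in> mixed_space \<Gamma>N \<and> (\<forall>w\<in>mixed_space \<Gamma>N. mixed_form (\<sigma>, u, \<gamma>) w = load \<Gamma>D f g w)"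
proof
  assume "msmfe1_solution \<Omega> \<Gamma>D \<Gamma>N T A f g \<sigma> u \<gamma>"
  then show "(\<sigma>, u, \<gamma>) \<in> mixed_space \<Gamma>N \<and> (\<forall>w\<in>mixed_space \<Gamma>N. mixed_form (\<sigma>, u, \<gamma>) w = load \<Gamma>D f g w)"
    unfolding msmfe1_solution_def by (auto simp: mixed_space_def mixed_form_def load_def)
next
  assume *: "(\<sigma>, u, \<gamma>) \<in> mixed_space \<Gamma>N \<and> (\<forall>w\<in>mixed_space \<Gamma>N. mixed_form (\<sigma>, u, \<gamma>) w = load \<Gamma>D f g w)"
  have X: "\<sigma> \<in> Xh \<Omega> \<Gamma>N T" and V: "u \<in> Vh \<Omega> T" and W: "\<gamma> \<in> Wh1 \<Omega> T" using * by (auto simp: mixed_space_def)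
  note z = zero_in_Xh[OF \<Gamma>] zero_in_Vh zero_in_Wh
  have q0: "quad T v (\<lambda>x. 0) = 0" for v :: "real^'n \<Rightarrow> real^'n^'n"
    unfolding quad_commute[of v] by (rule quad_zero_left) simp
  have b0: "boundary_pairing \<Omega> \<Gamma>D T g (\<lambda>x. 0) = 0" by (rule boundary_pairing_zero) simp
  have d0: "L2_inner \<Omega> u (weak_div \<Omega> (\<lambda>x. 0)) = 0"
  proof -
    have "L2_inner \<Omega> (weak_div \<Omega> (\<lambda>x. 0)) u = 0"
      by (rule L2_inner_zero_left[OF stress_space_weak_div(2)[OF XhD(1)[OF z(1)]] VhD(1)[OF V] weak_div_AE_zero[OF XhD(1)[OF z(1)]]]) simp
    then show ?thesis by (simp add: L2_inner_commute[of \<Omega> u])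
  qed
  have i0: "L2_inner \<Omega> v (\<lambda>x. 0) = 0" for v :: "real^'n \<Rightarrow> real^'n" by (simp add: L2_inner_def)
  have w: "mixed_form (\<sigma>, u, \<gamma>) w = load \<Gamma>D f g w" if "w \<in> mixed_space \<Gamma>N" for w using * that by blast
  have "quad T (\<lambda>x. A x (\<sigma> x)) \<tau> + L2_inner \<Omega> u (weak_div \<Omega> \<tau>) + quad T \<gamma> \<tau> = boundary_pairing \<Omega> \<Gamma>D T g \<tau>"
    if "\<tau> \<in> Xh \<Omega> \<Gamma>N T" for \<tau>
    using w[of "(\<tau>, \<lambda>x. 0, \<lambda>x. 0)"] that z by (simp add: mixed_space_def mixed_form_def load_def q0 i0)
  moreover have "L2_inner \<Omega> (weak_div \<Omega> \<sigma>) v = L2_inner \<Omega> f v" if "v \<in> Vh \<Omega> T" for v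
    using w[of "(\<lambda>x. 0, v, \<lambda>x. 0)"] that z by (simp add: mixed_space_def mixed_form_def load_def q0 b0 d0)
  moreover have "quad T \<sigma> \<xi> = 0" if "\<xi> \<in> Wh1 \<Omega> T" for \<xi>
    using w[of "(\<lambda>x. 0, \<lambda>x. 0, \<xi>)"] that z by (simp add: mixed_space_def mixed_form_def load_def q0 b0 d0 i0)
  ultimately show "msmfe1_solution \<Omega> \<Gamma>D \<Gamma>N T A f g \<sigma> u \<gamma>"
    unfolding msmfe1_solution_def using X V W by blast
qed

lemma msmfe1_well_posed:
  assumes card: "CARD('n) \<in> {2, 3}" and \<Gamma>: "boundary_partition \<Omega> \<Gamma>D \<Gamma>N" "facets_resolve \<Omega> \<Gamma>D \<Gamma>N T"
    and f: "f \<in> L2 \<Omega>" and g: "g \<in> L2_boundary \<Omega> \<Gamma>D"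
    and star: "\<And>E. E \<in> T \<Longrightarrow> \<exists>c\<in>\<Omega>. c \<in> vertices E"
  shows "\<exists>\<sigma> u \<gamma>. msmfe1_solution \<Omega> \<Gamma>D \<Gamma>N T A f g \<sigma> u \<gamma>"
    and "msmfe1_solution \<Omega> \<Gamma>D \<Gamma>N T A f g \<sigma> u \<gamma> \<Longrightarrow> msmfe1_solution \<Omega> \<Gamma>D \<Gamma>N T A f g \<sigma>' u' \<gamma>' \<Longrightarrow>
      (AE x in lebesgue_on \<Omega>. \<sigma> x = \<sigma>' x) \<and> (AE x in lebesgue_on \<Omega>. u x = u' x) \<and> (\<forall>x\<in>\<Omega>. \<gamma> x = \<gamma>' x)"
proof -
  have \<Gamma>f: "\<Gamma>N \<subseteq> frontier \<Omega>" using \<Gamma>(1) by (auto simp: boundary_partition_def)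
  let ?Z = "mixed_space \<Gamma>N"
  have nondeg: "discretely_zero z" if "z \<in> mixed_space \<Gamma>N" "\<And>w. w \<in> mixed_space \<Gamma>N \<Longrightarrow> mixed_form z w = 0" for z
    using mixed_form_nondegenerate[OF card \<Gamma> _ that(1)] star that(2) by blast
  define I :: "(('n + 'n \<times> 'n + 'n \<times> 'n) \<times> (real^'n) set \<times> (real^'n)) set" where
    "I = UNIV \<times> (SIGMA E:T. vertices E)"
  have "\<exists>z\<in>?Z. \<forall>w\<in>?Z. mixed_form z w = load \<Gamma>D f g w"
  proof (rule bilinear_problem_solvable[where K = I and e = nodal_value and cb = comb3])
    show "finite I" unfolding I_def
      by (intro finite_cartesian_product finite_SigmaI) (auto simp: finite_mesh finite_vertices)
    show "comb_closed comb3 ?Z" by (rule comb3_closed)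
    show "?Z \<noteq> {}" by (rule mixed_space_nonempty[OF \<Gamma>f])
    show "comb_linear comb3 ?Z (nodal_value k)" if "k \<in> I" for k
      using that nodal_value_linear by (auto simp: I_def)
    show "comb_linear comb3 ?Z (\<lambda>z. mixed_form z w)" if "w \<in> ?Z" for w using mixed_form_left_linear[OF that] .
    show "comb_linear comb3 ?Z (mixed_form z)" if "z \<in> ?Z" for z using mixed_form_right_linear[OF that] .
    show "mixed_form z w = 0" if "z \<in> ?Z" "w \<in> ?Z" "\<forall>k\<in>I. nodal_value k z = 0" for z w
    proof (rule mixed_form_zero_left[OF that(1,2)])
      show "discretely_zero z" by (rule nodal_values_zero[OF that(1)]) (use that(3) in \<open>auto simp: I_def\<close>)
    qed
    show "comb_linear comb3 ?Z (load \<Gamma>D f g)" by (rule load_linear[OF f g])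
    show "load \<Gamma>D f g w = 0" if w: "w \<in> ?Z" and 0: "\<forall>z\<in>?Z. mixed_form z w = 0" for w
    proof (rule load_zero[OF f w], rule nondeg[OF w])
      fix z assume "z \<in> ?Z"
      then show "mixed_form w z = 0" using 0 mixed_form_symmetric[OF w] by simp
    qed
  qed
  then show "\<exists>\<sigma> u \<gamma>. msmfe1_solution \<Omega> \<Gamma>D \<Gamma>N T A f g \<sigma> u \<gamma>"
    unfolding msmfe1_solution_iff[OF \<Gamma>f] by (metis prod_cases3)
  assume s: "msmfe1_solution \<Omega> \<Gamma>D \<Gamma>N T A f g \<sigma> u \<gamma>" "msmfe1_solution \<Omega> \<Gamma>D \<Gamma>N T A f g \<sigma>' u' \<gamma>'"
  let ?z = "(\<sigma>, u, \<gamma>)" and ?z' = "(\<sigma>', u', \<gamma>')"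
  have z: "?z \<in> ?Z" "?z' \<in> ?Z" using s unfolding msmfe1_solution_iff[OF \<Gamma>f] by auto
  have d: "comb3 ?z (-1) ?z' \<in> ?Z" using comb3_closed z unfolding comb_closed_def by blast
  have "discretely_zero (comb3 ?z (-1) ?z')"
  proof (rule nondeg[OF d])
    fix w assume w: "w \<in> ?Z"
    have "mixed_form (comb3 ?z (-1) ?z') w = mixed_form ?z w + (-1) * mixed_form ?z' w"
      using mixed_form_left_linear[OF w] z unfolding comb_linear_def by blast
    then show "mixed_form (comb3 ?z (-1) ?z') w = 0" using s w unfolding msmfe1_solution_iff[OF \<Gamma>f] by simp
  qed
  then have eq: "\<sigma> x = \<sigma>' x" "u x = u' x" "\<gamma> x = \<gamma>' x" if "E \<in> T" "x \<in> interior E" for E x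
    using that by (auto simp: discretely_zero_def comb3_def)
  have "AE x in lebesgue_on \<Omega>. \<sigma> x = \<sigma>' x" "AE x in lebesgue_on \<Omega>. u x = u' x"
    using AE_interior_element by (eventually_elim, use eq in blast)+
  moreover have "\<gamma> x = \<gamma>' x" if x: "x \<in> \<Omega>" for x
  proof -
    obtain E where E: "E \<in> T" "x \<in> E" using point_in_element[OF x] by blast
    have W: "\<gamma> \<in> Wh1 \<Omega> T" "\<gamma>' \<in> Wh1 \<Omega> T" using z by (auto simp: mixed_space_def)
    have "\<gamma> x = value_from E \<gamma> x" using Wh1_value_in_domain[OF W(1) E x] by simp
    also have "\<dots> = value_from E \<gamma>' x" by (rule value_from_cong_interior) (use eq E in blast)
    also have "\<dots> = \<gamma>' x" by (rule Wh1_value_in_domain[OF W(2) E x])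
    finally show ?thesis .
  qed
  ultimately show "(AE x in lebesgue_on \<Omega>. \<sigma> x = \<sigma>' x) \<and> (AE x in lebesgue_on \<Omega>. u x = u' x) \<and> (\<forall>x\<in>\<Omega>. \<gamma> x = \<gamma>' x)"
    by blast
qed

end

theorem theorem4p3:
  fixes \<Omega> \<Gamma>D \<Gamma>N :: "(real^'n) set"
    and A :: "real^'n \<Rightarrow> real^'n^'n \<Rightarrow> real^'n^'n"
    and f g :: "real^'n \<Rightarrow> real^'n"
    and H :: "real set"
    and T :: "real \<Rightarrow> (real^'n) set set"
    and \<R> :: "(real^'n) set set set"
    and \<kappa> C :: real
  assumes dim: "CARD('n) \<in> {2, 3}"
    and domain: "polyhedral_domain \<Omega>" "simply_connected \<Omega>"
    and boundary: "boundary_partition \<Omega> \<Gamma>D \<Gamma>N"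
    and coefficient: "compliance_tensor \<Omega> A"
    and data: "f \<in> L2 \<Omega>" "g \<in> L2_boundary \<Omega> \<Gamma>D"
    and mesh: "\<And>h. h \<in> H \<Longrightarrow> mesh_of \<Omega> (T h)"
      "\<And>h. h \<in> H \<Longrightarrow> mesh_size (T h) = h"
      "\<And>h. h \<in> H \<Longrightarrow> facets_resolve \<Omega> \<Gamma>D \<Gamma>N (T h)"
      "\<And>h. h \<in> H \<Longrightarrow> shape_regular \<kappa> (T h)"
      "\<And>h. h \<in> H \<Longrightarrow> quasi_uniform C (T h)"
      "\<And>h. h \<in> H \<Longrightarrow> has_vertex_values (T h) A"
    and reference: "finite \<R>" "\<And>M'. M' \<in> \<R> \<Longrightarrow> macroelement \<kappa> M'"
    and partition: "\<And>h. h \<in> H \<Longrightarrow> \<exists>\<M>. vertex_star_partition \<kappa> \<R> \<Omega> (T h) \<M>"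
  shows "\<forall>h\<in>H.
      (\<exists>\<sigma> u \<gamma>. msmfe1_solution \<Omega> \<Gamma>D \<Gamma>N (T h) A f g \<sigma> u \<gamma>) \<and>
      (\<forall>\<sigma> u \<gamma> \<sigma>' u' \<gamma>'.
         msmfe1_solution \<Omega> \<Gamma>D \<Gamma>N (T h) A f g \<sigma> u \<gamma> \<and>
         msmfe1_solution \<Omega> \<Gamma>D \<Gamma>N (T h) A f g \<sigma>' u' \<gamma>' \<longrightarrow>
           (AE x in lebesgue_on \<Omega>. \<sigma> x = \<sigma>' x) \<and>
           (AE x in lebesgue_on \<Omega>. u x = u' x) \<and>
           (\<forall>x\<in>\<Omega>. \<gamma> x = \<gamma>' x))"
proof (intro ballI)
  fix h assume h: "h \<in> H"
  note resolve = mesh(3)[OF h]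
  interpret elastic_mesh \<Omega> "T h" A
    by standard (use domain(1) mesh(1,6)[OF h] coefficient in auto)
  \<comment> \<open>An element of the star of an interior vertex has that vertex among its own.\<close>
  have star: "\<exists>c\<in>\<Omega>. c \<in> vertices E" if E: "E \<in> T h" for E
  proof -
    obtain \<M> where M: "vertex_star_partition \<kappa> \<R> \<Omega> (T h) \<M>" using partition[OF h] by blast
    then have "E \<in> \<Union>\<M>" using E by (simp add: vertex_star_partition_def partition_on_def)
    then obtain M where "M \<in> \<M>" "E \<in> M" by blast
    then obtain c where "c \<in> \<Omega>" "M = vertex_star (T h) c"
      using M unfolding vertex_star_partition_def by blast
    then show ?thesis using \<open>E \<in> M\<close> by (auto simp: vertex_star_def)
  qed
  note wp = msmfe1_well_posed[OF dim boundary resolve data star]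
  show "(\<exists>\<sigma> u \<gamma>. msmfe1_solution \<Omega> \<Gamma>D \<Gamma>N (T h) A f g \<sigma> u \<gamma>) \<and>
      (\<forall>\<sigma> u \<gamma> \<sigma>' u' \<gamma>'.
         msmfe1_solution \<Omega> \<Gamma>D \<Gamma>N (T h) A f g \<sigma> u \<gamma> \<and>
         msmfe1_solution \<Omega> \<Gamma>D \<Gamma>N (T h) A f g \<sigma>' u' \<gamma>' \<longrightarrow>
           (AE x in lebesgue_on \<Omega>. \<sigma> x = \<sigma>' x) \<and>
           (AE x in lebesgue_on \<Omega>. u x = u' x) \<and>
           (\<forall>x\<in>\<Omega>. \<gamma> x = \<gamma>' x))"
    using wp by blast
qed

end
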